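(* Let $p,q$ be distinct primes $\ge3$, $m=pq$, $m'=\lfloor m/2\rfloor$. Let $\mathcal{H}_p,\mathcal{H}_q$, $C_k$, $C'_l$, $q^*$, $p^*$ be as in the context, with $1\in\mathcal{H}_p$ and $1\in\mathcal{H}_q$, and put $\mathcal{H}'_p=\mathcal{H}_p\setminus\{1\}$, $\mathcal{H}'_q=\mathcal{H}_q\setminus\{1\}$. For $k\in\mathcal{H}'_p$ and $l\in\mathcal{H}'_q$ define (with the convention $Y_1=0$) $$R_{p,k}=\sum_{j\in C_k}Y_j-\sum_{j\in C_1}Y_j-Y_{(qk)_{red}}+Y_{(qq^*k)_{red}}-Y_{(qq^* )_{red}}+Y_q,$$ $$R_{q,l}=\sum_{j\in C'_l}Y_j-\sum_{j\in C'_1}Y_j-Y_{(pl)_{red}}+Y_{(pp^*l)_{red}}-Y_{(pp^* )_{red}}+Y_p.$$ Then the forms $R_{p,k}$, $k\in\mathcal{H}'_p$, together with $R_{q,l}$, $l\in\mathcal{H}'_q$, form a $\mathbb{Q}$-basis of the $\mathbb{Q}$-vector space of $U$-relations.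
   Context: For $k=1,\dots,m'$ let $U_k=\log_2\!\left(\frac{\sin(\pi k/m)}{\sin(\pi/m)}\right)$. A $U$-relation is a linear form $\sum_{k=2}^{m'}c_kY_k$, $c_k\in\mathbb{Q}$, in variables $Y_2,\dots,Y_{m'}$ with $\sum_{k=2}^{m'}c_kU_k=0$. For an integer $a\not\equiv0\pmod m$, $a_{red}$ is the unique integer in $\{1,\dots,m'\}$ with $a_{red}\equiv\pm a\pmod m$. $\mathcal{H}_p$ is a set of integers such that every $k\in\mathcal{H}_p$ satisfies $\gcd(k,q)=1$; for every $j\in\{1,\dots,(p-1)/2\}$ there is $k\in\mathcal{H}_p$ with $k\equiv j\pmod p$; and $k\not\equiv\pm k'\pmod p$ for distinct $k,k'\in\mathcal{H}_p$. $\mathcal{H}_q$ is defined symmetrically with the roles of $p$ and $q$ exchanged. For $k\in\mathcal{H}_p$, $C_k=\{(kj)_{red}: j\in\{1,\dots,m\},\ j\equiv1\pmod p,\ \gcd(j,q)=1\}$; for $l\in\mathcal{H}_q$, $C'_l=\{(lj)_{red}: j\in\{1,\dots,m\},\ j\equiv1\pmod q,\ \gcd(j,p)=1\}$. $q^*$ is a fixed integer with $qq^*\equiv1\pmod p$, and $p^*$ a fixed integer with $pp^*\equiv1\pmod q$. *)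

theory Defs
  imports "HOL-Analysis.Analysis" "HOL-Number_Theory.Cong" "HOL-Library.Poly_Mapping"
begin

text \<open>
  Rational linear forms in variables indexed by natural numbers are finitely supported
  functions \<open>nat \<Rightarrow>\<^sub>0 rat\<close>: the coefficient of the \<open>k\<close>-th variable in \<open>f\<close> is
  \<open>Poly_Mapping.lookup f k\<close>.
\<close>

definition lf_scale :: "rat \<Rightarrow> (nat \<Rightarrow>\<^sub>0 rat) \<Rightarrow> (nat \<Rightarrow>\<^sub>0 rat)" where
  "lf_scale c f = Poly_Mapping.map ((*) c) f"

lemma lookup_lf_scale [simp]:
  "Poly_Mapping.lookup (lf_scale c f) k = c * Poly_Mapping.lookup f k"
  by (simp add: lf_scale_def Poly_Mapping.map.rep_eq when_def)

interpretation lf: vector_space lf_scale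
  by unfold_locales (rule poly_mapping_eqI, simp add: lookup_add algebra_simps)+

text \<open>
  Bases are indexed families, so injectivity on the index set is part of the definition.
\<close>

definition lf_basis :: "('i \<Rightarrow> (nat \<Rightarrow>\<^sub>0 rat)) \<Rightarrow> 'i set \<Rightarrow> (nat \<Rightarrow>\<^sub>0 rat) set \<Rightarrow> bool" where
  "lf_basis B I V \<longleftrightarrow> inj_on B I \<and> lf.independent (B ` I) \<and> lf.span (B ` I) = V"

text \<open>The variable \<open>Y\<^sub>k\<close> as a linear form, with the convention \<open>Y\<^sub>1 = 0\<close>.\<close>

definition Yvar :: "nat \<Rightarrow> (nat \<Rightarrow>\<^sub>0 rat)" where
  "Yvar k = (if k = 1 then 0 else Poly_Mapping.single k 1)"

definition Uval :: "nat \<Rightarrow> nat \<Rightarrow> real" where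
  "Uval m k = log 2 (sin (pi * real k / real m) / sin (pi / real m))"

definition U_relations :: "nat \<Rightarrow> (nat \<Rightarrow>\<^sub>0 rat) set" where
  "U_relations m = {f. Poly_Mapping.keys f \<subseteq> {2..m div 2} \<and>
     (\<Sum>k = 2..m div 2. of_rat (Poly_Mapping.lookup f k) * Uval m k) = 0}"

text \<open>
  The description determines \<open>red m a\<close> exactly when \<open>a\<close> is not divisible by \<open>m\<close>;
  otherwise the value is unspecified.
\<close>

definition red :: "nat \<Rightarrow> int \<Rightarrow> nat" where
  "red m a = (THE r. r \<in> {1..m div 2} \<and>
     ([int r = a] (mod int m) \<or> [int r = - a] (mod int m)))"

lemma red_unique_existence:
  assumes "\<not> [a = 0] (mod int m)" "m > 0"
  shows "\<exists>!r. r \<in> {1..m div 2} \<and> ([int r = a] (mod int m) \<or> [int r = - a] (mod int m))"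
proof -
  define b where "b = a mod int m"
  have m: "int m > 0" using assms(2) by simp
  have "b \<noteq> 0" using assms(1) by (simp add: b_def cong_def)
  moreover have "0 \<le> b" "b < int m" using m by (simp_all add: b_def)
  ultimately have b: "0 < b" "b < int m" by simp_all
  have "[b = a] (mod int m)" by (simp add: b_def)
  then have ab: "int m dvd b - a" by (simp only: cong_iff_dvd_diff)
  define r where "r = nat (min b (int m - b))"
  have r_int: "int r = min b (int m - b)" using b by (simp add: r_def)
  then have r: "r \<in> {1..m div 2}" using b by (simp add: min_def split: if_splits)
  have "int m dvd (int m - b) + a"
    using dvd_diff[OF dvd_refl ab] by (simp add: algebra_simps)
  then have r': "int m dvd int r - a \<or> int m dvd int r + a"
    using ab by (auto simp: r_int min_def)
  have unique: "s = r" if s: "s \<in> {1..m div 2}"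
    and s': "int m dvd int s - a \<or> int m dvd int s + a" for s
  proof -
    have "int m dvd int s - int r \<or> int m dvd int s + int r"
      using s'
    proof
      assume sa: "int m dvd int s - a"
      show ?thesis using r'
      proof
        assume "int m dvd int r - a"
        from dvd_diff[OF sa this] have "int m dvd int s - int r" by simp
        then show ?thesis ..
      next
        assume "int m dvd int r + a"
        from dvd_add[OF sa this] have "int m dvd int s + int r" by simp
        then show ?thesis ..
      qed
    next
      assume sa: "int m dvd int s + a"
      show ?thesis using r'
      proof
        assume "int m dvd int r - a"
        from dvd_add[OF sa this] have "int m dvd int s + int r" by simp
        then show ?thesis ..
      next
        assume "int m dvd int r + a"
        from dvd_diff[OF sa this] have "int m dvd int s - int r" by simp
        then show ?thesis ..
      qed
    qed
    then show ?thesis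
    proof
      assume d: "int m dvd int s - int r"
      have "\<bar>int s - int r\<bar> < int m" using s r by simp linarith
      then have "int s - int r = 0"
        using dvd_imp_le_int[OF _ d] by linarith
      then show ?thesis by simp
    next
      assume "int m dvd int s + int r"
      moreover have "int s + int r > 0" using s by simp
      ultimately have "int m \<le> int s + int r" by (rule zdvd_imp_le)
      then have "m \<le> s + r" by linarith
      moreover have "s \<le> m div 2" "r \<le> m div 2" using s r by simp_all
      ultimately show ?thesis by linarith
    qed
  qed
  have eq: "([int s = a] (mod int m) \<or> [int s = - a] (mod int m)) \<longleftrightarrow>
      (int m dvd int s - a \<or> int m dvd int s + a)" for s
    by (simp only: cong_iff_dvd_diff diff_minus_eq_add)
  show ?thesis unfolding eq
    by (rule ex1I[of _ r]) (use r r' in simp, use unique in blast)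
qed

text \<open>
  The definitions below are for the pair \<open>(p, q)\<close>; their counterparts with the roles of the two
  primes exchanged are obtained by swapping the arguments. In particular \<open>\<H>\<^sub>q\<close>, \<open>C'\<^sub>l\<close> and
  \<open>R\<^bsub>q,l\<^esub>\<close> are \<open>cyc_reps q p\<close>, \<open>cyc_orbit q p l\<close> and \<open>Rform q p ps l\<close>. The argument \<open>qs\<close>
  of \<open>Rform p q qs k\<close> is the inverse \<open>q\<^sup>*\<close> of \<open>q\<close> modulo \<open>p\<close>.
\<close>

definition cyc_reps :: "nat \<Rightarrow> nat \<Rightarrow> int set \<Rightarrow> bool" where
  "cyc_reps p q H \<longleftrightarrow>
     (\<forall>k\<in>H. gcd k (int q) = 1) \<and>
     (\<forall>j\<in>{1..(p - 1) div 2}. \<exists>k\<in>H. [k = int j] (mod int p)) \<and>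
     (\<forall>k\<in>H. \<forall>k'\<in>H. k \<noteq> k' \<longrightarrow> \<not> [k = k'] (mod int p) \<and> \<not> [k = - k'] (mod int p))"

definition cyc_orbit :: "nat \<Rightarrow> nat \<Rightarrow> int \<Rightarrow> nat set" where
  "cyc_orbit p q k =
     {red (p * q) (k * int j) | j. j \<in> {1..p * q} \<and> [j = 1] (mod p) \<and> gcd j q = 1}"

definition Rform :: "nat \<Rightarrow> nat \<Rightarrow> int \<Rightarrow> int \<Rightarrow> (nat \<Rightarrow>\<^sub>0 rat)" where
  "Rform p q qs k = (\<Sum>j\<in>cyc_orbit p q k. Yvar j) - (\<Sum>j\<in>cyc_orbit p q 1. Yvar j)
     - Yvar (red (p * q) (int q * k)) + Yvar (red (p * q) (int q * qs * k))
     - Yvar (red (p * q) (int q * qs)) + Yvar q"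

end

theory Submission
  imports Defs "HOL-Number_Theory.Number_Theory" "HOL-Real_Asymp.Real_Asymp"
begin

text \<open>
  Write \<open>v a = ln \<bar>1 - \<zeta>^a\<bar>\<close> with \<open>\<zeta>\<close> a primitive \<open>m\<close>-th root of unity, so that
  \<open>U k = (v k - v 1) / ln 2\<close>. The forms \<open>R\<close> are differences of the distribution relations
  \<open>\<Sum>i<q. v (k + p * i) = v (q * k)\<close>, which makes them \<open>U\<close>-relations; on the variables with index
  prime to \<open>m\<close> they only see the index modulo \<open>p\<close> or modulo \<open>q\<close>, which by the Chinese remainder
  theorem makes them independent.

  For the spanning property let \<open>\<Sum>a. w a * v a = 0\<close> be a rational relation with \<open>w\<close> even. As
  an identity between products of the numbers \<open>1 - \<zeta>^a\<close> it is stable under Galois conjugation, that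
  is, \<open>\<Sum>a. w a * v (t * a) = 0\<close> for all \<open>t\<close> prime to \<open>m\<close>. Summing this against an even
  character \<open>X = X\<^sub>p X\<^sub>q\<close> with both factors nontrivial, and using \<open>\<Sum>t. X t * v t \<noteq> 0\<close> (a Gauss
  sum times \<open>L(1)\<close> of the conjugate character), shows that \<open>w\<close> is orthogonal to all such products. Hence on
  units \<open>w a\<close> is a function of \<open>a mod p\<close> plus a function of \<open>a mod q\<close>, and subtracting distribution
  relations makes \<open>w\<close> vanish on units. The characters modulo \<open>q\<close> then show that \<open>w\<close> is constant on
  the multiples of \<open>p\<close>, and likewise with \<open>p\<close> and \<open>q\<close> exchanged; since
  \<open>\<Sum>b. v (p * b) = ln q\<close> and \<open>ln p\<close>, \<open>ln q\<close> are linearly independent over the rationals, both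
  constants are zero.
\<close>

section \<open>Galois conjugation at roots of unity\<close>

text \<open>Why both factors of \<open>X\<close> must be nontrivial on units: such products are
  primitive modulo \<open>m\<close>. For a primitive even character \<open>X\<close> modulo
  \<open>p\<close> alone, the sum of \<open>X t * v t\<close> over the units modulo \<open>m\<close>
  carries the Euler factor \<open>1 - X q\<close>, which can vanish. So functions of
  \<open>a mod p\<close> alone or of \<open>a mod q\<close> alone are not excluded, and this is
  exactly the room that the distribution relations fill.

  The index 1 shapes the rest. Since \<open>U 1 = 0\<close> and \<open>Y 1 = 0\<close>, its
  coefficient is invisible. For spanning it is restored as the value that makes all coefficients add
  up to zero, which turns a relation between the \<open>U k\<close> into one between the
  \<open>v k\<close>. Distribution relations for different \<open>k\<close> modulo the same prime
  have equal coefficient sums, hence the differences from \<open>k = 1\<close>. For independence the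
  equation at the lost residues 1 and -1 is bypassed by a change of sign in one component.

  Galois conjugation is derived from congruences for \<open>l\<close>-th powers, without field
  automorphisms. \<open>L(1)\<close> is handled on the real axis only: an Euler product argument
  when \<open>X^2\<close> is nontrivial, a Lambert series when \<open>X\<close> is real.\<close>

text \<open>Integer polynomials are kept as functions with an inductive generation rule, because the
  congruence for \<open>l\<close>-th powers and the bound on denominators are both proved by
  induction on how \<open>F\<close> is built.\<close>

inductive int_polyfun :: "(complex \<Rightarrow> complex) \<Rightarrow> bool" where
  const: "int_polyfun (\<lambda>_. of_int c)"
| id: "int_polyfun (\<lambda>z. z)"
| add: "int_polyfun F \<Longrightarrow> int_polyfun G \<Longrightarrow> int_polyfun (\<lambda>z. F z + G z)"
| mult: "int_polyfun F \<Longrightarrow> int_polyfun G \<Longrightarrow> int_polyfun (\<lambda>z. F z * G z)"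

lemma int_polyfun_of_nat: "int_polyfun (\<lambda>_. of_nat c)" using int_polyfun.const[of "int c"] by simp

lemma int_polyfun_diff:
  assumes "int_polyfun F" "int_polyfun G"
  shows "int_polyfun (\<lambda>z. F z - G z)"
  using int_polyfun.add[OF assms(1) int_polyfun.mult[OF int_polyfun.const[of "-1"] assms(2)]] by simp

lemma int_polyfun_prod:
  assumes "\<And>i. i \<in> A \<Longrightarrow> int_polyfun (F i)"
  shows "int_polyfun (\<lambda>z. \<Prod>i\<in>A. F i z)" using assms
  by (induction A rule: infinite_finite_induct)
     (auto intro: int_polyfun.mult int_polyfun.const[of 1, simplified])

lemma int_polyfun_sum:
  assumes "\<And>i. i \<in> A \<Longrightarrow> int_polyfun (F i)"
  shows "int_polyfun (\<lambda>z. \<Sum>i\<in>A. F i z)" using assms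
  by (induction A rule: infinite_finite_induct)
     (auto intro: int_polyfun.add int_polyfun.const[of 0, simplified])

lemma int_polyfun_power:
  assumes "int_polyfun F"
  shows "int_polyfun (\<lambda>z. F z ^ n)" using int_polyfun_prod[of "{..<n}" "\<lambda>_. F"] assms by simp

lemma int_polyfun_compose:
  assumes "int_polyfun F" "int_polyfun G"
  shows "int_polyfun (\<lambda>z. F (G z))" using assms by induction (auto intro: int_polyfun.intros)

lemma fermat_int:
  fixes a :: int
  assumes "prime l"
  shows "int l dvd a ^ l - a"
proof -
  have l0: "l > 0" using assms prime_gt_0_nat by blast
  obtain n where n: "[a = int n] (mod int l)"
    using l0 by (metis cong_mod_right cong_refl of_nat_0_less_iff pos_mod_sign zero_le_imp_eq_int)
  have "[n ^ l = n] (mod l)"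
  proof (cases "l dvd n")
    case True
    then show ?thesis using l0 by (meson cong_0_iff cong_sym cong_trans dvd_power dvd_trans)
  next
    case False
    then have "[n ^ (l - 1) * n = 1 * n] (mod l)" using fermat_theorem assms cong_scalar_right by blast
    then show ?thesis using l0 by (metis mult_1 power_minus_mult)
  qed
  then have "[int n ^ l = int n] (mod int l)" using cong_int_iff by (metis of_nat_power)
  then have "[a ^ l = a] (mod int l)" using n by (meson cong_pow cong_sym cong_trans)
  then show ?thesis by (simp add: cong_iff_dvd_diff)
qed

text \<open>Frobenius modulo \<open>l\<close>: constants are handled by Fermat's little theorem,
  sums by the divisibility of the middle binomial coefficients, products by multiplying out. The
  error term must stay an integer polynomial so that its values lie in the ring generated by the
  root of unity.\<close>

lemma int_polyfun_power_prime:
  assumes "int_polyfun F" and l: "prime l"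
  shows "\<exists>G. int_polyfun G \<and> (\<forall>z. F z ^ l = F (z ^ l) + of_nat l * G z)" using assms(1)
proof induction
  case (const c)
  obtain d where "c ^ l = c + int l * d"
    using fermat_int[OF l, of c] by (metis add.commute diff_add_cancel dvdE)
  then have "(of_int c :: complex) ^ l = of_int c + of_nat l * of_int d"
    by (metis of_int_add of_int_mult of_int_of_nat_eq of_int_power)
  then show ?case using int_polyfun.const by blast
next
  case id
  show ?case using int_polyfun.const[of 0] by (intro exI[of _ "\<lambda>_. 0"]) simp
next
  case (add F1 F2)
  then obtain G1 G2 where G: "int_polyfun G1" "\<And>z. F1 z ^ l = F1 (z ^ l) + of_nat l * G1 z"
    "int_polyfun G2" "\<And>z. F2 z ^ l = F2 (z ^ l) + of_nat l * G2 z" by blast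
  have l0: "l > 0" using l prime_gt_0_nat by blast
  \<comment> \<open>The middle binomial terms with the factor \<open>l\<close> divided out of the
    binomial coefficients.\<close>
  define K where "K = (\<lambda>z. \<Sum>k\<in>{0<..<l}. of_nat ((l choose k) div l) * (F1 z ^ k * F2 z ^ (l - k)))"
  have "int_polyfun K" unfolding K_def
    by (intro int_polyfun_sum int_polyfun.mult int_polyfun_of_nat int_polyfun_power add)
  have "(F1 z + F2 z) ^ l = F1 z ^ l + F2 z ^ l + of_nat l * K z" for z
  proof -
    have "(F1 z + F2 z) ^ l = (\<Sum>k\<le>l. of_nat (l choose k) * F1 z ^ k * F2 z ^ (l - k))" by (rule binomial_ring)
    also have "{..l} = insert 0 (insert l {0<..<l})" using l0 by auto
    also have "(\<Sum>k\<in>insert 0 (insert l {0<..<l}). of_nat (l choose k) * F1 z ^ k * F2 z ^ (l - k))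
       = F2 z ^ l + (F1 z ^ l + (\<Sum>k\<in>{0<..<l}. of_nat (l choose k) * F1 z ^ k * F2 z ^ (l - k)))"
      using l0 by simp
    also have "(\<Sum>k\<in>{0<..<l}. of_nat (l choose k) * F1 z ^ k * F2 z ^ (l - k)) = of_nat l * K z"
      unfolding K_def sum_distrib_left
    proof (rule sum.cong[OF refl], goal_cases)
      case (1 k)
      then have "l dvd (l choose k)" using l by (intro dvd_choose_prime) auto
      then have "of_nat (l choose k) = (of_nat l * of_nat ((l choose k) div l) :: complex)"
        by (metis dvd_mult_div_cancel of_nat_mult)
      then show ?case by simp
    qed
    finally show ?thesis by simp
  qed
  then have "(F1 z + F2 z) ^ l = F1 (z ^ l) + F2 (z ^ l) + of_nat l * (G1 z + G2 z + K z)" for z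
    using G by (simp add: algebra_simps)
  moreover have "int_polyfun (\<lambda>z. G1 z + G2 z + K z)"
    by (intro int_polyfun.add G \<open>int_polyfun K\<close>)
  ultimately show ?case by blast
next
  case (mult F1 F2)
  then obtain G1 G2 where G: "int_polyfun G1" "\<And>z. F1 z ^ l = F1 (z ^ l) + of_nat l * G1 z"
    "int_polyfun G2" "\<And>z. F2 z ^ l = F2 (z ^ l) + of_nat l * G2 z" by blast
  have "(F1 z * F2 z) ^ l = F1 (z ^ l) * F2 (z ^ l) +
    of_nat l * (F1 (z ^ l) * G2 z + G1 z * F2 (z ^ l) + of_nat l * (G1 z * G2 z))" for z
    using G by (simp add: power_mult_distrib algebra_simps)
  moreover have "int_polyfun (\<lambda>z. F1 (z ^ l) * G2 z + G1 z * F2 (z ^ l) + of_nat l * (G1 z * G2 z))"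
    by (intro int_polyfun.add int_polyfun.mult int_polyfun_of_nat G
        int_polyfun_compose[OF mult(1)] int_polyfun_compose[OF mult(2)] int_polyfun_power int_polyfun.id)
  ultimately show ?case by (intro exI conjI) auto
qed

text \<open>A \<open>\<rat>\<close>-linear functional that is \<open>1\<close> at \<open>\<alpha>\<close> takes values with bounded denominators
  on the ring generated by a root of unity.\<close>

lemma prime_divisors_in_cyclotomic_ring:
  fixes z \<alpha> :: complex
  assumes "z ^ m = 1" "m > 0" "\<alpha> \<noteq> 0"
  shows "\<exists>D>0. \<forall>l F. int_polyfun F \<longrightarrow> \<alpha> = of_nat l * F z \<longrightarrow> l dvd D"
proof -
  interpret vs: vector_space "\<lambda>(q::rat) (x::complex). of_rat q * x"
    by unfold_locales (auto simp: algebra_simps of_rat_add of_rat_mult)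
  interpret vr: vector_space "(*) :: rat \<Rightarrow> rat \<Rightarrow> rat"
    by unfold_locales (auto simp: algebra_simps)
  interpret vp: vector_space_pair "\<lambda>(q::rat) (x::complex). of_rat q * x" "(*) :: rat \<Rightarrow> rat \<Rightarrow> rat" ..
  have "vs.independent {\<alpha>}" using assms(3) by simp
  from vp.linear_independent_extend[OF this, of "\<lambda>_. 1"] obtain \<phi> where
    lin: "Vector_Spaces.linear (\<lambda>(q::rat) (x::complex). of_rat q * x) ((*) :: rat \<Rightarrow> rat \<Rightarrow> rat) \<phi>"
    and \<phi>\<alpha>: "\<phi> \<alpha> = 1" by auto
  interpret \<phi>: Vector_Spaces.linear "\<lambda>(q::rat) (x::complex). of_rat q * x" "(*) :: rat \<Rightarrow> rat \<Rightarrow> rat" \<phi>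
    by (fact lin)
  define den where "den = (\<lambda>k. snd (quotient_of (\<phi> (z ^ k))))"
  \<comment> \<open>A common denominator of \<open>\<phi>\<close> on the powers of \<open>z\<close>
    below \<open>m\<close>, hence on all powers, which repeat with period \<open>m\<close>.\<close>
  define D where "D = (\<Prod>k<m. den k)"
  have den: "den k > 0" "of_int (den k) * \<phi> (z ^ k) \<in> \<int>" for k
  proof -
    show "den k > 0" by (simp add: den_def quotient_of_denom_pos')
    then show "of_int (den k) * \<phi> (z ^ k) \<in> \<int>" unfolding den_def
      by (subst (2) quotient_of_div[of "\<phi> (z ^ k)" "fst (quotient_of (\<phi> (z ^ k)))" "snd (quotient_of (\<phi> (z ^ k)))"]) auto
  qed
  have D0: "D > 0" unfolding D_def using den by (simp add: prod_pos)
  have DZ: "of_int D * \<phi> (z ^ k) \<in> \<int>" for k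
  proof -
    have "z ^ k = z ^ (k mod m)"
      by (metis assms(1) div_mult_mod_eq mult.commute mult_1 power_add power_mult power_one)
    moreover have "den (k mod m) dvd D" unfolding D_def using assms(2) by (intro dvd_prodI) auto
    then obtain e where "D = e * den (k mod m)" by (metis dvdE mult.commute)
    then have "of_int D * \<phi> (z ^ (k mod m)) = of_int e * (of_int (den (k mod m)) * \<phi> (z ^ (k mod m)))"
      by simp
    ultimately show ?thesis using den by (metis Ints_mult Ints_of_int)
  qed
  \<comment> \<open>The arbitrary factor \<open>w\<close> strengthens the induction: in the product
    case \<open>G z * w\<close> takes the place of \<open>w\<close>.\<close>
  have gen: "\<forall>j. of_int D * \<phi> (F z * w * z ^ j) \<in> \<int>"
    if "int_polyfun F" "\<forall>j. of_int D * \<phi> (w * z ^ j) \<in> \<int>" for F w using that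
  proof (induction arbitrary: w)
    case (const c)
    have "of_int D * \<phi> (of_int c * w * z ^ j) = of_int c * (of_int D * \<phi> (w * z ^ j))" for j
      using \<phi>.scale[of "of_int c" "w * z ^ j"] by (simp add: mult_ac)
    then show ?case using const by (metis Ints_mult Ints_of_int)
  next
    case id
    show ?case
    proof
      fix j show "of_int D * \<phi> (z * w * z ^ j) \<in> \<int>"
        using spec[OF id, of "Suc j"] by (simp add: mult_ac)
    qed
  next
    case (add F G)
    show ?case
    proof
      fix j
      have "(F z + G z) * w * z ^ j = F z * w * z ^ j + G z * w * z ^ j" by (simp add: algebra_simps)
      then have "of_int D * \<phi> ((F z + G z) * w * z ^ j) = of_int D * \<phi> (F z * w * z ^ j) + of_int D * \<phi> (G z * w * z ^ j)"
        by (simp add: \<phi>.add distrib_left)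
      then show "of_int D * \<phi> ((F z + G z) * w * z ^ j) \<in> \<int>" using add.IH[OF add.prems] by auto
    qed
  next
    case (mult F G)
    from mult.IH(1)[of "G z * w"] mult.IH(2)[OF mult.prems]
    show ?case by (simp add: mult_ac)
  qed
  show ?thesis
  proof (intro exI[of _ "nat D"] conjI allI impI)
    show "0 < nat D" using D0 by simp
    fix l F assume F: "int_polyfun F" and \<alpha>: "\<alpha> = of_nat l * F z"
    have "of_int D * \<phi> (F z) \<in> \<int>"
      using gen[OF F, of 1] DZ by (metis mult.right_neutral mult_1 power_0)
    then obtain c where c: "of_int D * \<phi> (F z) = of_int c" by (elim Ints_cases)
    have "(1::rat) = of_nat l * \<phi> (F z)"
      using \<phi>.scale[of "of_nat l" "F z"] \<phi>\<alpha> \<alpha> by simp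
    then have "rat_of_int D = of_int (int l * c)" using c
      by (metis mult.left_commute mult.right_neutral of_int_mult of_int_of_nat_eq)
    then have "D = int l * c" by (simp only: of_int_eq_iff)
    then show "l dvd nat D" using D0 by (metis dvd_triv_left int_dvd_int_iff int_nat_eq less_imp_le)
  qed
qed

text \<open>Add to \<open>t\<close> the multiple \<open>m * s\<close>, where \<open>s\<close>
  collects the primes of \<open>A\<close> not dividing \<open>t\<close>. A prime of \<open>A\<close>
  dividing \<open>t\<close> divides neither \<open>m\<close> nor \<open>s\<close>; any other prime
  of \<open>A\<close> divides \<open>s\<close> but not \<open>t\<close>. The further summand
  \<open>m * A\<close> changes neither property and makes positivity immediate.\<close>

lemma coprime_shift_exists:
  fixes t m A :: nat
  assumes "coprime t m" "A > 0"
  shows "\<exists>n>0. [n = t] (mod m) \<and> coprime n A"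
proof -
  define s where "s = \<Prod>{l \<in> prime_factors A. \<not> l dvd t}"
  have "coprime (t + m * s) A"
  proof (rule ccontr)
    assume "\<not> coprime (t + m * s) A"
    then obtain l where l: "prime l" "l dvd t + m * s" "l dvd A"
      by (metis coprime_iff_gcd_eq_1 gcd_nat.boundedE prime_factor_nat)
    have lA: "l \<in> prime_factors A" using l assms by (simp add: in_prime_factors_iff)
    show False
    proof (cases "l dvd t")
      case True
      then have "l dvd m * s" using l by (simp add: dvd_add_right_iff)
      moreover have "\<not> l dvd m" using True assms(1) l(1) by (meson coprime_common_divisor not_prime_unit)
      ultimately have "l dvd s" using l prime_dvd_mult_iff by blast
      then obtain x where "x \<in> {l \<in> prime_factors A. \<not> l dvd t}" "l dvd x" unfolding s_def
        using prime_dvd_prod_iff[of "{l \<in> prime_factors A. \<not> l dvd t}" l "\<lambda>x. x"] l by auto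
      then have "x = l" using l primes_dvd_imp_eq[of l x] by (auto simp: in_prime_factors_iff)
      then show False using True \<open>x \<in> _\<close> by auto
    next
      case False
      then have "l dvd s" unfolding s_def using lA by (intro dvd_prodI) auto
      then show False using False l by (metis dvd_add_left_iff dvd_mult)
    qed
  qed
  then have "coprime (t + m * s + m * A) A" by (metis coprime_iff_gcd_eq_1 gcd_add_mult mult.commute add.commute gcd.commute)
  moreover have "[t + m * s + m * A = t] (mod m)" by (simp add: cong_def)
  moreover have "t + m * s + m * A > 0" using assms by (cases "m = 0") auto
  ultimately show ?thesis by blast
qed

text \<open>If \<open>F (z ^ k) = 0\<close> and \<open>l\<close> is prime, then \<open>F (z ^ (k * l))\<close> is divisible by \<open>l\<close>, because
  \<open>F\<close> commutes with \<open>l\<close>-th powers modulo \<open>l\<close>; for all but finitely many \<open>l\<close> this forces it to be zero,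
  and every unit modulo \<open>m\<close> is represented by a product of such \<open>l\<close>.\<close>

theorem int_polyfun_galois:
  assumes F: "int_polyfun F" and z: "z ^ m = 1" "m > 0" and "F z = 0" "coprime t m"
  shows "F (z ^ t) = 0"
proof -
  have red: "z ^ k = z ^ (k mod m)" for k
    by (metis z(1) div_mult_mod_eq mult.commute mult_1 power_add power_mult power_one)
  \<comment> \<open>One bound for each value \<open>F (z ^ r)\<close>. Where this value is 0 nothing
    is required, and \<open>D = 1\<close> serves.\<close>
  have "\<forall>r. \<exists>D>0. F (z ^ r) \<noteq> 0 \<longrightarrow> (\<forall>l G. int_polyfun G \<longrightarrow> F (z ^ r) = of_nat l * G z \<longrightarrow> l dvd D)"
    using prime_divisors_in_cyclotomic_ring[OF z] by (metis zero_less_one)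
  then obtain D where D: "\<And>r. D r > (0::nat)"
    "\<And>r l G. F (z ^ r) \<noteq> 0 \<Longrightarrow> int_polyfun G \<Longrightarrow> F (z ^ r) = of_nat l * G z \<Longrightarrow> l dvd D r" by metis
  define A where "A = (\<Prod>r<m. D r)"
  have "A > 0" unfolding A_def using D by (simp add: prod_pos)
  then obtain n where n: "n > 0" "[n = t] (mod m)" "coprime n A" using coprime_shift_exists assms by metis
  have "F (z ^ n) = 0" using n(1,3)
  proof (induction n rule: nat_less_induct)
    case (1 n)
    show ?case
    proof (cases "n = 1")
      case True
      then show ?thesis using assms by simp
    next
      case False
      then obtain l where l: "prime l" "l dvd n" using prime_factor_nat by blast
      then obtain k where k: "n = k * l" by (metis dvdE mult.commute)
      have "k < n" "k > 0" using k 1 l prime_gt_1_nat by (auto intro: gr0I)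
      moreover have cop: "coprime k A" "coprime l A" using 1 k by auto
      ultimately have Fk: "F (z ^ k) = 0" using 1 by blast
      obtain G where G: "int_polyfun G" "\<And>z. F z ^ l = F (z ^ l) + of_nat l * G z"
        using int_polyfun_power_prime[OF F l(1)] by blast
      have "F (z ^ n) = of_nat l * (- G (z ^ k))" using G(2)[of "z ^ k"] Fk l prime_gt_0_nat
        by (simp add: k power_mult power_0_left add_eq_0_iff2)
      also have "- G (z ^ k) = (\<lambda>z. 0 - G (z ^ k)) z" by simp
      finally have "F (z ^ (n mod m)) = of_nat l * (\<lambda>z. 0 - G (z ^ k)) z" using red by metis
      moreover have "int_polyfun (\<lambda>z. 0 - G (z ^ k))"
        by (intro int_polyfun_diff int_polyfun_compose[OF G(1)] int_polyfun_power int_polyfun.id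
            int_polyfun.const[of 0, simplified])
      ultimately have "F (z ^ (n mod m)) \<noteq> 0 \<Longrightarrow> l dvd D (n mod m)" using D(2) by blast
      \<comment> \<open>A nonzero value would make \<open>l\<close> divide \<open>A\<close>, but
        \<open>l\<close> divides \<open>n\<close>, which is coprime to \<open>A\<close>.\<close>
      moreover have "D (n mod m) dvd A" unfolding A_def using z by (intro dvd_prodI) auto
      ultimately have "F (z ^ (n mod m)) \<noteq> 0 \<Longrightarrow> l dvd A" using dvd_trans by blast
      then show ?thesis using cop(2) l(1) red by (metis coprime_absorb_left not_prime_unit)
    qed
  qed
  then show ?thesis using n(2) red by (metis cong_def)
qed

section \<open>Dirichlet characters and summation by parts\<close>

lemma summation_by_parts:
  fixes f :: "nat \<Rightarrow> complex" and a :: "nat \<Rightarrow> real"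
  shows "(\<Sum>k<n. a k *\<^sub>R f k) - a 0 *\<^sub>R L =
    a n *\<^sub>R ((\<Sum>k<n. f k) - L) + (\<Sum>k<n. (a k - a (Suc k)) *\<^sub>R ((\<Sum>j<Suc k. f j) - L))"
proof (induction n)
  case (Suc n)
  then show ?case by (simp add: algebra_simps scaleR_conv_of_real)
qed simp

text \<open>The crude bound \<open>B\<close> only kills the boundary term; the finer bounds
  \<open>b\<close> control the size of the error. With \<open>L = 0\<close> this is Dirichlet's
  test; with \<open>L\<close> the value of a convergent series it compares the weighted series with
  that value.\<close>

lemma summation_by_parts_bound:
  fixes f :: "nat \<Rightarrow> complex" and a b :: "nat \<Rightarrow> real"
  assumes a: "\<And>k. a (Suc k) \<le> a k" "a \<longlonglongrightarrow> 0"
    and bd: "\<And>n. norm ((\<Sum>k<n. f k) - L) \<le> B"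
    and b: "\<And>n. norm ((\<Sum>k<Suc n. f k) - L) \<le> b n"
    and sm: "summable (\<lambda>k. (a k - a (Suc k)) * b k)"
  shows "summable (\<lambda>k. a k *\<^sub>R f k)"
    and "norm ((suminf (\<lambda>k. a k *\<^sub>R f k)) - a 0 *\<^sub>R L) \<le> (suminf (\<lambda>k. (a k - a (Suc k)) * b k))"
proof -
  let ?g = "\<lambda>k. (a k - a (Suc k)) *\<^sub>R ((\<Sum>j<Suc k. f j) - L)"
  have ng: "norm (?g k) \<le> (a k - a (Suc k)) * b k" for k
    using a(1)[of k] b[of k] by (simp add: mult_left_mono del: sum.lessThan_Suc)
  have sn: "summable (\<lambda>k. norm (?g k))"
    by (rule summable_comparison_test'[OF sm, of 0]) (use ng in auto)
  have sg: "summable ?g" using sn by (rule summable_norm_cancel)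
  have "(\<lambda>n. a n *\<^sub>R ((\<Sum>k<n. f k) - L)) \<longlonglongrightarrow> 0"
  proof (rule Lim_null_comparison)
    show "\<forall>\<^sub>F n in sequentially. norm (a n *\<^sub>R ((\<Sum>k<n. f k) - L)) \<le> \<bar>a n\<bar> * B"
      using bd by (auto intro!: always_eventually mult_left_mono)
    show "(\<lambda>n. \<bar>a n\<bar> * B) \<longlonglongrightarrow> 0"
      using tendsto_mult_left_zero[OF tendsto_rabs_zero[OF a(2)]] by simp
  qed
  from tendsto_add[OF this summable_LIMSEQ[OF sg]]
  have "(\<lambda>n. (\<Sum>k<n. a k *\<^sub>R f k) - a 0 *\<^sub>R L) \<longlonglongrightarrow> suminf ?g"
    by (simp only: summation_by_parts[symmetric] add_0)
  from tendsto_add[OF this tendsto_const[of "a 0 *\<^sub>R L"]]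
  have *: "(\<lambda>k. a k *\<^sub>R f k) sums (suminf ?g + a 0 *\<^sub>R L)" by (simp add: sums_def)
  then show "summable (\<lambda>k. a k *\<^sub>R f k)" by (rule sums_summable)
  have "(suminf (\<lambda>k. a k *\<^sub>R f k)) - a 0 *\<^sub>R L = suminf ?g" using * by (simp add: sums_iff)
  then show "norm ((suminf (\<lambda>k. a k *\<^sub>R f k)) - a 0 *\<^sub>R L) \<le> (suminf (\<lambda>k. (a k - a (Suc k)) * b k))"
    using summable_norm[OF sn] suminf_le[OF ng sn sm] by simp
qed

lemma sum_decreasing_telescope:
  fixes a :: "nat \<Rightarrow> real"
  assumes "a \<longlonglongrightarrow> 0"
  shows "(\<lambda>k. (a k - a (Suc k)) * B) sums (a 0 * B)"
  using sums_mult2[OF telescope_sums'[OF assms], of B] by simp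

lemma dirichlet_test_bound:
  fixes f :: "nat \<Rightarrow> complex" and a :: "nat \<Rightarrow> real"
  assumes a: "\<And>k. a (Suc k) \<le> a k" "a \<longlonglongrightarrow> 0"
    and bd: "\<And>n. norm (\<Sum>k<n. f k) \<le> B"
  shows "summable (\<lambda>k. a k *\<^sub>R f k)" and "norm (suminf (\<lambda>k. a k *\<^sub>R f k)) \<le> a 0 * B"
proof -
  have bd': "norm ((\<Sum>k<n. f k) - 0) \<le> B" for n using bd by simp
  note S = sum_decreasing_telescope[of a B, OF a(2)]
  note * = summation_by_parts_bound[OF a bd' bd' sums_summable[OF S]]
  show "summable (\<lambda>k. a k *\<^sub>R f k)" by (fact *(1))
  show "norm (suminf (\<lambda>k. a k *\<^sub>R f k)) \<le> a 0 * B" using *(2) sums_unique[OF S] by simp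
qed

lemma dirichlet_test_tail:
  fixes f :: "nat \<Rightarrow> complex" and a :: "nat \<Rightarrow> real"
  assumes a: "\<And>k. a (Suc k) \<le> a k" "a \<longlonglongrightarrow> 0"
    and bd: "\<And>n. norm (\<Sum>k<n. f k) \<le> B"
  shows "norm ((\<Sum>k<n. a k *\<^sub>R f k) - (suminf (\<lambda>k. a k *\<^sub>R f k))) \<le> a n * (2 * B)"
proof -
  have sm: "summable (\<lambda>k. a k *\<^sub>R f k)" using dirichlet_test_bound[OF a bd] by simp
  \<comment> \<open>A block of consecutive terms is a difference of two partial sums, hence the
    factor 2.\<close>
  have bd2: "norm (\<Sum>k<j. f (k + n)) \<le> 2 * B" for j
  proof -
    have "(\<Sum>k<j. f (k + n)) = (\<Sum>k<n + j. f k) - (\<Sum>k<n. f k)"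
      using sum_diff_nat_ivl[of 0 n "n + j" f] sum.shift_bounds_nat_ivl[of f 0 n j]
      by (simp add: lessThan_atLeast0 add.commute)
    then show ?thesis using norm_triangle_ineq4[of "\<Sum>k<n + j. f k" "\<Sum>k<n. f k"] bd[of "n + j"] bd[of n]
      by simp
  qed
  have "norm (suminf (\<lambda>k. a (k + n) *\<^sub>R f (k + n))) \<le> a (0 + n) * (2 * B)"
    by (rule dirichlet_test_bound(2)[of "\<lambda>k. a (k + n)" "\<lambda>k. f (k + n)"])
       (use a bd2 LIMSEQ_ignore_initial_segment[of a] in auto)
  moreover have "(suminf (\<lambda>k. a k *\<^sub>R f k)) = (suminf (\<lambda>k. a (k + n) *\<^sub>R f (k + n))) + (\<Sum>k<n. a k *\<^sub>R f k)"
    using suminf_split_initial_segment[OF sm, of n] by simp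
  ultimately show ?thesis by (simp add: norm_minus_commute)
qed

text \<open>Characters are functions on all integers that vanish off the units, so sums can run over
  a full residue system and be dilated or shifted without a side condition.\<close>

definition dchar :: "nat \<Rightarrow> (int \<Rightarrow> complex) \<Rightarrow> bool" where
  "dchar m X \<longleftrightarrow> (\<forall>a b. X (a * b) = X a * X b) \<and> (\<forall>a b. [a = b] (mod int m) \<longrightarrow> X a = X b) \<and>
     (\<forall>a. X a \<noteq> 0 \<longleftrightarrow> coprime a (int m))"

lemma dchar_mult: "dchar m X \<Longrightarrow> X (a * b) = X a * X b"
  and dchar_cong: "dchar m X \<Longrightarrow> [a = b] (mod int m) \<Longrightarrow> X a = X b"
  and dchar_eq_0_iff: "dchar m X \<Longrightarrow> X a = 0 \<longleftrightarrow> \<not> coprime a (int m)"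
  by (auto simp: dchar_def)

lemma dchar_1: "dchar m X \<Longrightarrow> X 1 = 1" by (metis coprime_1_left dchar_def mult_cancel_left1)

lemma dchar_power: "dchar m X \<Longrightarrow> X (a ^ n) = X a ^ n"
  by (induction n) (auto simp: dchar_1 dchar_mult)

lemma dchar_norm:
  assumes "dchar m X" "m > 0" "coprime a (int m)"
  shows "norm (X a) = 1"
proof -
  have t: "totient m > 0" using assms(2) by simp
  define b where "b = nat (a mod int m)"
  have b: "[a = int b] (mod int m)" using assms(2) by (simp add: b_def cong_def)
  then have "coprime b m" using assms(3) by (metis cong_imp_coprime coprime_int_iff)
  then have "[b ^ totient m = 1] (mod m)" using euler_theorem by blast
  then have "[int b ^ totient m = 1] (mod int m)" by (metis cong_int_iff of_nat_1 of_nat_power)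
  then have "X a ^ totient m = 1"
    using dchar_cong[OF assms(1) b] dchar_power[OF assms(1), of "int b" "totient m"] dchar_cong[OF assms(1)] dchar_1[OF assms(1)] by metis
  then have "norm (X a) ^ totient m = 1" by (metis norm_one norm_power)
  then show ?thesis using t by (metis norm_ge_zero power_eq_1_iff norm_power real_norm_def abs_of_nonneg power_eq_imp_eq_base power_one zero_le_one)
qed

lemma dchar_norm_le: "dchar m X \<Longrightarrow> m > 0 \<Longrightarrow> norm (X a) \<le> 1"
  by (metis dchar_norm dchar_eq_0_iff norm_zero order.refl zero_le_one)

lemma dchar_cnj: "dchar m X \<Longrightarrow> dchar m (\<lambda>a. cnj (X a))"
  unfolding dchar_def by (metis complex_cnj_mult complex_cnj_zero_iff)

lemma dchar_times:
  assumes "dchar m X" "dchar n Y"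
  shows "dchar (m * n) (\<lambda>a. X a * Y a)" unfolding dchar_def
proof (intro conjI allI impI)
  fix a b :: int
  show "X (a * b) * Y (a * b) = X a * Y a * (X b * Y b)" using assms by (simp add: dchar_mult)
  show "X a * Y a = X b * Y b" if "[a = b] (mod int (m * n))"
  proof -
    have "[a = b] (mod int m)" "[a = b] (mod int n)" using that by (auto elim: cong_dvd_modulus)
    then show ?thesis using assms dchar_cong by metis
  qed
  show "X a * Y a \<noteq> 0 \<longleftrightarrow> coprime a (int (m * n))"
    using dchar_eq_0_iff[OF assms(1)] dchar_eq_0_iff[OF assms(2)] by auto
qed

lemma dchar_square: "dchar m X \<Longrightarrow> dchar m (\<lambda>a. X a * X a)" unfolding dchar_def by auto

lemma sum_residues_mult:
  fixes g :: "int \<Rightarrow> 'a::comm_monoid_add"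
  assumes per: "\<And>a b. [a = b] (mod int m) \<Longrightarrow> g a = g b" and "coprime u (int m)"
  shows "(\<Sum>a\<in>{0..<int m}. g (u * a)) = (\<Sum>a\<in>{0..<int m}. g a)"
proof (cases "m = 0")
  case False
  have inj: "inj_on (\<lambda>a. (u * a) mod int m) {0..<int m}"
  proof (rule inj_onI)
    fix a b assume ab: "a \<in> {0..<int m}" "b \<in> {0..<int m}" "(u * a) mod int m = (u * b) mod int m"
    then have "[u * a = u * b] (mod int m)" by (simp add: cong_def)
    then have "[a = b] (mod int m)" using assms(2) by (simp add: cong_mult_lcancel)
    then show "a = b" using ab by (simp add: cong_def)
  qed
  have im: "(\<lambda>a. (u * a) mod int m) ` {0..<int m} = {0..<int m}"
    by (rule endo_inj_surj) (use inj False in auto)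
  have "(\<Sum>a\<in>{0..<int m}. g a) = (\<Sum>a\<in>{0..<int m}. g ((u * a) mod int m))"
    using sum.reindex[OF inj, of g] im by simp
  also have "\<dots> = (\<Sum>a\<in>{0..<int m}. g (u * a))" by (intro sum.cong refl per) (simp add: cong_def)
  finally show ?thesis ..
qed simp

lemma sum_residues_add:
  fixes g :: "int \<Rightarrow> 'a::comm_monoid_add"
  assumes per: "\<And>a b. [a = b] (mod int m) \<Longrightarrow> g a = g b"
  shows "(\<Sum>a\<in>{0..<int m}. g (a + s)) = (\<Sum>a\<in>{0..<int m}. g a)"
proof (cases "m = 0")
  case False
  have inj: "inj_on (\<lambda>a. (a + s) mod int m) {0..<int m}"
  proof (rule inj_onI)
    fix a b assume ab: "a \<in> {0..<int m}" "b \<in> {0..<int m}" "(a + s) mod int m = (b + s) mod int m"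
    then have "[a + s = b + s] (mod int m)" by (simp add: cong_def)
    then have "[a = b] (mod int m)" by (simp add: cong_add_rcancel)
    then show "a = b" using ab by (simp add: cong_def)
  qed
  have im: "(\<lambda>a. (a + s) mod int m) ` {0..<int m} = {0..<int m}"
    by (rule endo_inj_surj) (use inj False in auto)
  have "(\<Sum>a\<in>{0..<int m}. g a) = (\<Sum>a\<in>{0..<int m}. g ((a + s) mod int m))"
    using sum.reindex[OF inj, of g] im by simp
  also have "\<dots> = (\<Sum>a\<in>{0..<int m}. g (a + s))" by (intro sum.cong refl per) (simp add: cong_def)
  finally show ?thesis ..
qed simp

text \<open>Multiplying the variable by \<open>u\<close> permutes the residues and multiplies the
  sum by \<open>X u\<close>. Nontriviality of a character is expressed by such a witness
  \<open>u\<close> from here on.\<close>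

lemma dchar_sum_zero:
  assumes "dchar m X" "coprime u (int m)" "X u \<noteq> 1"
  shows "(\<Sum>a\<in>{0..<int m}. X a) = 0"
proof -
  have "X u * (\<Sum>a\<in>{0..<int m}. X a) = (\<Sum>a\<in>{0..<int m}. X (u * a))"
    by (simp add: dchar_mult[OF assms(1)] sum_distrib_left)
  also have "\<dots> = (\<Sum>a\<in>{0..<int m}. X a)"
    by (rule sum_residues_mult) (use assms dchar_cong in auto)
  finally show ?thesis using assms(3) by simp
qed

text \<open>Every block of \<open>m\<close> consecutive values sums to zero, so one may strip blocks
  until at most \<open>m\<close> terms remain.\<close>

lemma dchar_partial_sums:
  assumes X: "dchar m X" "m > 0" and u: "coprime u (int m)" "X u \<noteq> 1"
  shows "norm (\<Sum>k<n. X (int (Suc k))) \<le> m"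
proof (induction n rule: less_induct)
  case (less n)
  show ?case
  proof (cases "n \<le> m")
    case True
    have "norm (\<Sum>k<n. X (int (Suc k))) \<le> (\<Sum>k<n. 1)" by (intro sum_norm_le dchar_norm_le[OF X])
    then show ?thesis using True by simp
  next
    case False
    have "(\<Sum>k<m. X (int (Suc (k + (n - m))))) = (\<Sum>a\<in>{0..<int m}. X (a + int (Suc (n - m))))"
      by (rule sum.reindex_bij_witness[of _ nat int]) (auto simp: algebra_simps)
    also have "\<dots> = 0"
      using sum_residues_add[of m X] dchar_cong[OF X(1)] dchar_sum_zero[OF X(1) u] by metis
    finally have z: "(\<Sum>k<m. X (int (Suc (k + (n - m))))) = 0" .
    have "(\<Sum>k<n. X (int (Suc k))) = (\<Sum>k\<in>{0..<n - m}. X (int (Suc k))) + (\<Sum>k\<in>{n - m..<n}. X (int (Suc k)))"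
      using False by (simp add: sum.atLeastLessThan_concat lessThan_atLeast0)
    also have "(\<Sum>k\<in>{n - m..<n}. X (int (Suc k))) = (\<Sum>k<m. X (int (Suc (k + (n - m)))))"
      using False sum.shift_bounds_nat_ivl[of "\<lambda>k. X (int (Suc k))" 0 "n - m" m] by (simp add: lessThan_atLeast0)
    finally have "(\<Sum>k<n. X (int (Suc k))) = (\<Sum>k<n - m. X (int (Suc k)))"
      using z by (simp add: lessThan_atLeast0)
    then show ?thesis using less[of "n - m"] False X(2) by simp
  qed
qed

section \<open>Nonvanishing of Dirichlet series at 1\<close>

lemma powr_diff_bounds:
  fixes x e :: real
  assumes "x > 0" "e > 0"
  shows "e * (x + 1) powr (- e - 1) \<le> x powr (- e) - (x + 1) powr (- e)"
    and "x powr (- e) - (x + 1) powr (- e) \<le> e * x powr (- e - 1)"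
proof -
  have "\<exists>z>x. z < x + 1 \<and> (x + 1) powr (- e) - x powr (- e) = (x + 1 - x) * (- e * z powr (- e - 1))"
    by (rule MVT2) (use assms in \<open>auto intro!: derivative_eq_intros simp: powr_diff\<close>)
  then obtain z where z: "x < z" "z < x + 1" "(x + 1) powr (- e) - x powr (- e) = - e * z powr (- e - 1)" by auto
  have "e * z powr (- e - 1) \<le> e * x powr (- e - 1)" "e * (x + 1) powr (- e - 1) \<le> e * z powr (- e - 1)"
    using z assms by (auto intro!: powr_mono2' mult_left_mono)
  then show "e * (x + 1) powr (- e - 1) \<le> x powr (- e) - (x + 1) powr (- e)"
    "x powr (- e) - (x + 1) powr (- e) \<le> e * x powr (- e - 1)" using z(3) by simp_all
qed

text \<open>The value \<open>L(1, X)\<close>. The series converges only conditionally, and only for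
  nontrivial \<open>X\<close>, so bounds on its tails replace absolute convergence.\<close>

definition L1 :: "(int \<Rightarrow> complex) \<Rightarrow> complex" where
  "L1 X = suminf (\<lambda>k. (1 / real (Suc k)) *\<^sub>R X (int (Suc k)))"

lemma
  assumes X: "dchar m X" "m > 0" "coprime u (int m)" "X u \<noteq> 1"
  shows summable_L1: "summable (\<lambda>k. (1 / real (Suc k)) *\<^sub>R X (int (Suc k)))"
    and L1_tail: "norm ((\<Sum>k<n. (1 / real (Suc k)) *\<^sub>R X (int (Suc k))) - L1 X) \<le> 2 * real m / real (Suc n)"
proof -
  have "(\<lambda>k. 1 / real (Suc k)) \<longlonglongrightarrow> 0" using LIMSEQ_inverse_real_of_nat by (simp add: inverse_eq_divide)
  then have a: "\<And>k. 1 / real (Suc (Suc k)) \<le> 1 / real (Suc k)" "(\<lambda>k. 1 / real (Suc k)) \<longlonglongrightarrow> 0"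
    by (auto simp: frac_le)
  note * = dirichlet_test_bound(1)[OF a dchar_partial_sums[OF X]] dirichlet_test_tail[OF a dchar_partial_sums[OF X], of n]
  show "summable (\<lambda>k. (1 / real (Suc k)) *\<^sub>R X (int (Suc k)))" using * by blast
  show "norm ((\<Sum>k<n. (1 / real (Suc k)) *\<^sub>R X (int (Suc k))) - L1 X) \<le> 2 * real m / real (Suc n)"
    unfolding L1_def using *(2) by (simp add: mult.commute)
qed

text \<open>Partial summation with the weights \<open>k powr (- e)\<close> against the terms of
  \<open>L(1, X)\<close>: the tails are \<open>O(1/k)\<close> and the differences of consecutive
  weights are \<open>O(e/k)\<close>, so the total error is \<open>e\<close> times a constant
  multiple of the sum of \<open>1/k^2\<close>.\<close>

lemma Lseries_near_1:
  assumes X: "dchar m X" "m > 0" "coprime u (int m)" "X u \<noteq> 1"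
  shows "\<exists>C\<ge>0. \<forall>e>0. norm ((suminf (\<lambda>k. (real (Suc k) powr (- e) / real (Suc k)) *\<^sub>R X (int (Suc k)))) - L1 X) \<le> C * e"
proof -
  define Z where "Z = (suminf (\<lambda>k. 1 / (real (Suc k))\<^sup>2))"
  have sZ: "summable (\<lambda>k. 1 / (real (Suc k))\<^sup>2)"
    using inverse_power_summable[of 2, where 'a=real] summable_Suc_iff[of "\<lambda>n. 1 / (real n)\<^sup>2"]
    by (simp add: inverse_eq_divide)
  have "Z \<ge> 0" unfolding Z_def by (intro suminf_nonneg sZ) simp
  show ?thesis
  proof (intro exI[of _ "2 * real m * Z"] conjI allI impI)
    show "0 \<le> 2 * real m * Z" using \<open>Z \<ge> 0\<close> by simp
    fix e :: real assume e: "e > 0"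
    let ?a = "\<lambda>k. real (Suc k) powr (- e)" and ?f = "\<lambda>k. (1 / real (Suc k)) *\<^sub>R X (int (Suc k))"
    let ?b = "\<lambda>k. 2 * real m / real (Suc k)"
    have a1: "?a (Suc k) \<le> ?a k" for k using e by (intro powr_mono2') auto
    have a2: "?a \<longlonglongrightarrow> 0"
      using e by (intro tendsto_neg_powr filterlim_compose[OF filterlim_real_sequentially filterlim_Suc]) auto
    have ab: "(?a k - ?a (Suc k)) * ?b k \<le> 2 * real m * e * (1 / (real (Suc k))\<^sup>2)" for k
    proof -
      have "?a k - ?a (Suc k) \<le> e * real (Suc k) powr (- e - 1)"
        using powr_diff_bounds(2)[of "real (Suc k)" e] e by (simp add: add.commute)
      also have "\<dots> \<le> e * real (Suc k) powr (- 1)" using e by (intro mult_left_mono powr_mono) auto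
      also have "\<dots> = e / real (Suc k)" by (simp add: powr_minus_divide)
      finally have "(?a k - ?a (Suc k)) * ?b k \<le> (e / real (Suc k)) * ?b k" by (rule mult_right_mono) simp
      then show ?thesis by (simp add: power2_eq_square mult_ac)
    qed
    have sR: "summable (\<lambda>k. 2 * real m * e * (1 / (real (Suc k))\<^sup>2))" by (intro summable_mult sZ)
    have ab0: "(?a k - ?a (Suc k)) * ?b k \<ge> 0" for k using a1[of k] by (intro mult_nonneg_nonneg) auto
    have sab: "summable (\<lambda>k. (?a k - ?a (Suc k)) * ?b k)"
      by (rule summable_comparison_test'[OF sR, of 0]) (simp only: real_norm_def abs_of_nonneg[OF ab0] ab)
    have bd: "norm ((\<Sum>k<n. ?f k) - L1 X) \<le> 2 * real m" for n
      by (rule order_trans[OF L1_tail[OF X]]) (simp add: divide_le_eq algebra_simps)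
    have bd2: "norm ((\<Sum>k<Suc n. ?f k) - L1 X) \<le> ?b n" for n
      by (rule order_trans[OF L1_tail[OF X]]) (auto intro!: divide_left_mono)
    have "norm ((suminf (\<lambda>k. ?a k *\<^sub>R ?f k)) - ?a 0 *\<^sub>R L1 X) \<le> (suminf (\<lambda>k. (?a k - ?a (Suc k)) * ?b k))"
      using summation_by_parts_bound(2)[of ?a ?f "L1 X" "2 * real m" ?b, OF a1 a2 bd bd2 sab] .
    also have "\<dots> \<le> (suminf (\<lambda>k. 2 * real m * e * (1 / (real (Suc k))\<^sup>2)))"
      by (intro suminf_le ab sab sR)
    also have "\<dots> = 2 * real m * e * Z" unfolding Z_def by (rule suminf_mult[OF sZ])
    finally show "norm ((suminf (\<lambda>k. (?a k / real (Suc k)) *\<^sub>R X (int (Suc k)))) - L1 X) \<le> 2 * real m * Z * e"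
      by (simp add: mult_ac)
  qed
qed

text \<open>The pole at 1 is at most simple: each term after the first is at most \<open>1/e\<close>
  times a difference of consecutive values of \<open>k powr (- e)\<close>, and these differences
  telescope.\<close>

lemma zeta_bound:
  fixes e :: real
  assumes e: "e > 0"
  shows "summable (\<lambda>k. real (Suc k) powr (- e) / real (Suc k))"
    and "(suminf (\<lambda>k. real (Suc k) powr (- e) / real (Suc k))) \<le> 1 + 1 / e"
proof -
  let ?z = "\<lambda>k. real (Suc k) powr (- e) / real (Suc k)"
  let ?a = "\<lambda>k. real (Suc k) powr (- e)"
  have a2: "?a \<longlonglongrightarrow> 0"
    using e by (intro tendsto_neg_powr filterlim_compose[OF filterlim_real_sequentially filterlim_Suc]) auto
  have S: "(\<lambda>k. (?a k - ?a (Suc k)) * (1 / e)) sums (?a 0 * (1 / e))"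
    by (rule sum_decreasing_telescope[OF a2])
  have le: "?z (Suc k) \<le> (?a k - ?a (Suc k)) * (1 / e)" for k
    using powr_diff_bounds(1)[of "real (Suc k)" e] e by (simp add: field_simps powr_diff)
  have s: "summable (\<lambda>k. ?z (Suc k))"
    by (rule summable_comparison_test'[OF sums_summable[OF S], of 0]) (use le in auto)
  then show s': "summable ?z" by (subst (asm) summable_Suc_iff)
  have "suminf ?z = suminf (\<lambda>k. ?z (Suc k)) + ?z 0" using suminf_split_head[OF s'] by simp
  also have "suminf (\<lambda>k. ?z (Suc k)) \<le> ?a 0 * (1 / e)"
    using suminf_le[OF le s sums_summable[OF S]] sums_unique[OF S] by simp
  finally show "suminf ?z \<le> 1 + 1 / e" by simp
qed

text \<open>Sieve of Eratosthenes: subtracting \<open>g p\<close> times the series deletes exactly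
  the surviving terms whose index is divisible by \<open>p\<close>.\<close>

lemma euler_sieve:
  fixes g :: "nat \<Rightarrow> complex"
  assumes mult: "\<And>a b. g (a * b) = g a * g b" and sm: "summable (\<lambda>n. norm (g n))"
    and P: "finite P" "\<And>p. p \<in> P \<Longrightarrow> prime p"
  shows "(\<Prod>p\<in>P. 1 - g p) * suminf g = suminf (\<lambda>n. if \<exists>p\<in>P. p dvd n then 0 else g n)"
  using P
proof (induction P rule: finite_induct)
  case (insert p P)
  have p: "prime p" using insert by simp
  let ?s = "\<lambda>P n. if \<exists>p\<in>P. p dvd n then 0 else g n"
  have sg: "summable (?s P)" for P
    by (rule summable_norm_cancel, rule summable_comparison_test'[OF sm, of 0]) auto
  have mono: "strict_mono (\<lambda>n. p * n)" using p prime_gt_0_nat by (auto simp: strict_mono_def)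
  let ?h = "\<lambda>n. if p dvd n then ?s P n else 0"
  have sh: "summable ?h" by (rule summable_norm_cancel, rule summable_comparison_test'[OF sm, of 0]) auto
  have z: "?h n = 0" if "n \<notin> range (\<lambda>n. p * n)" for n using that by (metis dvdE rangeI)
  have "g p * suminf (?s P) = suminf (\<lambda>n. g p * ?s P n)" using suminf_mult[OF sg] by simp
  also have "(\<lambda>n. g p * ?s P n) = (\<lambda>n. ?h (p * n))"
  proof
    fix n
    have "q dvd p * n \<longleftrightarrow> q dvd n" if "q \<in> P" for q
      using that insert p by (metis insertCI prime_dvd_mult_iff primes_dvd_imp_eq dvd_mult)
    then show "g p * ?s P n = ?h (p * n)" by (simp add: mult)
  qed
  also have "suminf \<dots> = suminf ?h" using suminf_mono_reindex[OF mono, of ?h] z by simp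
  finally have 1: "g p * suminf (?s P) = suminf ?h" .
  have "(1 - g p) * suminf (?s P) = suminf (?s P) - suminf ?h" using 1 by (simp add: algebra_simps)
  also have "\<dots> = suminf (\<lambda>n. ?s P n - ?h n)" by (rule suminf_diff[OF sg sh])
  also have "(\<lambda>n. ?s P n - ?h n) = ?s (insert p P)" by (rule ext) auto
  finally have "(1 - g p) * ((\<Prod>p\<in>P. 1 - g p) * suminf g) = suminf (?s (insert p P))"
    using insert by simp
  then show ?case using insert(1,2) by (simp add: mult.assoc)
qed simp

text \<open>After sieving by all primes up to \<open>N\<close>, the only term left with index below
  \<open>N\<close> is the one at 1; the remainder is bounded by a tail of the absolutely convergent
  series. The form \<open>product * sum\<close> avoids both infinite products and division by the
  sum.\<close>

lemma euler_product_limit: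
  fixes g :: "nat \<Rightarrow> complex"
  assumes mult: "\<And>a b. g (a * b) = g a * g b" and sm: "summable (\<lambda>n. norm (g n))"
    and g: "g 0 = 0" "g 1 = 1"
  shows "(\<lambda>N. (\<Prod>p | prime p \<and> p \<le> N. 1 - g p) * suminf g) \<longlonglongrightarrow> 1"
proof (rule Lim_transform2[of "\<lambda>_. 1"])
  show "(\<lambda>N. 1 - (\<Prod>p | prime p \<and> p \<le> N. 1 - g p) * suminf g) \<longlonglongrightarrow> 0"
  proof (rule Lim_null_comparison)
    show "(\<lambda>N. suminf (\<lambda>n. norm (g (n + N)))) \<longlonglongrightarrow> 0" by (rule suminf_exist_split2[OF sm])
    show "\<forall>\<^sub>F N in sequentially. norm (1 - (\<Prod>p | prime p \<and> p \<le> N. 1 - g p) * suminf g) \<le> suminf (\<lambda>n. norm (g (n + N)))"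
    proof (rule eventually_sequentiallyI[of 2])
      fix N :: nat assume N: "N \<ge> 2"
      let ?P = "{p. prime p \<and> p \<le> N}"
      let ?s = "\<lambda>n. if \<exists>p\<in>?P. p dvd n then 0 else g n"
      have ss: "summable (\<lambda>n. norm (?s n))" by (rule summable_comparison_test'[OF sm, of 0]) auto
      have s0: "?s n = (if n = 1 then 1 else 0)" if "n < N" for n
      proof (cases "n \<le> 1")
        case True
        then show ?thesis using g by (cases "n = 0") (auto simp: le_Suc_eq)
      next
        case False
        then obtain p where "prime p" "p dvd n" by (metis prime_factor_nat nat_neq_iff less_one le_refl)
        moreover have "p \<le> N" using \<open>p dvd n\<close> that False by (auto dest: dvd_imp_le)
        ultimately show ?thesis using False by auto
      qed
      have "(\<Sum>n<N. ?s n) = (\<Sum>n<N. if n = 1 then 1 else 0)" by (rule sum.cong) (use s0 in auto)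
      also have "\<dots> = 1" using N by simp
      finally have "suminf ?s = suminf (\<lambda>n. ?s (n + N)) + 1"
        using suminf_split_initial_segment[OF summable_norm_cancel[OF ss], of N] by simp
      moreover have "(\<Prod>p\<in>?P. 1 - g p) * suminf g = suminf ?s" by (rule euler_sieve[OF mult sm]) auto
      ultimately have "norm (1 - (\<Prod>p\<in>?P. 1 - g p) * suminf g) = norm (suminf (\<lambda>n. ?s (n + N)))"
        by simp
      also have "\<dots> \<le> suminf (\<lambda>n. norm (?s (n + N)))"
        by (rule summable_norm) (use summable_ignore_initial_segment[OF ss] in auto)
      also have "\<dots> \<le> suminf (\<lambda>n. norm (g (n + N)))"
        by (rule suminf_le) (use summable_ignore_initial_segment[OF ss, of N] summable_ignore_initial_segment[OF sm, of N] in auto)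
      finally show "norm (1 - (\<Prod>p\<in>?P. 1 - g p) * suminf g) \<le> suminf (\<lambda>n. norm (g (n + N)))" .
    qed
  qed
qed simp

section \<open>Characters with nontrivial square\<close>

lemma ln_norm_one_minus_sums:
  fixes w :: complex
  assumes "norm w < 1"
  shows "(\<lambda>n. - Re (w ^ n / of_nat n)) sums ln (norm (1 - w))"
proof -
  have "(\<lambda>n. - ((- (- w)) ^ n) / of_nat n) sums ln (1 + (- w))" by (rule Ln_series') (use assms in simp)
  then have "(\<lambda>n. Re (- (w ^ n) / of_nat n)) sums Re (ln (1 - w))" by (intro sums_Re) simp
  moreover have "1 - w \<noteq> 0" using assms by auto
  ultimately show ?thesis by simp
qed

text \<open>Expand the three logarithms: with \<open>w = z ^ n\<close> on the unit circle, the
  combined coefficient is a nonpositive multiple of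
  \<open>3 + 4 * Re w + Re (w^2) = 2 * (1 + Re w)^2\<close>.\<close>

lemma three_four_one:
  fixes x :: real and z :: complex
  assumes x: "0 \<le> x" "x < 1" and z: "norm z = 1"
  shows "(1 - x) ^ 3 * norm (1 - x *\<^sub>R z) ^ 4 * norm (1 - x *\<^sub>R z\<^sup>2) \<le> 1"
proof -
  let ?T = "\<lambda>n. 3 * (- Re (complex_of_real x ^ n / of_nat n)) + 4 * (- Re ((x *\<^sub>R z) ^ n / of_nat n)) + (- Re ((x *\<^sub>R z\<^sup>2) ^ n / of_nat n))"
  have S: "?T sums (3 * ln (norm (1 - complex_of_real x)) + 4 * ln (norm (1 - x *\<^sub>R z)) + ln (norm (1 - x *\<^sub>R z\<^sup>2)))"
    by (intro sums_add sums_mult ln_norm_one_minus_sums) (use x z in \<open>auto simp: norm_power\<close>)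
  have "?T n \<le> 0" for n
  proof -
    let ?w = "z ^ n"
    have nw: "norm ?w = 1" using z by (simp add: norm_power)
    then have "(Re ?w)\<^sup>2 + (Im ?w)\<^sup>2 = 1" by (simp add: cmod_def)
    then have "Re (?w\<^sup>2) = 2 * (Re ?w)\<^sup>2 - 1" by (simp add: power2_eq_square)
    then have "3 + 4 * Re ?w + Re (?w\<^sup>2) = 2 * (1 + Re ?w)\<^sup>2" by (simp add: power2_eq_square algebra_simps)
    then have pos: "3 + 4 * Re ?w + Re (?w\<^sup>2) \<ge> 0" by simp
    have p1: "complex_of_real x ^ n / of_nat n = complex_of_real (x ^ n / n)" by simp
    have p2: "(x *\<^sub>R z) ^ n / of_nat n = (x ^ n / n) *\<^sub>R ?w" by (simp add: scaleR_conv_of_real power_mult_distrib)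
    have p3: "(x *\<^sub>R z\<^sup>2) ^ n / of_nat n = (x ^ n / n) *\<^sub>R ?w\<^sup>2"
      by (simp add: scaleR_conv_of_real power_mult_distrib flip: power_mult) (simp add: mult.commute)
    have "?T n = - ((x ^ n / n) * (3 + 4 * Re ?w + Re (?w\<^sup>2)))"
      unfolding p1 p2 p3 by (simp add: algebra_simps)
    then show ?thesis using pos x by simp
  qed
  then have "3 * ln (norm (1 - complex_of_real x)) + 4 * ln (norm (1 - x *\<^sub>R z)) + ln (norm (1 - x *\<^sub>R z\<^sup>2)) \<le> 0"
    using sums_le[OF _ S sums_zero] by blast
  moreover have nz: "1 - x *\<^sub>R z \<noteq> 0" "1 - x *\<^sub>R z\<^sup>2 \<noteq> 0"
  proof -
    have "norm (x *\<^sub>R z) < 1" "norm (x *\<^sub>R z\<^sup>2) < 1" using x z by (auto simp: norm_power)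
    then show "1 - x *\<^sub>R z \<noteq> 0" "1 - x *\<^sub>R z\<^sup>2 \<noteq> 0"
      by (metis eq_iff_diff_eq_0 less_irrefl norm_one)+
  qed
  moreover have "norm (1 - complex_of_real x) = 1 - x"
    using x by (metis abs_of_pos diff_gt_0_iff_gt norm_of_real of_real_1 of_real_diff)
  ultimately have "ln ((1 - x) ^ 3 * norm (1 - x *\<^sub>R z) ^ 4 * norm (1 - x *\<^sub>R z\<^sup>2)) \<le> 0"
    using x by (simp add: ln_mult ln_realpow)
  moreover have "(1 - x) ^ 3 * norm (1 - x *\<^sub>R z) ^ 4 * norm (1 - x *\<^sub>R z\<^sup>2) > 0"
    using x nz by (intro mult_pos_pos) auto
  ultimately show ?thesis by (metis ln_le_zero_iff)
qed

text \<open>If \<open>L(1, X) = 0\<close>, then \<open>\<bar>L(s, 1)\<bar>^3 * \<bar>L(s, X)\<bar>^4 * \<bar>L(s, X^2)\<bar>\<close> tends to \<open>0\<close> as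
  \<open>s = 1 + e\<close> decreases to \<open>1\<close>, but by its Euler product it is at least \<open>1\<close>.\<close>

lemma L1_nonzero_complex:
  assumes X: "dchar m X" "m > 0" and u: "coprime u (int m)" "X u * X u \<noteq> 1"
  shows "L1 X \<noteq> 0"
proof
  assume L0: "L1 X = 0"
  define X2 where "X2 = (\<lambda>a. X a * X a)"
  have X2: "dchar m X2" unfolding X2_def by (rule dchar_square[OF X(1)])
  have u1: "X u \<noteq> 1" using u by auto
  obtain C where C: "C \<ge> 0" "\<And>e. e > 0 \<Longrightarrow> norm ((suminf (\<lambda>k. (real (Suc k) powr (- e) / real (Suc k)) *\<^sub>R X (int (Suc k)))) - L1 X) \<le> C * e"
    using Lseries_near_1[OF X u(1) u1] by blast
  obtain C2 where C2: "C2 \<ge> 0" "\<And>e. e > 0 \<Longrightarrow> norm ((suminf (\<lambda>k. (real (Suc k) powr (- e) / real (Suc k)) *\<^sub>R X2 (int (Suc k)))) - L1 X2) \<le> C2 * e"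
    using Lseries_near_1[OF X2 X(2) u(1)] u(2) unfolding X2_def by blast
  \<comment> \<open>The three factors bound the series of the principal character, of
    \<open>X\<close> and of \<open>X^2\<close> at \<open>1 + e\<close>: a simple pole, a zero
    because \<open>L1 X = 0\<close>, and a bounded quantity because \<open>X^2\<close> is
    nontrivial.\<close>
  have main: "1 \<le> (1 + 1 / e) ^ 3 * (C * e) ^ 4 * (norm (L1 X2) + C2 * e)" if e: "e > 0" for e :: real
  proof -
    define w where "w = (\<lambda>n. real n powr (- e) / real n)"
    have w_mult: "w (a * b) = w a * w b" for a b by (simp add: w_def powr_mult)
    have w0: "w 0 = 0" "w 1 = 1" "w n \<ge> 0" for n by (auto simp: w_def)
    have w1: "w n < 1" if "n \<ge> 2" for n
    proof -
      have "real n powr (- e) \<le> 1 powr (- e)" using that e by (intro powr_mono2') auto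
      then show ?thesis using that by (simp add: w_def field_simps)
    qed
    have sw: "summable w" using zeta_bound(1)[OF e] unfolding w_def by (subst (asm) summable_Suc_iff)
    define g where "g = (\<lambda>Y n. w n *\<^sub>R (Y (int n) :: complex))"
    have lim: "(\<lambda>N. (\<Prod>p | prime p \<and> p \<le> N. 1 - g Y p) * suminf (g Y)) \<longlonglongrightarrow> 1"
      and norm_g: "norm (suminf (g Y)) \<le> 1 + 1 / e"
      and g_suc: "suminf (g Y) = suminf (\<lambda>k. (real (Suc k) powr (- e) / real (Suc k)) *\<^sub>R Y (int (Suc k)))"
      if Y: "\<And>a b. Y (a * b) = Y a * Y b" "\<And>a. norm (Y a) \<le> 1" "Y 1 = 1" for Y
    proof -
      have le: "norm (g Y n) \<le> w n" for n using Y(2)[of "int n"] w0(3)[of n]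
        by (simp add: g_def mult_left_le)
      have sm: "summable (\<lambda>n. norm (g Y n))"
        by (rule summable_comparison_test'[OF sw, of 0]) (use le in auto)
      show "(\<lambda>N. (\<Prod>p | prime p \<and> p \<le> N. 1 - g Y p) * suminf (g Y)) \<longlonglongrightarrow> 1"
        by (rule euler_product_limit[OF _ sm]) (use Y(1,3) w0 in \<open>auto simp: g_def w_mult\<close>)
      show "suminf (g Y) = suminf (\<lambda>k. (real (Suc k) powr (- e) / real (Suc k)) *\<^sub>R Y (int (Suc k)))"
        using suminf_split_head[OF summable_norm_cancel[OF sm]] w0 by (simp add: g_def w_def)
      have "norm (suminf (g Y)) \<le> suminf (\<lambda>n. norm (g Y n))" by (rule summable_norm[OF sm])
      also have "\<dots> \<le> suminf w" by (rule suminf_le[OF le sm sw])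
      also have "\<dots> = suminf (\<lambda>k. w (Suc k))" using suminf_split_head[OF sw] w0 by simp
      also have "\<dots> \<le> 1 + 1 / e" using zeta_bound(2)[OF e] unfolding w_def by simp
      finally show "norm (suminf (g Y)) \<le> 1 + 1 / e" .
    qed
    define X0 :: "int \<Rightarrow> complex" where "X0 = (\<lambda>a. if coprime a (int m) then 1 else 0)"
    have Y0: "\<And>a b. X0 (a * b) = X0 a * X0 b" "\<And>a. norm (X0 a) \<le> 1" "X0 1 = 1" by (auto simp: X0_def)
    have Y1: "\<And>a b. X (a * b) = X a * X b" "\<And>a. norm (X a) \<le> 1" "X 1 = 1"
      using dchar_mult[OF X(1)] dchar_norm_le[OF X] dchar_1[OF X(1)] by auto
    have Y2: "\<And>a b. X2 (a * b) = X2 a * X2 b" "\<And>a. norm (X2 a) \<le> 1" "X2 1 = 1"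
      using dchar_mult[OF X2] dchar_norm_le[OF X2 X(2)] dchar_1[OF X2] by auto
    define P where "P = (\<lambda>Y N. \<Prod>p | prime p \<and> p \<le> N. 1 - g Y p)"
    have P_le: "norm (P X0 N) ^ 3 * norm (P X N) ^ 4 * norm (P X2 N) \<le> 1" for N
    proof -
      have "norm (P X0 N) ^ 3 * norm (P X N) ^ 4 * norm (P X2 N) =
         (\<Prod>p | prime p \<and> p \<le> N. norm (1 - g X0 p) ^ 3 * norm (1 - g X p) ^ 4 * norm (1 - g X2 p))"
        by (simp add: P_def prod.distrib flip: prod_norm prod_power_distrib)
      \<comment> \<open>At primes not dividing \<open>m\<close> this is
        \<open>three_four_one\<close>; at the others all three factors are 1.\<close>
      also have "\<dots> \<le> 1"
      proof (rule prod_le_1, safe)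
        fix p :: nat assume p: "prime p"
        show "norm (1 - g X0 p) ^ 3 * norm (1 - g X p) ^ 4 * norm (1 - g X2 p) \<le> 1"
        proof (cases "coprime (int p) (int m)")
          case True
          have "norm (1 - g X0 p) = 1 - w p" using True w1[of p] p prime_ge_2_nat[OF p]
            by (simp add: g_def X0_def scaleR_conv_of_real)
               (metis abs_of_pos diff_gt_0_iff_gt norm_of_real of_real_1 of_real_diff)
          then show ?thesis
            using three_four_one[of "w p" "X (int p)"] dchar_norm[OF X True] w0(3)[of p] w1[of p] prime_ge_2_nat[OF p]
            by (simp add: g_def X2_def power2_eq_square)
        next
          case False
          then have "X (int p) = 0" using dchar_eq_0_iff[OF X(1)] by blast
          then show ?thesis using False by (simp add: g_def X0_def X2_def)
        qed
      qed simp
      finally show ?thesis .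
    qed
    have "(\<lambda>N. norm (P X0 N * suminf (g X0)) ^ 3 * norm (P X N * suminf (g X)) ^ 4 * norm (P X2 N * suminf (g X2))) \<longlonglongrightarrow> norm (1::complex) ^ 3 * norm (1::complex) ^ 4 * norm (1::complex)"
      unfolding P_def by (intro tendsto_intros lim Y0 Y1 Y2)
    then have "(\<lambda>N. norm (P X0 N * suminf (g X0)) ^ 3 * norm (P X N * suminf (g X)) ^ 4 * norm (P X2 N * suminf (g X2))) \<longlonglongrightarrow> 1" by simp
    moreover have "norm (P X0 N * suminf (g X0)) ^ 3 * norm (P X N * suminf (g X)) ^ 4 * norm (P X2 N * suminf (g X2))
       \<le> norm (suminf (g X0)) ^ 3 * norm (suminf (g X)) ^ 4 * norm (suminf (g X2))" for N
    proof -
      have "norm (P X0 N * suminf (g X0)) ^ 3 * norm (P X N * suminf (g X)) ^ 4 * norm (P X2 N * suminf (g X2))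
        = (norm (P X0 N) ^ 3 * norm (P X N) ^ 4 * norm (P X2 N)) * (norm (suminf (g X0)) ^ 3 * norm (suminf (g X)) ^ 4 * norm (suminf (g X2)))"
        by (simp add: norm_mult power_mult_distrib mult_ac)
      also have "\<dots> \<le> 1 * (norm (suminf (g X0)) ^ 3 * norm (suminf (g X)) ^ 4 * norm (suminf (g X2)))"
        by (rule mult_right_mono[OF P_le]) simp
      finally show ?thesis by simp
    qed
    ultimately have "1 \<le> norm (suminf (g X0)) ^ 3 * norm (suminf (g X)) ^ 4 * norm (suminf (g X2))"
      by (intro LIMSEQ_le_const2) auto
    also have "\<dots> \<le> (1 + 1 / e) ^ 3 * (C * e) ^ 4 * (norm (L1 X2) + C2 * e)"
    proof (intro mult_mono power_mono)
      show "norm (suminf (g X0)) \<le> 1 + 1 / e" using norm_g[of X0] Y0 by blast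
      show "norm (suminf (g X)) \<le> C * e" using C(2)[OF e] L0 g_suc[of X, OF Y1] by simp
      show "norm (suminf (g X2)) \<le> norm (L1 X2) + C2 * e"
        using C2(2)[OF e] g_suc[of X2, OF Y2] norm_triangle_sub[of "suminf (g X2)" "L1 X2"] by simp
    qed (use C(1) C2(1) e in auto)
    finally show ?thesis .
  qed
  have "((\<lambda>e. (1 + 1 / e) ^ 3 * (C * e) ^ 4 * (norm (L1 X2) + C2 * e)) \<longlongrightarrow> 0) (at_right 0)"
  proof (rule Lim_transform_eventually)
    show "((\<lambda>e. (e + 1) ^ 3 * C ^ 4 * e * (norm (L1 X2) + C2 * e)) \<longlongrightarrow> 0) (at_right 0)"
      by (auto intro!: tendsto_eq_intros)
    \<comment> \<open>The cube of the pole cancels three of the four factors \<open>e\<close>; the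
      one left over forces the limit 0.\<close>
    have "(e + 1) ^ 3 * C ^ 4 * e * (norm (L1 X2) + C2 * e) =
        (1 + 1 / e) ^ 3 * (C * e) ^ 4 * (norm (L1 X2) + C2 * e)" if "e > 0" for e
    proof -
      have "(1 + 1 / e) ^ 3 * (C * e) ^ 4 = ((1 + 1 / e) * e) ^ 3 * C ^ 4 * e"
        by (simp only: power_mult_distrib) (simp add: eval_nat_numeral)
      also have "(1 + 1 / e) * e = e + 1" using that by (simp add: field_simps)
      finally show ?thesis by simp
    qed
    then show "eventually (\<lambda>e. (e + 1) ^ 3 * C ^ 4 * e * (norm (L1 X2) + C2 * e) =
        (1 + 1 / e) ^ 3 * (C * e) ^ 4 * (norm (L1 X2) + C2 * e)) (at_right 0)"
      by (auto intro: eventually_mono[OF eventually_at_right_less])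
  qed
  then have "eventually (\<lambda>e. (1 + 1 / e) ^ 3 * (C * e) ^ 4 * (norm (L1 X2) + C2 * e) < 1) (at_right 0)"
    by (rule order_tendstoD) simp
  moreover have "eventually (\<lambda>e::real. e > 0) (at_right 0)" by (simp add: eventually_at_right_less)
  ultimately have "eventually (\<lambda>e::real. False) (at_right 0)" by eventually_elim (use main in force)
  then show False by simp
qed

section \<open>Real characters and their Lambert series\<close>

lemma divisor_sum_prime_power:
  fixes r :: "nat \<Rightarrow> real"
  assumes mult: "\<And>a b. r (a * b) = r a * r b" "r 1 = 1" and p: "prime p" "\<not> p dvd M" "M > 0"
  shows "(\<Sum>d | d dvd p ^ k * M. r d) = (\<Sum>i\<le>k. r p ^ i) * (\<Sum>d | d dvd M. r d)"
proof -
  have rp: "r (p ^ i) = r p ^ i" for i by (induction i) (use mult in auto)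
  have inj: "inj_on (\<lambda>(i, d). p ^ i * d) ({..k} \<times> {d. d dvd M})"
  proof (rule inj_onI, clarify)
    fix i d j e assume *: "d dvd M" "e dvd M" "p ^ i * d = p ^ j * e"
    have nd: "\<not> p dvd d" "\<not> p dvd e" using * p dvd_trans by blast+
    have np: "\<not> is_unit p" "p \<noteq> 0" using p by auto
    have "d \<noteq> 0" "e \<noteq> 0" using * p by auto
    then have "multiplicity p (p ^ i * d) = i" "multiplicity p (p ^ j * e) = j"
      using nd np by (simp_all add: multiplicity_times_same multiplicity_eq_zero_iff not_dvd_imp_multiplicity_0 prime_elem_multiplicity_mult_distrib p)
    then have "i = j" using * by simp
    then show "i = j \<and> d = e" using * np by simp
  qed
  have im: "(\<lambda>(i, d). p ^ i * d) ` ({..k} \<times> {d. d dvd M}) = {d. d dvd p ^ k * M}"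
  proof (intro equalityI subsetI)
    fix x assume "x \<in> {d. d dvd p ^ k * M}"
    then obtain a b where "x = a * b" "a dvd p ^ k" "b dvd M" using division_decomp by blast
    then show "x \<in> (\<lambda>(i, d). p ^ i * d) ` ({..k} \<times> {d. d dvd M})"
      using divides_primepow_nat[OF p(1)] by auto
  qed (auto intro!: mult_dvd_mono le_imp_power_dvd)
  have "(\<Sum>d | d dvd p ^ k * M. r d) = (\<Sum>(i, d)\<in>{..k} \<times> {d. d dvd M}. r p ^ i * r d)"
    unfolding im[symmetric] using sum.reindex[OF inj, of r] by (simp add: case_prod_unfold mult rp)
  also have "\<dots> = (\<Sum>i\<le>k. r p ^ i) * (\<Sum>d | d dvd M. r d)"
    by (simp add: sum_product sum.cartesian_product)
  finally show ?thesis .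
qed

text \<open>At a prime power \<open>p ^ k\<close> the divisor sum is \<open>k + 1\<close> if
  \<open>r p = 1\<close>, is 1 if \<open>r p = 0\<close>, and is 1 or 0 by the parity of
  \<open>k\<close> if \<open>r p = -1\<close>. It is never negative and is at least 1 for even
  \<open>k\<close>; a square has only even exponents.\<close>

lemma real_character_divisor_sum:
  fixes r :: "nat \<Rightarrow> real"
  assumes mult: "\<And>a b. r (a * b) = r a * r b" "r 1 = 1" and vals: "\<And>a. r a \<in> {-1, 0, 1}"
  shows "n > 0 \<Longrightarrow> (\<Sum>d | d dvd n. r d) \<ge> 0" and "n > 0 \<Longrightarrow> (\<Sum>d | d dvd n\<^sup>2. r d) \<ge> 1"
proof -
  have alt: "(\<Sum>i\<le>k. (-1::real) ^ i) = (if even k then 1 else 0)" for k by (induction k) auto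
  have zero: "(\<Sum>i\<le>k. (0::real) ^ i) = 1" for k by (induction k) auto
  have geo: "(\<Sum>i\<le>k. r p ^ i) \<ge> 0" "even k \<Longrightarrow> (\<Sum>i\<le>k. r p ^ i) \<ge> 1" for p k
    using vals[of p] by (auto simp: alt zero)
  have decomp: "\<exists>p k M. prime p \<and> \<not> p dvd M \<and> n = p ^ k * M \<and> 0 < M \<and> M < n" if "n > 1" for n :: nat
  proof -
    obtain p where p: "prime p" "p dvd n" using \<open>n > 1\<close> prime_factor_nat by (metis less_irrefl)
    then obtain M where M: "n = p ^ multiplicity p n * M" "\<not> p dvd M"
      using multiplicity_decompose'[of n p] \<open>n > 1\<close>
      by (metis less_numeral_extra(2) not_prime_unit not_less_zero)
    have "multiplicity p n > 0" using p \<open>n > 1\<close> by (simp add: prime_multiplicity_gt_zero_iff)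
    then have "p ^ multiplicity p n > 1" using prime_gt_1_nat[OF p(1)] by (intro one_less_power) auto
    moreover have "M > 0" using M by (auto intro: gr0I)
    ultimately have "M < n" using M(1) by (metis nat_mult_less_cancel1 mult.commute mult_1)
    then show ?thesis using p M \<open>M > 0\<close> by blast
  qed
  show "n > 0 \<Longrightarrow> (\<Sum>d | d dvd n. r d) \<ge> 0"
  proof (induction n rule: less_induct)
    case (less n)
    show ?case
    proof (cases "n = 1")
      case False
      then obtain p k M where "prime p" "\<not> p dvd M" "n = p ^ k * M" "0 < M" "M < n"
        using decomp[of n] less.prems by auto
      then show ?thesis using divisor_sum_prime_power[OF mult, of p M k] less.IH[of M] geo by simp
    qed (use mult in simp)
  qed
  show "n > 0 \<Longrightarrow> (\<Sum>d | d dvd n\<^sup>2. r d) \<ge> 1"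
  proof (induction n rule: less_induct)
    case (less n)
    show ?case
    proof (cases "n = 1")
      case False
      then obtain p k M where *: "prime p" "\<not> p dvd M" "n = p ^ k * M" "0 < M" "M < n"
        using decomp[of n] less.prems by auto
      have "n\<^sup>2 = p ^ (2 * k) * M\<^sup>2" using * by (simp add: power_mult_distrib mult.commute flip: power_mult)
      moreover have "\<not> p dvd M\<^sup>2" using * prime_dvd_power by blast
      ultimately have "(\<Sum>d | d dvd n\<^sup>2. r d) = (\<Sum>i\<le>2 * k. r p ^ i) * (\<Sum>d | d dvd M\<^sup>2. r d)"
        using divisor_sum_prime_power[OF mult *(1), of "M\<^sup>2" "2 * k"] * by simp
      then show ?thesis using less.IH[of M] * geo(2)[of "2 * k" p] mult_mono[of 1 "\<Sum>i\<le>2 * k. r p ^ i" 1 "\<Sum>d | d dvd M\<^sup>2. r d"] by simp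
    qed (use mult in simp)
  qed
qed

text \<open>Inequality of arithmetic and geometric means: the \<open>n + 1\<close> powers of
  \<open>y^2\<close> from exponent 0 to \<open>n\<close> have geometric mean
  \<open>y ^ n\<close>.\<close>

lemma geometric_mean_bound:
  fixes y :: real
  assumes "0 \<le> y" "y \<le> 1"
  shows "real (Suc n) * y ^ n \<le> (\<Sum>i<Suc n. (y\<^sup>2) ^ i)"
proof (induction n)
  case (Suc n)
  \<comment> \<open>The same inequality for 1 and \<open>n\<close> copies of
    \<open>y ^ Suc n\<close>.\<close>
  have h: "1 + real n * y ^ Suc n - real (Suc n) * y ^ n \<ge> 0" for n
  proof (induction n)
    case (Suc n)
    have "1 + real (Suc n) * y ^ Suc (Suc n) - real (Suc (Suc n)) * y ^ Suc n
       = (1 + real n * y ^ Suc n - real (Suc n) * y ^ n) + real (Suc n) * y ^ n * (y - 1)\<^sup>2"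
      by (simp add: power2_eq_square algebra_simps)
    also have "\<dots> \<ge> 0" using Suc assms by (intro add_nonneg_nonneg) auto
    finally show ?case .
  qed simp
  have "real (Suc (Suc n)) * y ^ Suc n \<le> 1 + real (Suc n) * y ^ Suc (Suc n)" using h[of "Suc n"] by simp
  also have "\<dots> = 1 + y\<^sup>2 * (real (Suc n) * y ^ n)" by (simp add: power2_eq_square)
  also have "\<dots> \<le> 1 + y\<^sup>2 * (\<Sum>i<Suc n. (y\<^sup>2) ^ i)" using Suc by (intro add_left_mono mult_left_mono) auto
  also have "\<dots> = (\<Sum>i<Suc (Suc n). (y\<^sup>2) ^ i)"
    by (subst (2) sum.lessThan_Suc_shift) (simp add: sum_distrib_left del: sum.lessThan_Suc)
  finally show ?case .
qed simp

text \<open>With \<open>G n = 1 + x + ... + x ^ (n - 1)\<close> and \<open>n = Suc k\<close>, the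
  decrease amounts to \<open>n * (n + 1) * x ^ n \<le> G n * G (n + 1)\<close>. Bounding each
  \<open>G\<close> below by its number of terms times their geometric mean gives this with half a
  power of \<open>x\<close> to spare.\<close>

lemma lambert_coefficient_antimono:
  fixes x :: real
  assumes x: "0 < x" "x < 1"
  defines "b \<equiv> \<lambda>k. 1 / (real (Suc k) * (1 - x)) - x ^ Suc k / (1 - x ^ Suc k)"
  shows "b (Suc k) \<le> b k" and "b \<longlonglongrightarrow> 0"
proof -
  let ?n = "Suc k"
  define G where "G = (\<lambda>n. \<Sum>i<n. x ^ i)"
  have G: "1 - x ^ n = (1 - x) * G n" for n unfolding G_def by (rule one_diff_power_eq)
  \<comment> \<open>The square root makes the exponents \<open>(n - 1) / 2\<close> and
    \<open>n / 2\<close> of the geometric means integral.\<close>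
  define y where "y = sqrt x"
  have y: "0 < y" "y \<le> 1" "x = y\<^sup>2" using x by (auto simp: y_def)
  have G1: "real ?n * y ^ k \<le> G ?n" "real (Suc ?n) * y ^ ?n \<le> G (Suc ?n)"
    unfolding G_def y(3) using geometric_mean_bound[of y k] geometric_mean_bound[of y "Suc k"] y(1,2) by simp_all
  have Gp: "G ?n > 0" "G (Suc ?n) > 0" using G1 y by (auto intro: less_le_trans[rotated])
  have "real ?n * real (Suc ?n) * x ^ ?n \<le> (real ?n * y ^ k) * (real (Suc ?n) * y ^ ?n)"
  proof -
    have "x ^ ?n = y ^ ?n * y ^ ?n" by (simp add: y(3) power_mult_distrib power2_eq_square)
    also have "\<dots> \<le> y ^ k * y ^ ?n" using y by (intro mult_right_mono power_decreasing) auto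
    finally have "real ?n * real (Suc ?n) * x ^ ?n \<le> real ?n * real (Suc ?n) * (y ^ k * y ^ ?n)"
      by (rule mult_left_mono) simp
    then show ?thesis by (simp add: mult_ac)
  qed
  also have "\<dots> \<le> G ?n * G (Suc ?n)" using G1 y Gp by (intro mult_mono) auto
  finally have GG: "real ?n * real (Suc ?n) * x ^ ?n \<le> G ?n * G (Suc ?n)" .
  have key: "x ^ ?n / (G ?n * G (Suc ?n)) \<le> 1 / (real ?n * real (Suc ?n))"
  proof -
    have "v / c \<le> 1 / a" if "a * v \<le> c" "a > 0" "c > 0" for a c v :: real
      using that by (simp add: field_simps)
    from this[OF GG] show ?thesis using Gp by simp
  qed
  have "b k - b ?n = (1 / (1 - x)) * (1 / real ?n - 1 / real (Suc ?n)) - (x ^ ?n / (1 - x ^ ?n) - x ^ Suc ?n / (1 - x ^ Suc ?n))"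
  proof -
    have *: "1 / (a * y) = 1 / y * (1 / a)" for a y :: real by simp
    have "u * v - c - (u * w - d) = u * (v - w) - (c - d)" for u v w c d :: real by (simp add: algebra_simps)
    then show ?thesis unfolding b_def * .
  qed
  also have "x ^ ?n / (1 - x ^ ?n) - x ^ Suc ?n / (1 - x ^ Suc ?n) = (1 / (1 - x)) * (x ^ ?n / (G ?n * G (Suc ?n)))"
  proof -
    have "t / (1 - t) - x * t / (1 - x * t) = t * (1 - x) / ((1 - t) * (1 - x * t))"
      if "1 - t \<noteq> 0" "1 - x * t \<noteq> 0" for t
      using that by (simp add: diff_frac_eq) (simp add: algebra_simps)
    moreover have "1 - x ^ ?n \<noteq> 0" "1 - x * x ^ ?n \<noteq> 0"
      using G[of ?n] G[of "Suc ?n"] Gp x by auto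
    ultimately have "x ^ ?n / (1 - x ^ ?n) - x ^ Suc ?n / (1 - x ^ Suc ?n)
        = x ^ ?n * (1 - x) / ((1 - x ^ ?n) * (1 - x ^ Suc ?n))" by (simp only: power_Suc)
    also have "\<dots> = x ^ ?n * (1 - x) / (((1 - x) * G ?n) * ((1 - x) * G (Suc ?n)))" by (simp only: G)
    also have "\<dots> = (1 / (1 - x)) * (x ^ ?n / (G ?n * G (Suc ?n)))" using x by simp
    finally show ?thesis .
  qed
  also have "1 / real ?n - 1 / real (Suc ?n) = 1 / (real ?n * real (Suc ?n))" by (simp add: field_simps)
  finally have "b k - b ?n = (1 / (1 - x)) * (1 / (real ?n * real (Suc ?n)) - x ^ ?n / (G ?n * G (Suc ?n)))"
    by (simp add: right_diff_distrib)
  also have "\<dots> \<ge> 0" using key x by (intro mult_nonneg_nonneg) auto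
  finally show "b (Suc k) \<le> b k" by simp
  have "(\<lambda>k. 1 / real (Suc k) * (1 / (1 - x)) - x ^ Suc k / (1 - x ^ Suc k)) \<longlonglongrightarrow> 0 * (1 / (1 - x)) - 0 / (1 - 0)"
    using x LIMSEQ_inverse_real_of_nat LIMSEQ_Suc[OF LIMSEQ_realpow_zero[of x]]
    by (intro tendsto_intros) (auto simp: inverse_eq_divide)
  then show "b \<longlonglongrightarrow> 0" unfolding b_def by simp
qed

text \<open>Expanding \<open>x ^ n / (1 - x ^ n)\<close> and collecting by \<open>N = n * k\<close>
  turns the series into the power series of the divisor sums of \<open>r\<close>; then all
  \<open>N\<close> except finitely many squares are dropped.\<close>

lemma lambert_series_lower_bound:
  fixes r :: "nat \<Rightarrow> real"
  assumes mult: "\<And>a b. r (a * b) = r a * r b" "r 1 = 1" and vals: "\<And>a. r a \<in> {-1, 0, 1}"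
    and x: "0 < x" "x < 1"
  shows "\<exists>S. (\<lambda>k. r (Suc k) * (x ^ Suc k / (1 - x ^ Suc k))) sums S \<and> (\<Sum>j\<in>{1..J}. x ^ j\<^sup>2) \<le> S"
proof -
  define A where "A = {1::nat..}"
  define h where "h = (\<lambda>(n, k). r n * x ^ (n * k))"
  have r1: "\<bar>r a\<bar> \<le> 1" for a using vals[of a] by auto
  have bijA: "bij_betw Suc UNIV A" unfolding A_def
    by (auto simp: bij_betw_def image_iff Suc_le_eq gr0_conv_Suc)
  have geo: "((\<lambda>k. x ^ (n * k)) has_sum (x ^ n / (1 - x ^ n))) A" if "n \<in> A" for n
  proof -
    have n: "n > 0" using that by (simp add: A_def)
    have xn: "norm (x ^ n) < 1" "x ^ n \<ge> 0" using x n by (auto simp: power_less_one_iff abs_of_pos)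
    have "(\<lambda>k. (x ^ n) ^ Suc k) sums (x ^ n * (1 / (1 - x ^ n)))"
      using sums_mult[OF geometric_sums[OF xn(1)], of "x ^ n"] by simp
    then have "((\<lambda>k. (x ^ n) ^ Suc k) has_sum (x ^ n / (1 - x ^ n))) UNIV"
      using xn by (intro norm_summable_imp_has_sum) (auto simp: sums_iff)
    then have "((\<lambda>k. (x ^ n) ^ k) has_sum (x ^ n / (1 - x ^ n))) A"
      using has_sum_reindex_bij_betw[OF bijA, of "\<lambda>k. (x ^ n) ^ k"] by simp
    then show ?thesis by (simp add: power_mult)
  qed
  have "(\<lambda>n. x ^ n / (1 - x ^ n)) summable_on A"
  proof -
    have "summable (\<lambda>k. norm (x ^ Suc k / (1 - x ^ Suc k)))"
    proof (rule summable_comparison_test'[of "\<lambda>k. x ^ Suc k * (1 / (1 - x))" 0])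
      show "summable (\<lambda>k. x ^ Suc k * (1 / (1 - x)))"
        using x by (intro summable_mult2) (simp add: summable_geometric)
      fix k
      have "x ^ Suc k \<le> x" using x power_decreasing[of 1 "Suc k" x] by simp
      then have "x ^ Suc k / (1 - x ^ Suc k) \<le> x ^ Suc k / (1 - x)" "x ^ Suc k < 1"
        using x power_Suc_less_one[of x k] by (auto intro!: divide_left_mono mult_pos_pos simp del: power_Suc)
      then show "norm (norm (x ^ Suc k / (1 - x ^ Suc k))) \<le> x ^ Suc k * (1 / (1 - x))"
        using x by (simp del: power_Suc)
    qed
    then have "(\<lambda>k. x ^ Suc k / (1 - x ^ Suc k)) summable_on UNIV"
      by (rule norm_summable_imp_summable_on)
    then show ?thesis using summable_on_reindex_bij_betw[OF bijA, of "\<lambda>n. x ^ n / (1 - x ^ n)"] by simp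
  qed
  \<comment> \<open>Absolute convergence of the double series, which
    \<open>\<bar>r\<bar> \<le> 1\<close> carries over to \<open>h\<close> and which permits the
    rearrangement.\<close>
  then have "(\<lambda>(n, k). x ^ (n * k)) summable_on (A \<times> A)"
    by (intro summable_on_SigmaI[where g = "\<lambda>n. x ^ n / (1 - x ^ n)"]) (use geo x in auto)
  then have "(\<lambda>z. norm (h z)) summable_on (A \<times> A)" by (rule summable_on_comparison_test)
       (use x r1 in \<open>auto simp: h_def abs_mult mult_left_le_one_le\<close>)
  then have "h summable_on (A \<times> A)" by (rule abs_summable_summable)
  then obtain S where S: "(h has_sum S) (A \<times> A)" by (auto simp: summable_on_def)
  have "((\<lambda>n. r n * (x ^ n / (1 - x ^ n))) has_sum S) A"
    by (rule has_sum_SigmaD[OF S]) (use has_sum_cmult_right[OF geo, of _ "r _"] in \<open>auto simp: h_def\<close>)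
  then have "((\<lambda>k. r (Suc k) * (x ^ Suc k / (1 - x ^ Suc k))) has_sum S) UNIV"
    using has_sum_reindex_bij_betw[OF bijA, of "\<lambda>n. r n * (x ^ n / (1 - x ^ n))"] by simp
  then have sums: "(\<lambda>k. r (Suc k) * (x ^ Suc k / (1 - x ^ Suc k))) sums S" by (rule has_sum_imp_sums)
  have "((\<lambda>(N, d). r d * x ^ N) has_sum S) (Sigma A (\<lambda>N. {d. d dvd N}))"
  proof -
    \<comment> \<open>A pair \<open>(n, k)\<close> corresponds to \<open>N = n * k\<close> together
      with its divisor \<open>d = n\<close>.\<close>
    have "((\<lambda>(N, d). r d * x ^ N) has_sum S) (Sigma A (\<lambda>N. {d. d dvd N})) \<longleftrightarrow> (h has_sum S) (A \<times> A)"
      by (rule has_sum_reindex_bij_witness[of _ "\<lambda>(n, k). (n * k, n)" "\<lambda>(N, d). (d, N div d)"])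
         (auto simp: A_def h_def Suc_le_eq elim!: dvdE intro: gr0I)
    then show ?thesis using S by simp
  qed
  then have cS: "((\<lambda>N. (\<Sum>d | d dvd N. r d) * x ^ N) has_sum S) A"
    by (rule has_sum_SigmaD) (auto simp: A_def sum_distrib_right intro!: has_sum_finite)
  have pos: "(\<Sum>d | d dvd N. r d) * x ^ N \<ge> 0" if "N \<in> A" for N
    using real_character_divisor_sum(1)[OF mult vals, of N] that x by (simp add: A_def)
  have injsq: "inj_on (\<lambda>j::nat. j\<^sup>2) {1..J}" by (auto intro!: inj_onI simp: power2_eq_iff)
  have "(\<Sum>j\<in>{1..J}. x ^ j\<^sup>2) \<le> (\<Sum>j\<in>{1..J}. (\<Sum>d | d dvd j\<^sup>2. r d) * x ^ j\<^sup>2)"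
    using real_character_divisor_sum(2)[OF mult vals] x by (intro sum_mono) auto
  also have "\<dots> = (\<Sum>N\<in>(\<lambda>j. j\<^sup>2) ` {1..J}. (\<Sum>d | d dvd N. r d) * x ^ N)"
    using sum.reindex[OF injsq, of "\<lambda>N. (\<Sum>d | d dvd N. r d) * x ^ N"] by simp
  also have "\<dots> \<le> S"
    by (rule finite_sum_le_has_sum[OF cS]) (use pos in \<open>auto simp: A_def\<close>)
  finally show ?thesis using sums by blast
qed

text \<open>The Lambert series of a real character is unbounded near \<open>1\<close>, since its power series coefficients
  are nonnegative and at least \<open>1\<close> at the squares. Subtracting \<open>L(1) / (1 - x)\<close> from it leaves a series
  with monotone weights, which is bounded; so \<open>L(1) \<noteq> 0\<close>.\<close>

lemma L1_nonzero_real: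
  assumes X: "dchar m X" "m > 0" and u: "coprime u (int m)" "X u \<noteq> 1"
    and real: "\<And>a. coprime a (int m) \<Longrightarrow> X a * X a = 1"
  shows "L1 X \<noteq> 0"
proof
  assume L0: "L1 X = 0"
  define r where "r = (\<lambda>n. Re (X (int n)))"
  have v: "X a \<in> {-1, 0, 1}" for a
    using real[of a] dchar_eq_0_iff[OF X(1), of a] by (auto simp: square_eq_1_iff)
  have Xr: "X (int n) = of_real (r n)" for n using v[of "int n"] by (auto simp: r_def)
  have mult: "r (a * b) = r a * r b" for a b
    using dchar_mult[OF X(1), of "int a" "int b"] Xr by (metis of_nat_mult of_real_eq_iff of_real_mult)
  have r1: "r 1 = 1" using dchar_1[OF X(1)] by (simp add: r_def)
  have vals: "r a \<in> {-1, 0, 1}" for a using v[of "int a"] by (auto simp: r_def)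
  \<comment> \<open>\<open>Suc m\<close> squares suffice: as \<open>x\<close> tends to 1 the left
    side tends to \<open>m + 1\<close>, while the bound does not depend on \<open>x\<close>.\<close>
  have main: "(\<Sum>j\<in>{1..Suc m}. x ^ j\<^sup>2) \<le> real m" if x: "0 < x" "x < 1" for x :: real
  proof -
    obtain S where S: "(\<lambda>k. r (Suc k) * (x ^ Suc k / (1 - x ^ Suc k))) sums S"
      "(\<Sum>j\<in>{1..Suc m}. x ^ j\<^sup>2) \<le> S"
      using lambert_series_lower_bound[OF mult r1 vals x] by blast
    let ?b = "\<lambda>k. 1 / (real (Suc k) * (1 - x)) - x ^ Suc k / (1 - x ^ Suc k)"
    have "(\<lambda>k. (1 / (1 - x)) *\<^sub>R ((1 / real (Suc k)) *\<^sub>R X (int (Suc k))) - complex_of_real (r (Suc k) * (x ^ Suc k / (1 - x ^ Suc k)))) sums ((1 / (1 - x)) *\<^sub>R L1 X - of_real S)"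
      unfolding L1_def by (intro sums_diff sums_scaleR_right summable_sums summable_L1[OF X u] sums_of_real S)
    moreover have "(1 / (1 - x)) *\<^sub>R ((1 / real (Suc k)) *\<^sub>R X (int (Suc k))) - complex_of_real (r (Suc k) * (x ^ Suc k / (1 - x ^ Suc k)))
      = ?b k *\<^sub>R X (int (Suc k))" for k
    proof -
      have "1 / y * (1 / s * c) - c * t = (1 / (s * y) - t) * c" for s t y c :: real
        by (simp add: algebra_simps)
      then show ?thesis by (simp only: Xr scaleR_conv_of_real flip: of_real_mult of_real_diff)
    qed
    ultimately have "(\<lambda>k. ?b k *\<^sub>R X (int (Suc k))) sums (- of_real S)" using L0 by simp
    moreover have "norm (suminf (\<lambda>k. ?b k *\<^sub>R X (int (Suc k)))) \<le> ?b 0 * real m"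
    proof (rule dirichlet_test_bound(2))
      show "?b (Suc k) \<le> ?b k" for k by (rule lambert_coefficient_antimono(1)[OF x])
      show "?b \<longlonglongrightarrow> 0" by (rule lambert_coefficient_antimono(2)[OF x])
      show "norm (\<Sum>k<n. X (int (Suc k))) \<le> real m" for n by (rule dchar_partial_sums[OF X u])
    qed
    \<comment> \<open>The leading weight is 1 for every \<open>x\<close>, so Dirichlet's test gives
      a bound that is uniform up to \<open>x = 1\<close>.\<close>
    moreover have "?b 0 = 1" using x by (simp add: field_simps)
    ultimately have "\<bar>S\<bar> \<le> real m" by (simp add: sums_iff)
    then show ?thesis using S(2) by linarith
  qed
  have "((\<lambda>x::real. \<Sum>j\<in>{1..Suc m}. x ^ j\<^sup>2) \<longlongrightarrow> (\<Sum>j\<in>{1..Suc m}. 1 ^ j\<^sup>2)) (at_left 1)"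
    by (intro tendsto_intros)
  then have "((\<lambda>x::real. \<Sum>j\<in>{1..Suc m}. x ^ j\<^sup>2) \<longlongrightarrow> real (Suc m)) (at_left 1)" by simp
  then have "eventually (\<lambda>x::real. (\<Sum>j\<in>{1..Suc m}. x ^ j\<^sup>2) > real m) (at_left 1)"
    by (rule order_tendstoD) simp
  moreover have "eventually (\<lambda>x::real. x \<in> {0<..<1}) (at_left 1)" by (rule eventually_at_left_real) simp
  ultimately have "eventually (\<lambda>x::real. False) (at_left 1)" by eventually_elim (use main in force)
  then show False by simp
qed

theorem L1_nonzero:
  assumes "dchar m X" "m > 0" "coprime u (int m)" "X u \<noteq> 1"
  shows "L1 X \<noteq> 0"
proof (cases "\<exists>a. coprime a (int m) \<and> X a * X a \<noteq> 1")
  case True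
  then show ?thesis using L1_nonzero_complex[OF assms(1,2)] by auto
next
  case False
  then show ?thesis by (intro L1_nonzero_real[OF assms]) auto
qed

section \<open>Gauss sums and logarithms of cyclotomic numbers\<close>

definition unity_root :: "nat \<Rightarrow> int \<Rightarrow> complex" where
  "unity_root m a = cis (2 * pi * real_of_int a / real m)"

lemma unity_root_add: "unity_root m (a + b) = unity_root m a * unity_root m b"
  by (simp add: unity_root_def cis_mult add_divide_distrib distrib_left)

lemma unity_root_0 [simp]: "unity_root m 0 = 1" by (simp add: unity_root_def)

lemma norm_unity_root [simp]: "norm (unity_root m a) = 1" by (simp add: unity_root_def)

lemma unity_root_uminus: "unity_root m (- a) = cnj (unity_root m a)" by (simp add: unity_root_def cis_cnj)

lemma unity_root_power: "unity_root m a ^ n = unity_root m (a * int n)"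
  by (simp only: unity_root_def Complex.DeMoivre) (simp add: mult_ac)

lemma unity_root_eq_1_iff:
  assumes "m > 0"
  shows "unity_root m a = 1 \<longleftrightarrow> int m dvd a"
proof
  assume "unity_root m a = 1"
  then have "cos (2 * pi * real_of_int a / real m) = 1" by (simp add: unity_root_def complex_eq_iff)
  then obtain k :: int where "2 * pi * real_of_int a / real m = of_int k * 2 * pi"
    using cos_one_2pi_int by blast
  then have "real_of_int a = real_of_int (int m * k)" using assms by (simp add: field_simps)
  then show "int m dvd a" by (simp only: of_int_eq_iff dvd_triv_left)
next
  assume "int m dvd a"
  then obtain k where "a = int m * k" by blast
  then have "2 * pi * real_of_int a / real m = 2 * pi * real_of_int k" using assms by simp
  then show "unity_root m a = 1" by (simp add: unity_root_def cis_multiple_2pi)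
qed

lemma unity_root_cong:
  assumes "[a = b] (mod int m)"
  shows "unity_root m a = unity_root m b"
proof (cases "m = 0")
  case False
  have "unity_root m (a - b) = 1" using assms False by (simp add: unity_root_eq_1_iff cong_iff_dvd_diff)
  then show ?thesis using unity_root_add[of m "a - b" b] by simp
qed (use assms in simp)

lemma sum_unity_root:
  assumes "m > 0" "\<not> int m dvd b"
  shows "(\<Sum>n\<in>{0..<int m}. unity_root m (b * n)) = 0"
proof -
  have "(\<Sum>n\<in>{0..<int m}. unity_root m (b * (n + 1))) = (\<Sum>n\<in>{0..<int m}. unity_root m (b * n))"
    by (rule sum_residues_add) (auto intro!: unity_root_cong cong_scalar_left)
  then have "unity_root m b * (\<Sum>n\<in>{0..<int m}. unity_root m (b * n)) = (\<Sum>n\<in>{0..<int m}. unity_root m (b * n))"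
    by (simp add: distrib_left unity_root_add sum_distrib_left mult.commute)
  then show ?thesis using unity_root_eq_1_iff[OF assms(1), of b] assms(2) by simp
qed

definition gauss_sum :: "nat \<Rightarrow> (int \<Rightarrow> complex) \<Rightarrow> int \<Rightarrow> complex" where
  "gauss_sum m X n = (\<Sum>a\<in>{0..<int m}. X a * unity_root m (a * n))"

text \<open>Primitivity without conductors: every non-unit \<open>n\<close> is fixed by some unit on
  which \<open>X\<close> is not 1. This is the property that makes sums twisted by a non-unit
  vanish.\<close>

definition primitive_dchar :: "nat \<Rightarrow> (int \<Rightarrow> complex) \<Rightarrow> bool" where
  "primitive_dchar m X \<longleftrightarrow> dchar m X \<and>
     (\<forall>n. \<not> coprime n (int m) \<longrightarrow> (\<exists>u. coprime u (int m) \<and> [u * n = n] (mod int m) \<and> X u \<noteq> 1))"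

text \<open>The substitutions of \<open>n * a\<close> and of \<open>u * a\<close> for
  \<open>a\<close>. Only periodicity of \<open>h\<close> enters, so the lemma serves Gauss sums and
  sums of logarithms alike.\<close>

lemma character_sum_dilate:
  fixes h :: "int \<Rightarrow> complex"
  assumes X: "dchar m X" "m > 0" and h: "\<And>a b. [a = b] (mod int m) \<Longrightarrow> h a = h b"
  shows character_sum_dilate_coprime:
      "coprime n (int m) \<Longrightarrow> (\<Sum>a\<in>{0..<int m}. X a * h (a * n)) = cnj (X n) * (\<Sum>a\<in>{0..<int m}. X a * h a)"
    and character_sum_dilate_fixed:
      "coprime u (int m) \<Longrightarrow> [u * n = n] (mod int m) \<Longrightarrow> X u \<noteq> 1 \<Longrightarrow> (\<Sum>a\<in>{0..<int m}. X a * h (a * n)) = 0"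
proof -
  assume n: "coprime n (int m)"
  have "cnj (X n) * X n = 1" using dchar_norm[OF X n]
    by (metis complex_norm_square mult.commute of_real_1 power_one)
  then have "X a = cnj (X n) * X (n * a)" for a by (simp add: dchar_mult[OF X(1)] flip: mult.assoc)
  then have "(\<Sum>a\<in>{0..<int m}. X a * h (a * n)) = (\<Sum>a\<in>{0..<int m}. cnj (X n) * (X (n * a) * h (n * a)))"
    by (intro sum.cong refl) (metis mult.assoc mult.commute)
  also have "\<dots> = cnj (X n) * (\<Sum>a\<in>{0..<int m}. X a * h a)" unfolding sum_distrib_left[symmetric]
    by (subst sum_residues_mult[of m "\<lambda>a. X a * h a" n])
       (use n dchar_cong[OF X(1)] h in \<open>auto intro: arg_cong2[of _ _ _ _ "(*)"]\<close>)
  finally show "(\<Sum>a\<in>{0..<int m}. X a * h (a * n)) = cnj (X n) * (\<Sum>a\<in>{0..<int m}. X a * h a)" .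
next
  assume u: "coprime u (int m)" "[u * n = n] (mod int m)" "X u \<noteq> 1"
  have "(\<Sum>a\<in>{0..<int m}. X a * h (a * n)) = (\<Sum>a\<in>{0..<int m}. X (u * a) * h (u * a * n))"
    by (rule sum_residues_mult[of m "\<lambda>a. X a * h (a * n)" u, symmetric])
       (use u dchar_cong[OF X(1)] in \<open>auto intro!: arg_cong2[of _ _ _ _ "(*)"] h cong_scalar_right\<close>)
  also have "\<dots> = X u * (\<Sum>a\<in>{0..<int m}. X a * h (a * n))" unfolding sum_distrib_left
  proof (rule sum.cong[OF refl])
    fix a
    have "[a * (u * n) = a * n] (mod int m)" using u(2) by (rule cong_scalar_left)
    then have "h (u * a * n) = h (a * n)" by (intro h) (simp add: mult_ac)
    then show "X (u * a) * h (u * a * n) = X u * (X a * h (a * n))" by (simp add: dchar_mult[OF X(1)])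
  qed
  finally show "(\<Sum>a\<in>{0..<int m}. X a * h (a * n)) = 0" using u(3) by simp
qed

lemma gauss_sum_primitive:
  assumes "primitive_dchar m X" "m > 0"
  shows "gauss_sum m X n = cnj (X n) * gauss_sum m X 1"
proof (cases "coprime n (int m)")
  case True
  then show ?thesis using assms character_sum_dilate_coprime[of m X "unity_root m" n] unity_root_cong
    by (simp add: primitive_dchar_def gauss_sum_def)
next
  case False
  then obtain u where "coprime u (int m)" "[u * n = n] (mod int m)" "X u \<noteq> 1"
    using assms(1) by (auto simp: primitive_dchar_def)
  then have "gauss_sum m X n = 0"
    using assms character_sum_dilate_fixed[of m X "unity_root m" u n] unity_root_cong
    by (simp add: primitive_dchar_def gauss_sum_def)
  moreover have "X n = 0" using False assms(1) dchar_eq_0_iff by (auto simp: primitive_dchar_def)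
  ultimately show ?thesis by simp
qed

text \<open>Fourier inversion: if the Gauss sum at 1 vanished, then by primitivity all would, but
  their inverse transform at 1 is \<open>m * X 1 = m\<close>.\<close>

lemma gauss_sum_nonzero:
  assumes "primitive_dchar m X" "m > 1"
  shows "gauss_sum m X 1 \<noteq> 0"
proof
  assume "gauss_sum m X 1 = 0"
  then have "gauss_sum m X n = 0" for n using gauss_sum_primitive[OF assms(1), of n] assms(2) by simp
  then have "0 = (\<Sum>n\<in>{0..<int m}. gauss_sum m X n * unity_root m (- n))" by simp
  also have "\<dots> = (\<Sum>a\<in>{0..<int m}. X a * (\<Sum>n\<in>{0..<int m}. unity_root m ((a - 1) * n)))"
    unfolding gauss_sum_def sum_distrib_left sum_distrib_right
    by (subst sum.swap) (simp add: mult.assoc algebra_simps flip: unity_root_add)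
  also have "\<dots> = (\<Sum>a\<in>{0..<int m}. if a = 1 then of_nat m else 0)"
  proof (rule sum.cong[OF refl])
    fix a assume a: "a \<in> {0..<int m}"
    have "X 1 = 1" using assms(1) dchar_1 by (auto simp: primitive_dchar_def)
    moreover have "\<not> int m dvd a - 1" if "a \<noteq> 1"
      using a that assms(2) zdvd_imp_le[of "int m" "a - 1"] by (cases "a = 0") auto
    ultimately show "X a * (\<Sum>n\<in>{0..<int m}. unity_root m ((a - 1) * n)) = (if a = 1 then of_nat m else 0)"
      using sum_unity_root[of m "a - 1"] assms(2) by simp
  qed
  also have "\<dots> = of_nat m" using assms(2) by simp
  finally show False using assms(2) by simp
qed

text \<open>Abel's limit theorem with a rate. Since the tails of the series are
  \<open>O(1/k)\<close>, partial summation with weights \<open>x ^ k\<close> bounds the error by a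
  multiple of \<open>(1 - x)\<close> times the sum of \<open>x ^ k / (k + 1)\<close>, that is, of
  \<open>(1 - x) * (- ln (1 - x)) / x\<close>.\<close>

lemma L1_abel_limit:
  assumes X: "dchar m X" "m > 0" and u: "coprime u (int m)" "X u \<noteq> 1"
  shows "((\<lambda>x. suminf (\<lambda>k. x ^ k *\<^sub>R ((1 / real (Suc k)) *\<^sub>R X (int (Suc k))))) \<longlongrightarrow> L1 X) (at_left 1)"
proof (rule Lim_transform2[OF tendsto_const])
  let ?f = "\<lambda>k. (1 / real (Suc k)) *\<^sub>R X (int (Suc k))"
  show "((\<lambda>x. L1 X - suminf (\<lambda>k. x ^ k *\<^sub>R ?f k)) \<longlongrightarrow> 0) (at_left 1)"
  proof (rule Lim_null_comparison)
    show "((\<lambda>x::real. 2 * real m * ((1 - x) * (- ln (1 - x) / x))) \<longlongrightarrow> 0) (at_left 1)"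
      by (rule tendsto_mult_right_zero) real_asymp
    have main: "norm (L1 X - suminf (\<lambda>k. x ^ k *\<^sub>R ?f k)) \<le> 2 * real m * ((1 - x) * (- ln (1 - x) / x))"
      if x: "0 < x" "x < 1" for x :: real
    proof -
      let ?b = "\<lambda>k. 2 * real m / real (Suc k)"
      have "(\<lambda>n. - Re (complex_of_real x ^ n / of_nat n)) sums ln (norm (1 - complex_of_real x))"
        by (rule ln_norm_one_minus_sums) (use x in simp)
      moreover have "norm (1 - complex_of_real x) = 1 - x"
        using x by (metis abs_of_pos diff_gt_0_iff_gt norm_of_real of_real_1 of_real_diff)
      moreover have "- Re (complex_of_real x ^ n / of_nat n) = - (x ^ n / real n)" for n
        by (metis Re_complex_of_real of_real_divide of_real_of_nat_eq of_real_power)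
      ultimately have "(\<lambda>n. - (x ^ n / real n)) sums ln (1 - x)" by simp
      then have "(\<lambda>n. - (x ^ Suc n / real (Suc n))) sums ln (1 - x)" by (subst sums_Suc_iff) simp
      then have "(\<lambda>n. (- 1 / x) * - (x ^ Suc n / real (Suc n))) sums ((- 1 / x) * ln (1 - x))"
        by (rule sums_mult)
      then have "(\<lambda>n. 2 * real m * (1 - x) * ((- 1 / x) * - (x ^ Suc n / real (Suc n)))) sums (2 * real m * (1 - x) * ((- 1 / x) * ln (1 - x)))"
        by (rule sums_mult)
      moreover have "2 * real m * (1 - x) * ((- 1 / x) * - (x ^ Suc n / real (Suc n))) = (x ^ n - x ^ Suc n) * ?b n" for n
      proof -
        have "(- 1 / x) * - (x ^ Suc n / real (Suc n)) = x ^ n / real (Suc n)" using x by simp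
        moreover have "2 * c * (1 - x) * (t / s) = (t - x * t) * (2 * c / s)" for c s t :: real
          by (simp add: algebra_simps diff_divide_distrib)
        ultimately show ?thesis by (simp only: power_Suc)
      qed
      ultimately have "(\<lambda>k. (x ^ k - x ^ Suc k) * ?b k) sums (2 * real m * (1 - x) * ((- 1 / x) * ln (1 - x)))"
        by (simp only:)
      moreover have "2 * real m * (1 - x) * ((- 1 / x) * ln (1 - x)) = 2 * real m * ((1 - x) * (- ln (1 - x) / x))" by simp
      ultimately have S: "(\<lambda>k. (x ^ k - x ^ Suc k) * ?b k) sums (2 * real m * ((1 - x) * (- ln (1 - x) / x)))"
        by (simp only:)
      have a: "x ^ Suc k \<le> x ^ k" for k using x by (simp add: mult_left_le_one_le)
      have a2: "(\<lambda>k. x ^ k) \<longlonglongrightarrow> 0" using x by (simp add: LIMSEQ_realpow_zero)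
      have bd: "norm ((\<Sum>k<n. ?f k) - L1 X) \<le> 2 * real m" for n
        by (rule order_trans[OF L1_tail[OF X u]]) (simp add: divide_le_eq algebra_simps)
      have bd2: "norm ((\<Sum>k<Suc n. ?f k) - L1 X) \<le> ?b n" for n
        by (rule order_trans[OF L1_tail[OF X u]]) (auto intro!: divide_left_mono)
      have "norm (suminf (\<lambda>k. x ^ k *\<^sub>R ?f k) - x ^ 0 *\<^sub>R L1 X) \<le> suminf (\<lambda>k. (x ^ k - x ^ Suc k) * ?b k)"
        by (rule summation_by_parts_bound(2)[of "\<lambda>k. x ^ k" ?f "L1 X" "2 * real m" ?b, OF a a2 bd bd2 sums_summable[OF S]])
      then show ?thesis using sums_unique[OF S] by (simp add: norm_minus_commute)
    qed
    have "eventually (\<lambda>x::real. x \<in> {0<..<1}) (at_left 1)" by (rule eventually_at_left_real) simp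
    then show "eventually (\<lambda>x. norm (L1 X - suminf (\<lambda>k. x ^ k *\<^sub>R ?f k)) \<le> 2 * real m * ((1 - x) * (- ln (1 - x) / x))) (at_left 1)"
      by eventually_elim (use main in auto)
  qed
qed

text \<open>Because \<open>ln 0 = 0\<close>, the value at multiples of \<open>m\<close> is 0, so
  sums over a full residue system need not exclude them.\<close>

definition log_cyc :: "nat \<Rightarrow> int \<Rightarrow> real" where
  "log_cyc m a = ln (norm (1 - unity_root m a))"

lemma log_cyc_cong: "[a = b] (mod int m) \<Longrightarrow> log_cyc m a = log_cyc m b"
  unfolding log_cyc_def using unity_root_cong by metis

lemma log_cyc_uminus: "log_cyc m (- a) = log_cyc m a" unfolding log_cyc_def unity_root_uminus
  by (metis complex_cnj_diff complex_cnj_one complex_mod_cnj)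

text \<open>The sum equals minus the Gauss sum of \<open>X\<close> times \<open>L(1)\<close> of the
  conjugate character. The logarithmic series is not absolutely convergent on the unit circle, so
  the computation is made for \<open>x * unity_root m a\<close> with \<open>x < 1\<close>, followed
  by a limit.\<close>

theorem log_cyc_char_sum_nonzero:
  assumes prim: "primitive_dchar m X" and m: "m > 1" and even: "X (- 1) = 1"
  shows "(\<Sum>a\<in>{0..<int m}. X a * of_real (log_cyc m a)) \<noteq> 0"
proof -
  have X: "dchar m X" using prim by (simp add: primitive_dchar_def)
  define Y where "Y = (\<lambda>a. cnj (X a))"
  have Y: "dchar m Y" unfolding Y_def by (rule dchar_cnj[OF X])
  \<comment> \<open>Primitivity applied to the non-unit 0 yields nontriviality.\<close>
  obtain u where u: "coprime u (int m)" "X u \<noteq> 1"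
    using prim m by (auto simp: primitive_dchar_def coprime_0_left_iff dest!: spec[of _ 0])
  have Yu: "Y u \<noteq> 1" using u(2) unfolding Y_def by (metis complex_cnj_cnj complex_cnj_one)
  let ?g = "gauss_sum m X 1"
  let ?f = "\<lambda>k. (1 / real (Suc k)) *\<^sub>R Y (int (Suc k))"
  let ?V = "\<lambda>x::real. \<Sum>a\<in>{0..<int m}. X a * of_real (ln (norm (1 - x *\<^sub>R unity_root m a)))"
  \<comment> \<open>The coefficient of \<open>x ^ n\<close> involves the mean of the Gauss sums at
    \<open>n\<close> and at \<open>-n\<close>; evenness of \<open>X\<close> makes the two
    equal.\<close>
  have V: "?V x = - ?g * (of_real x * suminf (\<lambda>k. x ^ k *\<^sub>R ?f k))" if x: "0 < x" "x < 1" for x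
  proof -
    have "(\<lambda>n. of_real (- Re ((x *\<^sub>R unity_root m a) ^ n / of_nat n))) sums complex_of_real (ln (norm (1 - x *\<^sub>R unity_root m a)))" for a
      by (intro sums_of_real ln_norm_one_minus_sums) (use x in simp)
    then have S: "(\<lambda>n. \<Sum>a\<in>{0..<int m}. X a * of_real (- Re ((x *\<^sub>R unity_root m a) ^ n / of_nat n))) sums ?V x"
      by (intro sums_sum sums_mult)
    have coef: "(\<Sum>a\<in>{0..<int m}. X a * of_real (- Re ((x *\<^sub>R unity_root m a) ^ n / of_nat n))) = - ?g * (x ^ n / n) *\<^sub>R Y (int n)" for n
    proof -
      have re: "complex_of_real (Re ((x *\<^sub>R unity_root m a) ^ n / of_nat n)) = (x ^ n / n) *\<^sub>R ((unity_root m (a * int n) + unity_root m (a * (- int n))) / 2)" for a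
      proof -
        have "(x *\<^sub>R unity_root m a) ^ n / of_nat n = (x ^ n / n) *\<^sub>R unity_root m (a * int n)"
          by (simp add: scaleR_conv_of_real power_mult_distrib unity_root_power)
        then have 1: "Re ((x *\<^sub>R unity_root m a) ^ n / of_nat n) = (x ^ n / n) * Re (unity_root m (a * int n))" by simp
        have 2: "complex_of_real (Re (unity_root m (a * int n))) = (unity_root m (a * int n) + unity_root m (a * (- int n))) / 2"
          using complex_add_cnj[of "unity_root m (a * int n)"] by (simp add: unity_root_uminus)
        show ?thesis by (simp only: 1 of_real_mult 2) (simp only: scaleR_conv_of_real)
      qed
      let ?c = "- complex_of_real (x ^ n / n) / 2"
      have "(\<Sum>a\<in>{0..<int m}. X a * of_real (- Re ((x *\<^sub>R unity_root m a) ^ n / of_nat n))) =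
         (\<Sum>a\<in>{0..<int m}. ?c * (X a * unity_root m (a * int n)) + ?c * (X a * unity_root m (a * (- int n))))"
      proof (rule sum.cong[OF refl])
        have "y * - (c * ((v + w) / 2)) = - c / 2 * (y * v) + - c / 2 * (y * w)" for c v w y :: complex
          by (simp add: algebra_simps add_divide_distrib)
        then show "X a * of_real (- Re ((x *\<^sub>R unity_root m a) ^ n / of_nat n)) =
            ?c * (X a * unity_root m (a * int n)) + ?c * (X a * unity_root m (a * (- int n)))" for a
          unfolding of_real_minus re by (simp only: scaleR_conv_of_real)
      qed
      also have "\<dots> = - (x ^ n / n) *\<^sub>R ((gauss_sum m X (int n) + gauss_sum m X (- int n)) / 2)"
        unfolding gauss_sum_def sum.distrib sum_distrib_left[symmetric] by (simp add: scaleR_conv_of_real distrib_left)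
      also have "gauss_sum m X (int n) = cnj (X (int n)) * ?g" by (rule gauss_sum_primitive[OF prim]) (use m in simp)
      also have "gauss_sum m X (- int n) = cnj (X (- int n)) * ?g" by (rule gauss_sum_primitive[OF prim]) (use m in simp)
      also have "X (- int n) = X (int n)" using dchar_mult[OF X, of "- 1" "int n"] even by simp
      finally show ?thesis by (simp add: Y_def scaleR_conv_of_real)
    qed
    have "(\<lambda>n. - ?g * (x ^ n / n) *\<^sub>R Y (int n)) sums ?V x" using S unfolding coef .
    then have "(\<lambda>n. - ?g * (x ^ Suc n / Suc n) *\<^sub>R Y (int (Suc n))) sums ?V x"
      by (subst sums_Suc_iff) simp
    then have S1: "?V x = suminf (\<lambda>n. - ?g * (x ^ Suc n / Suc n) *\<^sub>R Y (int (Suc n)))" by (rule sums_unique)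
    have "(\<lambda>n. - ?g * (x ^ Suc n / Suc n) *\<^sub>R Y (int (Suc n))) = (\<lambda>n. (- ?g * of_real x) * (x ^ n *\<^sub>R ?f n))"
      by (rule ext) (simp add: scaleR_conv_of_real)
    moreover have "summable (\<lambda>k. x ^ k *\<^sub>R ?f k)"
    proof (rule dirichlet_test_bound(1))
      have "(\<lambda>k. x ^ k) \<longlonglongrightarrow> 0" using x by (simp add: LIMSEQ_realpow_zero)
      then show "(\<lambda>k. x ^ k) \<longlonglongrightarrow> 0" .
      show "x ^ Suc k \<le> x ^ k" for k using x by (simp add: mult_left_le_one_le)
      show "norm (\<Sum>k<n. ?f k) \<le> 2 * real m + norm (L1 Y)" for n
      proof -
        have "norm ((\<Sum>k<n. ?f k) - L1 Y) \<le> 2 * real m"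
          by (rule order_trans[OF L1_tail[OF Y _ u(1) Yu]]) (use m in \<open>auto simp: divide_le_eq algebra_simps\<close>)
        then show ?thesis using norm_triangle_sub[of "\<Sum>k<n. ?f k" "L1 Y"] by linarith
      qed
    qed
    ultimately show ?thesis using S1 suminf_mult[of "\<lambda>k. x ^ k *\<^sub>R ?f k" "- ?g * of_real x"] by (simp add: mult.assoc)
  qed
  have "((\<lambda>x. - ?g * (of_real x * suminf (\<lambda>k. x ^ k *\<^sub>R ?f k))) \<longlongrightarrow> - ?g * (of_real 1 * L1 Y)) (at_left 1)"
    by (intro tendsto_intros L1_abel_limit[OF Y _ u(1) Yu]) (use m in simp)
  moreover have "eventually (\<lambda>x. - ?g * (of_real x * suminf (\<lambda>k. x ^ k *\<^sub>R ?f k)) = ?V x) (at_left 1)"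
  proof -
    have "eventually (\<lambda>x::real. x \<in> {0<..<1}) (at_left 1)" by (rule eventually_at_left_real) simp
    then show ?thesis by eventually_elim (use V in auto)
  qed
  ultimately have "(?V \<longlongrightarrow> - ?g * (of_real 1 * L1 Y)) (at_left 1)" by (rule Lim_transform_eventually)
  then have lim1: "(?V \<longlongrightarrow> - ?g * L1 Y) (at_left 1)" by simp
  have lim2: "(?V \<longlongrightarrow> (\<Sum>a\<in>{0..<int m}. X a * of_real (log_cyc m a))) (at_left 1)"
  proof (rule tendsto_sum)
    fix a assume a: "a \<in> {0..<int m}"
    show "((\<lambda>x. X a * of_real (ln (norm (1 - x *\<^sub>R unity_root m a)))) \<longlongrightarrow> X a * of_real (log_cyc m a)) (at_left 1)"
    \<comment> \<open>At \<open>a = 0\<close> the logarithm diverges as \<open>x\<close> tends to 1,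
      but there \<open>X\<close> vanishes.\<close>
    proof (cases "a = 0")
      case True
      then have "X a = 0" using dchar_eq_0_iff[OF X] m by (simp add: coprime_0_left_iff)
      then show ?thesis by simp
    next
      case False
      then have "\<not> int m dvd a" using a zdvd_imp_le by fastforce
      then have "unity_root m a \<noteq> 1" using unity_root_eq_1_iff m by simp
      then have "norm (1 - 1 *\<^sub>R unity_root m a) \<noteq> 0" by auto
      then have "((\<lambda>x. X a * of_real (ln (norm (1 - x *\<^sub>R unity_root m a)))) \<longlongrightarrow> X a * of_real (ln (norm (1 - 1 *\<^sub>R unity_root m a)))) (at_left 1)"
        by (intro tendsto_intros) auto
      then show ?thesis by (simp add: log_cyc_def)
    qed
  qed
  have "(\<Sum>a\<in>{0..<int m}. X a * of_real (log_cyc m a)) = - ?g * L1 Y"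
    using tendsto_unique[OF _ lim2 lim1] by simp
  moreover have "L1 Y \<noteq> 0" using L1_nonzero[OF Y _ u(1) Yu] m by simp
  moreover have "?g \<noteq> 0" using gauss_sum_nonzero[OF prim m] .
  ultimately show ?thesis by simp
qed

section \<open>Conjugation of relations between logarithms\<close>

lemma unity_root_power_mod: "unity_root m a ^ nat (b mod int m) = unity_root m (a * b)"
proof (cases "m = 0")
  case False
  then have "unity_root m a ^ nat (b mod int m) = unity_root m (a * (b mod int m))"
    by (simp add: unity_root_power)
  also have "\<dots> = unity_root m (a * b)" by (intro unity_root_cong cong_scalar_left) (simp add: cong_def)
  finally show ?thesis .
qed (simp add: unity_root_def)

lemma log_cyc_0 [simp]: "log_cyc m 0 = 0" by (simp add: log_cyc_def)

text \<open>Doubling the relation and exponentiating gives an equation between products of squared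
  moduli. Positive and negative exponents go to different sides, so the equation is the vanishing of
  an integer polynomial function at a root of unity, to which \<open>int_polyfun_galois\<close>
  applies.\<close>

lemma log_cyc_galois_int:
  fixes n :: "int \<Rightarrow> int"
  assumes m: "m > 0" and rel: "(\<Sum>a\<in>{0..<int m}. of_int (n a) * log_cyc m a) = 0" and t: "coprime t (int m)"
  shows "(\<Sum>a\<in>{0..<int m}. of_int (n a) * log_cyc m (t * a)) = 0"
proof -
  let ?R = "{1..<int m}"
  \<comment> \<open>At \<open>unity_root m s\<close> this is the squared modulus of
    \<open>1 - unity_root m (s * a)\<close>, written as a polynomial: the conjugate is the power
    with exponent \<open>- a\<close> reduced modulo \<open>m\<close>.\<close>
  define K where "K = (\<lambda>a (z::complex). (1 - z ^ nat a) * (1 - z ^ nat ((- a) mod int m)))"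
  define F where "F = (\<lambda>z. (\<Prod>a\<in>?R. K a z ^ nat (n a)) - (\<Prod>a\<in>?R. K a z ^ nat (- n a)))"
  have "int_polyfun F" unfolding F_def K_def
    by (intro int_polyfun_diff int_polyfun_prod int_polyfun_power int_polyfun.mult int_polyfun.id
        int_polyfun.const[of 1, simplified])
  have key: "F (unity_root m s) = 0 \<longleftrightarrow> (\<Sum>a\<in>{0..<int m}. of_int (n a) * log_cyc m (s * a)) = 0"
    if s: "coprime s (int m)" for s
  proof -
    let ?z = "unity_root m s" and ?N = "\<lambda>a. norm (1 - unity_root m (s * a))"
    have K: "K a ?z = of_real ((?N a)\<^sup>2)" if a: "a \<in> ?R" for a
    proof -
      have "?z ^ nat a = unity_root m (s * a)" using unity_root_power_mod[of m s a] a by simp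
      moreover have "?z ^ nat ((- a) mod int m) = cnj (unity_root m (s * a))"
        using unity_root_power_mod[of m s "- a"] by (simp add: unity_root_uminus)
      ultimately have "K a ?z = (1 - unity_root m (s * a)) * cnj (1 - unity_root m (s * a))"
        by (simp add: K_def)
      then show ?thesis by (simp only: complex_norm_square)
    qed
    have pos: "?N a > 0" if a: "a \<in> ?R" for a
    proof -
      have "\<not> int m dvd s * a"
        using a s by (simp add: coprime_dvd_mult_right_iff coprime_commute zdvd_not_zless)
      then show ?thesis using unity_root_eq_1_iff[OF m] by simp
    qed
    have "F ?z = of_real ((\<Prod>a\<in>?R. ((?N a)\<^sup>2) ^ nat (n a)) - (\<Prod>a\<in>?R. ((?N a)\<^sup>2) ^ nat (- n a)))"
      unfolding F_def by (simp add: K)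
    then have "F ?z = 0 \<longleftrightarrow> (\<Prod>a\<in>?R. ((?N a)\<^sup>2) ^ nat (n a)) = (\<Prod>a\<in>?R. ((?N a)\<^sup>2) ^ nat (- n a))"
      by (simp only: of_real_eq_0_iff right_minus_eq)
    also have "\<dots> \<longleftrightarrow> ln (\<Prod>a\<in>?R. ((?N a)\<^sup>2) ^ nat (n a)) = ln (\<Prod>a\<in>?R. ((?N a)\<^sup>2) ^ nat (- n a))"
      using pos by (intro ln_inj_iff[symmetric] prod_pos) auto
    also have "ln (\<Prod>a\<in>?R. ((?N a)\<^sup>2) ^ nat (n a)) = (\<Sum>a\<in>?R. real (nat (n a)) * (2 * ln (?N a)))"
      using pos by (subst ln_prod) (auto simp: ln_realpow intro!: sum.cong)
    also have "ln (\<Prod>a\<in>?R. ((?N a)\<^sup>2) ^ nat (- n a)) = (\<Sum>a\<in>?R. real (nat (- n a)) * (2 * ln (?N a)))"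
      using pos by (subst ln_prod) (auto simp: ln_realpow intro!: sum.cong)
    also have "(\<Sum>a\<in>?R. real (nat (n a)) * (2 * ln (?N a))) = (\<Sum>a\<in>?R. real (nat (- n a)) * (2 * ln (?N a)))
       \<longleftrightarrow> (\<Sum>a\<in>?R. real (nat (n a)) * (2 * ln (?N a)) - real (nat (- n a)) * (2 * ln (?N a))) = 0"
      by (simp only: sum_subtractf right_minus_eq)
    also have "(\<Sum>a\<in>?R. real (nat (n a)) * (2 * ln (?N a)) - real (nat (- n a)) * (2 * ln (?N a)))
       = (\<Sum>a\<in>?R. 2 * (of_int (n a) * log_cyc m (s * a)))"
    proof (rule sum.cong[OF refl])
      show "real (nat (n a)) * (2 * ln (?N a)) - real (nat (- n a)) * (2 * ln (?N a)) = 2 * (of_int (n a) * log_cyc m (s * a))" for a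
        by (cases "n a \<ge> 0") (simp_all add: log_cyc_def)
    qed
    also have "\<dots> = 2 * (\<Sum>a\<in>{0..<int m}. of_int (n a) * log_cyc m (s * a))"
    proof -
      have "{0..<int m} = insert 0 ?R" using m by auto
      then show ?thesis by (simp add: sum_distrib_left)
    qed
    finally show ?thesis by simp
  qed
  have "F (unity_root m 1) = 0" using key[of 1] rel by simp
  define t' where "t' = nat (t mod int m)"
  have t': "[int t' = t] (mod int m)" using m by (simp add: t'_def)
  then have "coprime t' m" using t by (metis cong_imp_coprime cong_sym coprime_int_iff)
  then have "F (unity_root m 1 ^ t') = 0" using m unity_root_eq_1_iff[of m "int m"]
    by (intro int_polyfun_galois[OF \<open>int_polyfun F\<close> _ m \<open>F (unity_root m 1) = 0\<close>]) (auto simp: unity_root_power)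
  moreover have "unity_root m 1 ^ t' = unity_root m t"
    using unity_root_cong[OF t'] by (simp add: unity_root_power)
  ultimately show ?thesis using key[OF t] by simp
qed

lemma log_cyc_galois:
  fixes w :: "int \<Rightarrow> rat"
  assumes m: "m > 0" and rel: "(\<Sum>a\<in>{0..<int m}. of_rat (w a) * log_cyc m a) = 0" and t: "coprime t (int m)"
  shows "(\<Sum>a\<in>{0..<int m}. of_rat (w a) * log_cyc m (t * a)) = 0"
proof -
  define D where "D = (\<Prod>a\<in>{0..<int m}. snd (quotient_of (w a)))"
  have D: "D > 0" unfolding D_def by (intro prod_pos) (simp add: quotient_of_denom_pos')
  have "\<exists>n. rat_of_int n = of_int D * w a" if a: "a \<in> {0..<int m}" for a
  proof -
    obtain x y where xy: "quotient_of (w a) = (x, y)" by fastforce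
    then have "y > 0" "w a = of_int x / of_int y" using quotient_of_denom_pos quotient_of_div by auto
    moreover have "y dvd D" unfolding D_def using a xy by (metis dvd_prodI finite_atLeastLessThan_int snd_conv)
    then obtain e where "D = y * e" by blast
    ultimately have "of_int D * w a = rat_of_int (e * x)" by simp
    then show ?thesis by metis
  qed
  then obtain n where n: "\<And>a. a \<in> {0..<int m} \<Longrightarrow> rat_of_int (n a) = of_int D * w a" by metis
  have nr: "real_of_int (n a) = of_int D * of_rat (w a)" if "a \<in> {0..<int m}" for a
    using n[OF that] by (metis of_rat_mult of_rat_of_int_eq)
  have eq: "(\<Sum>a\<in>{0..<int m}. of_int (n a) * g a) = of_int D * (\<Sum>a\<in>{0..<int m}. of_rat (w a) * g a)" for g :: "int \<Rightarrow> real"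
    unfolding sum_distrib_left by (intro sum.cong refl) (simp add: nr mult.assoc)
  show ?thesis using log_cyc_galois_int[OF m _ t, of n] rel D unfolding eq by simp
qed

section \<open>Distribution relations and the sum of all logarithms\<close>

lemma prod_minus_unity_root:
  assumes "n > 0"
  shows "(\<Prod>i\<in>{0..<int n}. x - unity_root n i) = x ^ n - 1"
proof -
  let ?P = "\<Prod>i\<in>{0..<int n}. [:- unity_root n i, 1:]" and ?Q = "Polynomial.monom 1 n - 1 :: complex poly"
  have inj: "inj_on (unity_root n) {0..<int n}"
  proof (rule inj_onI)
    fix a b assume ab: "a \<in> {0..<int n}" "b \<in> {0..<int n}" "unity_root n a = unity_root n b"
    then have "unity_root n (a - b) = 1"
      using unity_root_add[of n a "- b"] unity_root_add[of n b "- b"] by simp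
    then have "int n dvd a - b" using unity_root_eq_1_iff assms by simp
    then have "[a = b] (mod int n)" by (simp add: cong_iff_dvd_diff)
    then show "a = b" using ab by (simp add: cong_def)
  qed
  have dP: "Polynomial.degree ?P = n" by (subst degree_prod_eq_sum_degree) auto
  have dQ: "Polynomial.degree ?Q \<le> n" by (intro degree_diff_le degree_monom_le) simp
  have lP: "Polynomial.coeff ?P n = 1" using lead_coeff_prod[of "\<lambda>i. [:- unity_root n i, 1:]" "{0..<int n}"] dP by simp
  have lQ: "Polynomial.coeff ?Q n = 1" using assms by simp
  have "?P = ?Q"
  proof (rule poly_eqI_degree_lead_coeff[where A = "unity_root n ` {0..<int n}"])
    show "card (unity_root n ` {0..<int n}) \<ge> n" using card_image[OF inj] by simp
    fix z assume "z \<in> unity_root n ` {0..<int n}"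
    then obtain i where i: "i \<in> {0..<int n}" "z = unity_root n i" by blast
    have "z ^ n = 1" using i unity_root_eq_1_iff[OF assms, of "i * int n"] by (simp add: unity_root_power)
    moreover have "poly ?P z = 0" unfolding poly_prod using i by (intro prod_zero bexI[of _ i]) auto
    ultimately show "poly ?P z = poly ?Q z" by (simp add: poly_monom)
  qed (use dP dQ lP lQ in auto)
  then have "poly ?P x = poly ?Q x" by simp
  then show ?thesis by (simp add: poly_prod poly_monom)
qed

lemma prod_one_minus_unity_root:
  assumes "n > 0"
  shows "(\<Prod>i\<in>{0..<int n}. 1 - x * unity_root n i) = 1 - x ^ n"
proof (cases "x = 0")
  case False
  have "(\<Prod>i\<in>{0..<int n}. 1 - x * unity_root n i) = (\<Prod>i\<in>{0..<int n}. x * (1 / x - unity_root n i))"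
    using False by (intro prod.cong) (auto simp: field_simps)
  also have "\<dots> = x ^ n * ((1 / x) ^ n - 1)"
    unfolding prod.distrib prod_minus_unity_root[OF assms] by simp
  also have "\<dots> = (x * (1 / x)) ^ n - x ^ n"
    by (simp only: right_diff_distrib power_mult_distrib mult_1_right)
  also have "x * (1 / x) = 1" using False by simp
  finally show ?thesis by (simp only: power_one)
qed (use assms in \<open>simp add: power_0_left\<close>)

lemma unity_root_scale: "p > 0 \<Longrightarrow> unity_root (p * q) (int p * a) = unity_root q a"
  by (simp add: unity_root_def mult.assoc mult.left_commute[of _ "real p"])

lemma log_cyc_scale: "p > 0 \<Longrightarrow> log_cyc (p * q) (int p * a) = log_cyc q a"
  by (simp add: log_cyc_def unity_root_scale)

text \<open>The logarithm of the factorisation of \<open>1 - y ^ q\<close> into factors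
  \<open>1 - y * unity_root q i\<close>, at \<open>y = unity_root (p * q) k\<close>. That
  \<open>p\<close> does not divide \<open>k\<close> keeps every factor nonzero.\<close>

lemma log_cyc_distribution:
  assumes "p > 0" "q > 0" "\<not> int p dvd k"
  shows "(\<Sum>i\<in>{0..<int q}. log_cyc (p * q) (k + int p * i)) = log_cyc (p * q) (int q * k)"
proof -
  have nz: "\<not> int (p * q) dvd k + int p * i" for i
    using assms by (metis dvd_add_times_triv_right_iff dvd_mult_left mult.commute of_nat_mult)
  have "unity_root (p * q) (int p * i) = unity_root q i" for i using assms by (intro unity_root_scale)
  then have e: "unity_root (p * q) (k + int p * i) = unity_root (p * q) k * unity_root q i" for i
    by (simp add: unity_root_add)
  have "(\<Sum>i\<in>{0..<int q}. log_cyc (p * q) (k + int p * i)) = ln (\<Prod>i\<in>{0..<int q}. norm (1 - unity_root (p * q) (k + int p * i)))"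
    unfolding log_cyc_def using nz unity_root_eq_1_iff[of "p * q"] assms by (intro ln_prod[symmetric]) auto
  also have "(\<Prod>i\<in>{0..<int q}. norm (1 - unity_root (p * q) (k + int p * i))) = norm (1 - unity_root (p * q) k ^ q)"
    unfolding e prod_norm prod_one_minus_unity_root[OF assms(2)] ..
  finally show ?thesis by (simp add: log_cyc_def unity_root_power mult.commute)
qed

text \<open>Cancelling \<open>1 - x\<close> from the factorisation of \<open>1 - x ^ n\<close>
  leaves \<open>1 + x + ... + x ^ (n - 1)\<close>, whose limit at \<open>x = 1\<close> is
  \<open>n\<close>.\<close>

lemma sum_log_cyc:
  assumes "n > 0"
  shows "(\<Sum>i\<in>{0..<int n}. log_cyc n i) = ln (real n)"
proof -
  let ?R = "{1..<int n}"
  have R: "{0..<int n} = insert 0 ?R" using assms by auto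
  have "(\<Prod>i\<in>?R. 1 - x * unity_root n i) = (\<Sum>j<n. x ^ j)" if "x \<noteq> 1" for x
  proof -
    have "(1 - x) * (\<Prod>i\<in>?R. 1 - x * unity_root n i) = (1 - x) * (\<Sum>j<n. x ^ j)"
      using prod_one_minus_unity_root[OF assms, of x] one_diff_power_eq[of x n] unfolding R by simp
    then show ?thesis using that by simp
  qed
  then have "eventually (\<lambda>x. (\<Prod>i\<in>?R. 1 - x * unity_root n i) = (\<Sum>j<n. x ^ j)) (at 1)"
    by (auto simp: eventually_at_filter)
  moreover have "((\<lambda>x. \<Prod>i\<in>?R. 1 - x * unity_root n i) \<longlongrightarrow> (\<Prod>i\<in>?R. 1 - 1 * unity_root n i)) (at 1)"
    by (intro tendsto_intros)
  ultimately have "((\<lambda>x::complex. \<Sum>j<n. x ^ j) \<longlongrightarrow> (\<Prod>i\<in>?R. 1 - 1 * unity_root n i)) (at 1)"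
    by (rule Lim_transform_eventually[rotated])
  moreover have "((\<lambda>x::complex. \<Sum>j<n. x ^ j) \<longlongrightarrow> (\<Sum>j<n. 1 ^ j)) (at 1)"
    by (intro tendsto_intros)
  ultimately have "(\<Prod>i\<in>?R. 1 - unity_root n i) = of_nat n"
    using tendsto_unique[OF at_neq_bot] by fastforce
  then have n: "(\<Prod>i\<in>?R. norm (1 - unity_root n i)) = real n" unfolding prod_norm by simp
  have "unity_root n i \<noteq> 1" if "i \<in> ?R" for i
    using that unity_root_eq_1_iff[OF assms] zdvd_not_zless by auto
  then have "(\<Sum>i\<in>?R. log_cyc n i) = ln (\<Prod>i\<in>?R. norm (1 - unity_root n i))"
    unfolding log_cyc_def by (intro ln_prod[symmetric]) auto
  then show ?thesis using n R by simp
qed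

section \<open>Relations modulo a product of two primes\<close>

lemma prime_residues_dlog:
  assumes "prime q" "q \<ge> 3"
  obtains g :: nat and ind :: "int \<Rightarrow> nat" where
    "\<And>a. coprime a (int q) \<Longrightarrow> [int g ^ ind a = a] (mod int q)" "\<And>a. ind a < q - 1"
    "\<And>a i. [int g ^ i = a] (mod int q) \<Longrightarrow> [i = ind a] (mod (q - 1))" "coprime (int g) (int q)"
proof -
  have "odd q" using assms prime_odd_nat by auto
  then obtain g where "\<forall>k>0. residue_primroot (q ^ k) g"
    using residue_primroot_odd_prime_power_exists assms(1) by blast
  then have "residue_primroot (q ^ 1) g" by (rule allE[of _ 1]) simp
  then have g: "residue_primroot q g" by simp
  have tot: "totient q = q - 1" using assms(1) by (rule totient_prime)
  have bij: "bij_betw (\<lambda>i. g ^ i mod q) {..<q - 1} (totatives q)"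
    using residue_primroot_is_generator[OF _ g] assms tot by simp
  have cg: "coprime q g" and og: "ord q g = q - 1" using g tot by (auto simp: residue_primroot_def)
  have ex: "\<exists>i<q - 1. [int g ^ i = a] (mod int q)" if a: "coprime a (int q)" for a
  proof -
    define b where "b = nat (a mod int q)"
    have b: "[int b = a] (mod int q)" using assms by (simp add: b_def)
    then have "coprime b q" using a by (metis cong_imp_coprime cong_sym coprime_int_iff)
    moreover have "b < q" using assms by (simp add: b_def nat_less_iff)
    ultimately have "b \<in> totatives q" using assms by (cases "b = 0") (auto simp: totatives_def)
    then obtain i where i: "i < q - 1" "b = g ^ i mod q" using bij by (auto simp: bij_betw_def)
    then have "[int (g ^ i) = int b] (mod int q)" by (simp add: cong_def zmod_int)
    then show ?thesis using i b by (metis cong_trans of_nat_power)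
  qed
  define ind where "ind = (\<lambda>a. if coprime a (int q) then SOME i. i < q - 1 \<and> [int g ^ i = a] (mod int q) else 0)"
  have ind: "ind a < q - 1 \<and> [int g ^ ind a = a] (mod int q)" if "coprime a (int q)" for a
    unfolding ind_def using that someI_ex[OF ex[OF that]] by simp
  show ?thesis
  proof (rule that[of g ind])
    show "[int g ^ ind a = a] (mod int q)" if "coprime a (int q)" for a using ind that by blast
    show "ind a < q - 1" for a using ind assms by (cases "coprime a (int q)") (auto simp: ind_def)
    show "coprime (int g) (int q)" using cg by (simp add: coprime_commute)
    show "[i = ind a] (mod (q - 1))" if *: "[int g ^ i = a] (mod int q)" for a i
    proof -
      have "coprime (int g ^ i) (int q)" using cg by (simp add: coprime_commute)
      then have "coprime a (int q)" using * by (metis cong_imp_coprime)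
      then have "[int g ^ i = int g ^ ind a] (mod int q)" using ind * by (meson cong_sym cong_trans)
      then have "[g ^ i = g ^ ind a] (mod q)" by (simp flip: of_nat_power add: cong_int_iff)
      then show ?thesis using order_divides_expdiff[OF cg] og by simp
    qed
  qed
qed

text \<open>Fourier inversion on the cyclic group of units: all coefficients at nontrivial
  characters vanish, so only the mean value of \<open>F\<close> remains.\<close>

lemma constant_if_orthogonal_to_characters:
  fixes F :: "int \<Rightarrow> complex"
  assumes q: "prime q" "q \<ge> 3" and F: "\<And>a b. [a = b] (mod int q) \<Longrightarrow> F a = F b"
    and orth: "\<And>X u. dchar q X \<Longrightarrow> coprime u (int q) \<Longrightarrow> X u \<noteq> 1 \<Longrightarrow> (\<Sum>y\<in>{0..<int q}. F y * X y) = 0"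
    and xy: "coprime x (int q)" "coprime y (int q)"
  shows "F x = F y"
proof -
  obtain g ind where ind: "\<And>a. coprime a (int q) \<Longrightarrow> [int g ^ ind a = a] (mod int q)" "\<And>a. ind a < q - 1"
    "\<And>a i. [int g ^ i = a] (mod int q) \<Longrightarrow> [i = ind a] (mod (q - 1))" and g: "coprime (int g) (int q)"
    using prime_residues_dlog[OF q] by metis
  define n where "n = q - 1"
  have n: "n \<ge> 2" using q by (simp add: n_def)
  have ind_i: "ind (int g ^ i) = i" if "i < n" for i
    using ind(3)[OF cong_refl, of i] ind(2)[of "int g ^ i"] that by (simp add: cong_def n_def)
  \<comment> \<open>The \<open>j\<close>-th character, sending the generator \<open>g\<close> to
    \<open>unity_root n j\<close>.\<close>
  define X where "X = (\<lambda>j a. if coprime a (int q) then unity_root n (j * int (ind a)) else 0)"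
  have indc: "unity_root n (j * int i) = unity_root n (j * int k)" if "[i = k] (mod n)" for i j k
    using that by (intro unity_root_cong cong_scalar_left) (simp add: cong_int_iff)
  have X: "dchar q (X j)" for j unfolding dchar_def
  proof (intro conjI allI impI)
    fix a b
    show "X j (a * b) = X j a * X j b"
    proof (cases "coprime a (int q) \<and> coprime b (int q)")
      case True
      then have "[int g ^ (ind a + ind b) = a * b] (mod int q)"
        unfolding power_add using ind(1) by (intro cong_mult) auto
      then have "[ind a + ind b = ind (a * b)] (mod n)" using ind(3) n_def by blast
      then show ?thesis using True indc[of "ind a + ind b" "ind (a * b)" j]
        by (simp add: X_def distrib_left unity_root_add)
    qed (auto simp: X_def)
    show "X j a = X j b" if "[a = b] (mod int q)"
    proof (cases "coprime a (int q)")
      case True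
      then have "coprime b (int q)" using that by (metis cong_imp_coprime)
      moreover have "[ind a = ind b] (mod n)"
        unfolding n_def by (rule ind(3)) (use ind(1)[OF True] that cong_trans in blast)
      ultimately show ?thesis using True indc by (simp add: X_def)
    next
      case False
      then have "\<not> coprime b (int q)" using that by (metis cong_imp_coprime cong_sym)
      then show ?thesis using False by (simp add: X_def)
    qed
    have "unity_root n k \<noteq> 0" for k by (metis norm_unity_root norm_zero zero_neq_one)
    then show "X j a \<noteq> 0 \<longleftrightarrow> coprime a (int q)" by (simp add: X_def)
  qed
  have reindex: "(\<Sum>y\<in>{0..<int q}. F y * X j y) = (\<Sum>i<n. F (int g ^ i) * unity_root n (j * int i))" for j
  proof -
    have "(\<Sum>y\<in>{0..<int q}. F y * X j y) = (\<Sum>y\<in>{y\<in>{0..<int q}. coprime y (int q)}. F y * X j y)"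
      by (rule sum.mono_neutral_right) (auto simp: X_def)
    also have "\<dots> = (\<Sum>i<n. F (int g ^ i) * unity_root n (j * int i))"
    proof (rule sum.reindex_bij_witness[of _ "\<lambda>i. int g ^ i mod int q" ind])
      fix y assume y: "y \<in> {y\<in>{0..<int q}. coprime y (int q)}"
      show "int g ^ ind y mod int q = y" using ind(1)[of y] y by (simp add: cong_def)
      show "ind y \<in> {..<n}" using ind(2) n_def by simp
      have "F (int g ^ ind y) = F y" using F ind(1) y by blast
      then show "F (int g ^ ind y) * unity_root n (j * int (ind y)) = F y * X j y" using y by (simp add: X_def)
    next
      fix i assume i: "i \<in> {..<n}"
      have c: "[int g ^ i = int g ^ i mod int q] (mod int q)" by simp
      show "ind (int g ^ i mod int q) = i"
        using ind(3)[OF c] ind(2)[of "int g ^ i mod int q"] i by (simp add: cong_def n_def)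
      have "coprime (int g ^ i mod int q) (int q)" using g c by (metis cong_imp_coprime coprime_power_left_iff)
      then show "int g ^ i mod int q \<in> {y\<in>{0..<int q}. coprime y (int q)}" using q by simp
    qed
    finally show ?thesis .
  qed
  have zero: "(\<Sum>i<n. F (int g ^ i) * unity_root n (j * int i)) = 0" if j: "j \<in> {0<..<int n}" for j
  proof -
    have "ind (int g) = 1" using ind_i[of 1] n by simp
    then have "X j (int g) = unity_root n j" using g by (simp add: X_def)
    moreover have "unity_root n j \<noteq> 1" using unity_root_eq_1_iff[of n j] j n zdvd_not_zless by auto
    ultimately have "(\<Sum>y\<in>{0..<int q}. F y * X j y) = 0" by (intro orth[OF X g]) simp
    then show ?thesis using reindex by simp
  qed
  have const: "of_nat n * F (int g ^ k) = (\<Sum>i<n. F (int g ^ i))" if k: "k < n" for k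
  proof -
    \<comment> \<open>The inverse transform at \<open>k\<close>, evaluated twice: by
      \<open>zero\<close> only \<open>j = 0\<close> contributes, and after exchanging the sums only
      \<open>i = k\<close> does.\<close>
    have "(\<Sum>j\<in>{0..<int n}. unity_root n (- j * int k) * (\<Sum>i<n. F (int g ^ i) * unity_root n (j * int i)))
        = (\<Sum>j\<in>{0}. unity_root n (- j * int k) * (\<Sum>i<n. F (int g ^ i) * unity_root n (j * int i)))"
      by (rule sum.mono_neutral_right) (use n zero in auto)
    also have "\<dots> = (\<Sum>i<n. F (int g ^ i))" by simp
    finally have 1: "(\<Sum>j\<in>{0..<int n}. unity_root n (- j * int k) * (\<Sum>i<n. F (int g ^ i) * unity_root n (j * int i))) = (\<Sum>i<n. F (int g ^ i))" .
    have "(\<Sum>j\<in>{0..<int n}. unity_root n (- j * int k) * (\<Sum>i<n. F (int g ^ i) * unity_root n (j * int i)))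
       = (\<Sum>i<n. F (int g ^ i) * (\<Sum>j\<in>{0..<int n}. unity_root n ((int i - int k) * j)))"
      unfolding sum_distrib_left
      by (subst sum.swap) (intro sum.cong refl, simp add: algebra_simps flip: unity_root_add)
    also have "\<dots> = (\<Sum>i<n. if i = k then F (int g ^ k) * of_nat n else 0)"
    proof (rule sum.cong[OF refl])
      fix i assume i: "i \<in> {..<n}"
      have "\<not> int n dvd int i - int k" if "i \<noteq> k"
      proof
        assume "int n dvd int i - int k"
        then have "[int i = int k] (mod int n)" by (simp add: cong_iff_dvd_diff)
        then show False using that i k by (simp add: cong_int_iff cong_def)
      qed
      then show "F (int g ^ i) * (\<Sum>j\<in>{0..<int n}. unity_root n ((int i - int k) * j)) = (if i = k then F (int g ^ k) * of_nat n else 0)"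
        using sum_unity_root[of n "int i - int k"] n by auto
    qed
    also have "\<dots> = F (int g ^ k) * of_nat n" using k by simp
    finally show ?thesis using 1 by (simp add: mult.commute)
  qed
  have "of_nat n * F a = (\<Sum>i<n. F (int g ^ i))" if "coprime a (int q)" for a
    using const[of "ind a"] ind(2)[of a] F[OF ind(1)[OF that]] n_def by simp
  then have "of_nat n * F x = of_nat n * F y" using xy by metis
  then show ?thesis using n by simp
qed

text \<open>A non-unit modulo a prime is congruent to 0, which every unit fixes.\<close>

lemma primitive_dchar_prime:
  assumes q: "prime q" and X: "dchar q X" and u: "coprime u (int q)" "X u \<noteq> 1"
  shows "primitive_dchar q X" unfolding primitive_dchar_def
proof (intro conjI allI impI X)
  fix n assume "\<not> coprime n (int q)"
  then have "int q dvd n" using q by (metis coprime_commute prime_imp_coprime prime_nat_int_transfer)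
  then have "[u * n = n] (mod int q)" by (simp add: cong_iff_dvd_diff)
  then show "\<exists>u. coprime u (int q) \<and> [u * n = n] (mod int q) \<and> X u \<noteq> 1" using u by blast
qed

lemma dchar_minus_1: "dchar m X \<Longrightarrow> X (- 1) = 1 \<or> X (- 1) = - 1"
  using dchar_mult[of m X "- 1" "- 1"] dchar_1[of m X] by (simp add: square_eq_1_iff)

lemma odd_character_sum:
  fixes w :: "int \<Rightarrow> complex"
  assumes X: "dchar m X" "X (- 1) = - 1" and w: "\<And>a b. [a = b] (mod int m) \<Longrightarrow> w a = w b" "\<And>a. w (- a) = w a"
  shows "(\<Sum>a\<in>{0..<int m}. w a * X a) = 0"
proof -
  have "(\<Sum>a\<in>{0..<int m}. w (- 1 * a) * X (- 1 * a)) = (\<Sum>a\<in>{0..<int m}. w a * X a)"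
    by (rule sum_residues_mult[of m "\<lambda>a. w a * X a" "- 1"])
       (use w dchar_cong[OF X(1)] in \<open>auto intro: arg_cong2[of _ _ _ _ "(*)"]\<close>)
  moreover have "w (- 1 * a) * X (- 1 * a) = - (w a * X a)" for a
    using X w(2) by (simp only: dchar_mult[OF X(1)]) simp
  ultimately show ?thesis by (simp add: sum_negf)
qed

section \<open>The Chinese remainder theorem and relations stable under conjugation\<close>

locale two_primes =
  fixes p q :: nat and qs ps :: int
  assumes p: "prime p" "p \<ge> 3" and q: "prime q" "q \<ge> 3" and pq: "p \<noteq> q"
    and qs: "[int q * qs = 1] (mod int p)" and ps: "[int p * ps = 1] (mod int q)"
begin

abbreviation M :: nat where "M \<equiv> p * q"

abbreviation R :: "int set" where "R \<equiv> {0..<int (p * q)}"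

text \<open>Through this, each result of the locale is also used with the two primes
  exchanged.\<close>

lemma swap: "two_primes q p ps qs" using p q pq qs ps by unfold_locales auto

text \<open>\<open>crt k 0\<close> is the subscript \<open>q * qs * k\<close> of
  \<open>Rform\<close>: the multiple of \<open>q\<close> that is congruent to \<open>k\<close>
  modulo \<open>p\<close>.\<close>

definition crt :: "int \<Rightarrow> int \<Rightarrow> int" where
  "crt x y = x * (int q * qs) + y * (int p * ps)"

lemma crt_cong_p: "[crt x y = x] (mod int p)"
proof -
  have "[x * (int q * qs) + y * (int p * ps) = x * 1 + 0] (mod int p)"
    by (intro cong_add cong_scalar_left qs) (simp add: cong_0_iff)
  then show ?thesis by (simp add: crt_def)
qed

lemma crt_cong_q: "[crt x y = y] (mod int q)"
proof -
  have "[x * (int q * qs) + y * (int p * ps) = 0 + y * 1] (mod int q)"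
    by (intro cong_add cong_scalar_left ps) (simp add: cong_0_iff)
  then show ?thesis by (simp add: crt_def)
qed

lemma coprime_p_q: "coprime (int p) (int q)" using p q pq by (simp add: primes_coprime)

lemma cong_pq_iff: "[a = b] (mod int M) \<longleftrightarrow> [a = b] (mod int p) \<and> [a = b] (mod int q)"
  using coprime_cong_mult[OF _ _ coprime_p_q, of a b] by (auto elim: cong_dvd_modulus)

lemma coprime_prime_iff: "coprime a (int p) \<longleftrightarrow> \<not> int p dvd a" "coprime a (int q) \<longleftrightarrow> \<not> int q dvd a"
  using p q by (metis coprime_absorb_left coprime_commute not_prime_unit prime_imp_coprime prime_nat_int_transfer)+

lemma coprime_pq_iff: "coprime a (int M) \<longleftrightarrow> coprime a (int p) \<and> coprime a (int q)"
  by simp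

lemma coprime_crt_iff: "coprime (crt x y) (int M) \<longleftrightarrow> coprime x (int p) \<and> coprime y (int q)"
  unfolding coprime_pq_iff using crt_cong_p[of x y] crt_cong_q[of x y] by (metis cong_imp_coprime cong_sym)

lemma sum_crt:
  fixes h :: "int \<Rightarrow> 'a::comm_monoid_add"
  assumes h: "\<And>a b. [a = b] (mod int M) \<Longrightarrow> h a = h b"
  shows "(\<Sum>a\<in>R. h a) = (\<Sum>x\<in>{0..<int p}. \<Sum>y\<in>{0..<int q}. h (crt x y))"
proof -
  have pos: "0 < int p" "0 < int q" "0 < int M" using p q by auto
  have "(\<Sum>(x, y)\<in>{0..<int p} \<times> {0..<int q}. h (crt x y)) = (\<Sum>a\<in>R. h a)"
  proof (rule sum.reindex_bij_witness[of _ "\<lambda>a. (a mod int p, a mod int q)" "\<lambda>(x, y). crt x y mod int M"])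
    fix z assume "z \<in> {0..<int p} \<times> {0..<int q}"
    then obtain x y where z: "z = (x, y)" "0 \<le> x" "x < int p" "0 \<le> y" "y < int q" by auto
    have "crt x y mod int M mod int p = x" "crt x y mod int M mod int q = y"
      using crt_cong_p[of x y] crt_cong_q[of x y] z by (simp_all add: mod_mod_cancel cong_def)
    then show "((case z of (x, y) \<Rightarrow> crt x y mod int M) mod int p, (case z of (x, y) \<Rightarrow> crt x y mod int M) mod int q) = z"
      using z by simp
    show "(case z of (x, y) \<Rightarrow> crt x y mod int M) \<in> R" using z pos by (simp del: of_nat_mult)
    show "h (case z of (x, y) \<Rightarrow> crt x y mod int M) = (case z of (x, y) \<Rightarrow> h (crt x y))"
      using z by (simp del: of_nat_mult) (intro h, simp add: cong_def)
  next
    fix a assume a: "a \<in> R"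
    have "[crt (a mod int p) (a mod int q) = a] (mod int M)"
      unfolding cong_pq_iff using crt_cong_p crt_cong_q by (meson cong_mod_left cong_refl cong_trans)
    then show "(case (a mod int p, a mod int q) of (x, y) \<Rightarrow> crt x y mod int M) = a"
      using a by (simp add: cong_def)
    show "(a mod int p, a mod int q) \<in> {0..<int p} \<times> {0..<int q}" using pos by simp
  qed
  then show ?thesis by (simp add: sum.cartesian_product)
qed

text \<open>A non-unit is divisible by one of the primes. It is then fixed by every unit that is 1
  modulo the other prime, and such a unit can be chosen where the corresponding factor is
  nontrivial.\<close>

lemma primitive_product:
  assumes X: "dchar p X" "coprime u (int p)" "X u \<noteq> 1" and Y: "dchar q Y" "coprime v (int q)" "Y v \<noteq> 1"
  shows "primitive_dchar M (\<lambda>a. X a * Y a)" unfolding primitive_dchar_def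
proof (intro conjI allI impI dchar_times X Y)
  fix n assume "\<not> coprime n (int M)"
  then consider "int p dvd n" | "int q dvd n" using coprime_pq_iff coprime_prime_iff by blast
  then show "\<exists>u. coprime u (int M) \<and> [u * n = n] (mod int M) \<and> X u * Y u \<noteq> 1"
  proof cases
    case 1
    have "[crt u 1 * n = n] (mod int M)"
      unfolding cong_pq_iff using 1 cong_scalar_right[OF crt_cong_q[of u 1], of n]
      by (auto simp: cong_iff_dvd_diff)
    moreover have "X (crt u 1) * Y (crt u 1) = X u * Y 1"
      using dchar_cong[OF X(1) crt_cong_p] dchar_cong[OF Y(1) crt_cong_q] by simp
    ultimately show ?thesis using coprime_crt_iff X Y dchar_1[OF Y(1)] by (intro exI[of _ "crt u 1"]) auto
  next
    case 2
    have "[crt 1 v * n = n] (mod int M)"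
      unfolding cong_pq_iff using 2 cong_scalar_right[OF crt_cong_p[of 1 v], of n]
      by (auto simp: cong_iff_dvd_diff)
    moreover have "X (crt 1 v) * Y (crt 1 v) = X 1 * Y v"
      using dchar_cong[OF X(1) crt_cong_p] dchar_cong[OF Y(1) crt_cong_q] by simp
    ultimately show ?thesis using coprime_crt_iff X Y dchar_1[OF X(1)] by (intro exI[of _ "crt 1 v"]) auto
  qed
qed

text \<open>Stability under conjugation is built in through \<open>t\<close>. It is proved for
  rational weights, but the character arguments only need this consequence and take complex
  values.\<close>

definition log_relation :: "(int \<Rightarrow> complex) \<Rightarrow> bool" where
  "log_relation w \<longleftrightarrow> (\<forall>a b. [a = b] (mod int M) \<longrightarrow> w a = w b) \<and> (\<forall>a. w (- a) = w a) \<and>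
     (\<forall>t. coprime t (int M) \<longrightarrow> (\<Sum>a\<in>R. w a * of_real (log_cyc M (t * a))) = 0)"

lemma log_relation_character:
  assumes w: "log_relation w" and X: "dchar M X"
  shows "(\<Sum>a\<in>R. w a * (\<Sum>t\<in>R. X t * of_real (log_cyc M (t * a)))) = 0"
proof -
  have "(\<Sum>a\<in>R. w a * (\<Sum>t\<in>R. X t * of_real (log_cyc M (t * a))))
     = (\<Sum>t\<in>R. X t * (\<Sum>a\<in>R. w a * of_real (log_cyc M (t * a))))"
    unfolding sum_distrib_left by (subst sum.swap) (simp add: mult_ac)
  also have "\<dots> = 0" using w dchar_eq_0_iff[OF X] unfolding log_relation_def by (intro sum.neutral) auto
  finally show ?thesis .
qed

text \<open>For even \<open>X * Y\<close>, primitivity gives the inner sum over \<open>t\<close> the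
  form \<open>cnj (Z a) * T\<close> at every residue \<open>a\<close>, non-units included, so the
  nonzero constant \<open>T\<close> can be divided out. For odd \<open>X * Y\<close> the evenness of
  \<open>w\<close> suffices.\<close>

lemma log_relation_orthogonal:
  assumes w: "log_relation w" and X: "dchar p X" "coprime u (int p)" "X u \<noteq> 1"
    and Y: "dchar q Y" "coprime v (int q)" "Y v \<noteq> 1"
  shows "(\<Sum>a\<in>R. w a * (X a * Y a)) = 0"
proof (cases "X (- 1) * Y (- 1) = 1")
  case False
  let ?Z = "\<lambda>a. X a * Y a"
  have Z: "dchar M ?Z" using X Y dchar_times by blast
  have "?Z (- 1) = - 1" using dchar_minus_1[OF Z] False by simp
  from odd_character_sum[OF Z this, of w] show ?thesis using w by (simp add: log_relation_def)
next
  case True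
  \<comment> \<open>The conjugate character, so that \<open>cnj (Z a)\<close> is
    \<open>X a * Y a\<close>.\<close>
  define Z where "Z = (\<lambda>a. cnj (X a) * cnj (Y a))"
  have prim: "primitive_dchar M Z" unfolding Z_def
    using primitive_product[OF dchar_cnj[OF X(1)] X(2) _ dchar_cnj[OF Y(1)] Y(2)] X Y
    by (metis complex_cnj_cnj complex_cnj_one)
  then have Z: "dchar M Z" by (simp add: primitive_dchar_def)
  have pos: "M > 0" "M > 1" using p q by (auto intro: one_less_mult)
  define T where "T = (\<Sum>t\<in>R. Z t * of_real (log_cyc M t))"
  have "T \<noteq> 0" unfolding T_def
  proof (rule log_cyc_char_sum_nonzero[OF prim pos(2)])
    have "Z (- 1) = cnj (X (- 1) * Y (- 1))" by (simp add: Z_def)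
    then show "Z (- 1) = 1" unfolding True by simp
  qed
  have hc: "complex_of_real (log_cyc M a) = of_real (log_cyc M b)" if "[a = b] (mod int M)" for a b
    using log_cyc_cong[OF that] by simp
  have "(\<Sum>t\<in>R. Z t * of_real (log_cyc M (t * a))) = cnj (Z a) * T" for a
  proof (cases "coprime a (int M)")
    case True
    show ?thesis unfolding T_def
      by (rule character_sum_dilate_coprime[of "p * q" Z "\<lambda>a. of_real (log_cyc M a)", OF Z pos(1) _ True])
         (rule hc)
  next
    case False
    then obtain u where u: "coprime u (int M)" "[u * a = a] (mod int M)" "Z u \<noteq> 1"
      using prim by (auto simp: primitive_dchar_def)
    have "(\<Sum>t\<in>R. Z t * of_real (log_cyc M (t * a))) = 0"
      by (rule character_sum_dilate_fixed[of "p * q" Z "\<lambda>a. of_real (log_cyc M a)", OF Z pos(1) _ u])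
         (rule hc)
    moreover have "Z a = 0" using False dchar_eq_0_iff[OF Z] by blast
    ultimately show ?thesis by simp
  qed
  then have "0 = (\<Sum>a\<in>R. w a * (cnj (Z a) * T))" using log_relation_character[OF w Z] by simp
  also have "\<dots> = (\<Sum>a\<in>R. w a * (X a * Y a)) * T" by (simp add: sum_distrib_left Z_def mult_ac)
  finally show ?thesis using \<open>T \<noteq> 0\<close> by simp
qed

text \<open>The vanishing mixed second difference says that on units \<open>w\<close> is a function
  of the first component plus a function of the second. It comes from
  \<open>constant_if_orthogonal_to_characters\<close>, once for each prime.\<close>

lemma log_relation_unit_part:
  assumes w: "log_relation w" and x: "coprime x (int p)" "coprime x' (int p)" and y: "coprime y (int q)" "coprime y' (int q)"
  shows "w (crt x y) - w (crt x y') = w (crt x' y) - w (crt x' y')"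
proof -
  have wc: "w a = w b" if "[a = b] (mod int M)" for a b using w that by (auto simp: log_relation_def)
  have wcrt: "w (crt a b) = w (crt a' b')" if "[a = a'] (mod int p)" "[b = b'] (mod int q)" for a b a' b'
    by (rule wc) (use that crt_cong_p crt_cong_q in \<open>meson cong_pq_iff cong_sym cong_trans\<close>)
  \<comment> \<open>For fixed \<open>X\<close>, its coefficient in the first component is a function
    of the second component that is orthogonal to every nontrivial \<open>Y\<close>, hence constant
    on units.\<close>
  have fixX: "(\<Sum>a\<in>{0..<int p}. w (crt a y) * X a) = (\<Sum>a\<in>{0..<int p}. w (crt a y') * X a)"
    if X: "dchar p X" "coprime u (int p)" "X u \<noteq> 1" for X u
  proof (rule constant_if_orthogonal_to_characters[OF q _ _ y, of "\<lambda>b. \<Sum>a\<in>{0..<int p}. w (crt a b) * X a"])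
    fix b b' :: int assume "[b = b'] (mod int q)"
    then show "(\<Sum>a\<in>{0..<int p}. w (crt a b) * X a) = (\<Sum>a\<in>{0..<int p}. w (crt a b') * X a)"
      using wcrt[OF cong_refl] by (intro sum.cong refl) metis
  next
    fix Y v assume Y: "dchar q Y" "coprime v (int q)" "Y v \<noteq> 1"
    have "(\<Sum>b\<in>{0..<int q}. (\<Sum>a\<in>{0..<int p}. w (crt a b) * X a) * Y b)
        = (\<Sum>a\<in>{0..<int p}. \<Sum>b\<in>{0..<int q}. w (crt a b) * (X (crt a b) * Y (crt a b)))"
      unfolding sum_distrib_right
      by (subst sum.swap) (simp add: dchar_cong[OF X(1) crt_cong_p] dchar_cong[OF Y(1) crt_cong_q] mult_ac)
    also have "\<dots> = (\<Sum>a\<in>R. w a * (X a * Y a))"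
    proof (rule sum_crt[symmetric])
      fix a b assume "[a = b] (mod int M)"
      then show "w a * (X a * Y a) = w b * (X b * Y b)"
        using wc dchar_cong[OF X(1)] dchar_cong[OF Y(1)] cong_pq_iff by metis
    qed
    also have "\<dots> = 0" by (rule log_relation_orthogonal[OF w X Y])
    finally show "(\<Sum>b\<in>{0..<int q}. (\<Sum>a\<in>{0..<int p}. w (crt a b) * X a) * Y b) = 0" .
  qed
  show ?thesis
  proof (rule constant_if_orthogonal_to_characters[OF p _ _ x, of "\<lambda>a. w (crt a y) - w (crt a y')"])
    fix a a' :: int assume "[a = a'] (mod int p)"
    then show "w (crt a y) - w (crt a y') = w (crt a' y) - w (crt a' y')" using wcrt[OF _ cong_refl] by metis
  next
    fix X u assume "dchar p X" "coprime u (int p)" "X u \<noteq> 1"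
    from fixX[OF this] show "(\<Sum>a\<in>{0..<int p}. (w (crt a y) - w (crt a y')) * X a) = 0"
      by (simp add: left_diff_distrib sum_subtractf)
  qed
qed

lemma sum_multiples_of_p:
  fixes h :: "int \<Rightarrow> 'a::comm_monoid_add"
  assumes "\<And>a. \<not> int p dvd a \<Longrightarrow> h a = 0"
  shows "(\<Sum>a\<in>R. h a) = (\<Sum>b\<in>{0..<int q}. h (int p * b))"
proof -
  have p0: "int p > 0" using p by simp
  have "(\<Sum>b\<in>{0..<int q}. h (int p * b)) = (\<Sum>a\<in>(*) (int p) ` {0..<int q}. h a)"
    using p0 by (subst sum.reindex) (auto intro: inj_onI)
  also have "\<dots> = (\<Sum>a\<in>R. h a)"
  proof (rule sum.mono_neutral_left)
    show "(*) (int p) ` {0..<int q} \<subseteq> R" using p0 by auto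
    have "a \<in> (*) (int p) ` {0..<int q}" if "a \<in> R" "int p dvd a" for a
    proof -
      from that obtain b where "a = int p * b" by blast
      then show ?thesis using that p0 by (auto simp: zero_le_mult_iff)
    qed
    then show "\<forall>a\<in>R - (*) (int p) ` {0..<int q}. h a = 0" using assms by blast
  qed simp
  finally show ?thesis ..
qed

text \<open>A character modulo \<open>q\<close> is extended by the principal character modulo
  \<open>p\<close>. This is imprimitive, but harmless now: units drop out by hypothesis, and at
  multiples of \<open>q\<close> not divisible by \<open>p\<close> the twisted sum vanishes. Only
  multiples of \<open>p\<close> are left, where everything reduces to the modulus
  \<open>q\<close>.\<close>

lemma log_relation_nonunit_part:
  assumes w: "log_relation w" and z: "\<And>a. coprime a (int M) \<Longrightarrow> w a = 0"
    and b: "coprime b (int q)" "coprime b' (int q)"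
  shows "w (int p * b) = w (int p * b')"
proof (rule constant_if_orthogonal_to_characters[OF q _ _ b, of "\<lambda>b. w (int p * b)"])
  have wc: "w a = w b" if "[a = b] (mod int M)" for a b using w that by (auto simp: log_relation_def)
  have weven: "w (- a) = w a" for a using w by (simp add: log_relation_def)
  show per: "w (int p * a) = w (int p * b)" if "[a = b] (mod int q)" for a b
    by (rule wc) (use that in \<open>simp add: cong_iff_dvd_diff flip: right_diff_distrib\<close>)
  fix X u assume X: "dchar q X" "coprime u (int q)" "X u \<noteq> 1"
  show "(\<Sum>y\<in>{0..<int q}. w (int p * y) * X y) = 0"
  proof (cases "X (- 1) = 1")
    case False
    then have "X (- 1) = - 1" using dchar_minus_1[OF X(1)] by blast
    from odd_character_sum[OF X(1) this, of "\<lambda>y. w (int p * y)"] show ?thesis using per weven by simp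
  next
    case True
    define Z where "Z = (\<lambda>a. cnj (X a))"
    have Z: "dchar q Z" "Z u \<noteq> 1" "Z (- 1) = 1" using dchar_cnj[OF X(1)] X(3) True
      by (auto simp: Z_def dest: arg_cong[of _ _ cnj])
    have pos: "M > 0" "q > 1" "q > 0" "p > 0" using p q by auto
    define T where "T = (\<Sum>t\<in>{0..<int q}. Z t * of_real (log_cyc q t))"
    have "T \<noteq> 0" unfolding T_def
      by (rule log_cyc_char_sum_nonzero[OF primitive_dchar_prime[OF q(1) Z(1) X(2) Z(2)] pos(2) Z(3)])
    define X0 :: "int \<Rightarrow> complex" where "X0 = (\<lambda>a. if coprime a (int p) then 1 else 0)"
    have X0: "dchar p X0" unfolding dchar_def X0_def
      by (auto dest: cong_imp_coprime cong_sym[THEN cong_imp_coprime])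
    define Y where "Y = (\<lambda>a. X0 a * Z a)"
    have Y: "dchar M Y" unfolding Y_def by (rule dchar_times[OF X0 Z(1)])
    have hc: "complex_of_real (log_cyc n a) = of_real (log_cyc n b)" if "[a = b] (mod int n)" for n a b
      using log_cyc_cong[OF that] by simp
    let ?T = "\<lambda>a. \<Sum>t\<in>R. Y t * of_real (log_cyc M (t * a))"
    have T1: "w a * ?T a = 0" if "\<not> int p dvd a" for a
    proof (cases "coprime a (int q)")
      case True
      then show ?thesis using z that coprime_pq_iff coprime_prime_iff by simp
    next
      case False
      then have "int q dvd a" using coprime_prime_iff by blast
      then have fx: "[crt 1 u * a = a] (mod int M)"
        unfolding cong_pq_iff using cong_scalar_right[OF crt_cong_p[of 1 u], of a]
        by (auto simp: cong_iff_dvd_diff)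
      have "Y (crt 1 u) = Z u"
        using dchar_cong[OF X0 crt_cong_p] dchar_cong[OF Z(1) crt_cong_q] dchar_1[OF X0] by (simp add: Y_def)
      then have Yu: "Y (crt 1 u) \<noteq> 1" using Z(2) by simp
      have cu: "coprime (crt 1 u) (int M)" unfolding coprime_crt_iff using X(2) by simp
      have "?T a = 0"
        by (rule character_sum_dilate_fixed[of "p * q" Y "\<lambda>a. of_real (log_cyc M a)" "crt 1 u", OF Y pos(1) _ cu fx Yu])
           (rule hc)
      then show ?thesis by simp
    qed
    \<comment> \<open>On multiples of \<open>p\<close> the logarithm depends only on
      \<open>t mod q\<close>, and each residue modulo \<open>q\<close> is paired with the
      \<open>p - 1\<close> units modulo \<open>p\<close>.\<close>
    have T2: "?T (int p * y) = of_nat (p - 1) * (cnj (Z y) * T)" for y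
    proof -
      have "?T (int p * y) = (\<Sum>t\<in>R. X0 t * (Z t * of_real (log_cyc q (t * y))))"
        using log_cyc_scale[OF pos(4), of q] by (simp add: Y_def mult.assoc mult.left_commute[of _ "int p"])
      also have "\<dots> = (\<Sum>x\<in>{0..<int p}. \<Sum>t\<in>{0..<int q}. X0 (crt x t) * (Z (crt x t) * of_real (log_cyc q (crt x t * y))))"
      proof (rule sum_crt)
        fix a b assume ab: "[a = b] (mod int M)"
        then have "[a * y = b * y] (mod int q)" using cong_pq_iff cong_scalar_right by blast
        then show "X0 a * (Z a * of_real (log_cyc q (a * y))) = X0 b * (Z b * of_real (log_cyc q (b * y)))"
          using ab dchar_cong[OF X0] dchar_cong[OF Z(1)] cong_pq_iff log_cyc_cong by metis
      qed
      also have "\<dots> = (\<Sum>x\<in>{0..<int p}. \<Sum>t\<in>{0..<int q}. X0 x * (Z t * of_real (log_cyc q (t * y))))"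
        using dchar_cong[OF X0 crt_cong_p] dchar_cong[OF Z(1) crt_cong_q]
          log_cyc_cong[OF cong_scalar_right[OF crt_cong_q]] by simp
      also have "\<dots> = (\<Sum>x\<in>{0..<int p}. X0 x) * (\<Sum>t\<in>{0..<int q}. Z t * of_real (log_cyc q (t * y)))"
        by (simp add: sum_product)
      also have "(\<Sum>x\<in>{0..<int p}. X0 x) = of_nat (p - 1)"
      proof -
        have "(\<Sum>x\<in>{0..<int p}. X0 x) = (\<Sum>x\<in>{1..<int p}. 1)"
        proof (rule sum.mono_neutral_cong_right)
          have "X0 x = 0" if "x \<in> {0..<int p} - {1..<int p}" for x
          proof -
            have "x = 0" using that by auto
            then show ?thesis using coprime_prime_iff(1) by (simp add: X0_def)
          qed
          then show "\<forall>x\<in>{0..<int p} - {1..<int p}. X0 x = 0" by blast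
          show "X0 x = 1" if "x \<in> {1..<int p}" for x
            using that coprime_prime_iff(1) zdvd_not_zless[of x "int p"] by (simp add: X0_def)
        qed auto
        then show ?thesis by (simp add: nat_diff_distrib')
      qed
      also have "(\<Sum>t\<in>{0..<int q}. Z t * of_real (log_cyc q (t * y))) = cnj (Z y) * T"
      proof (cases "coprime y (int q)")
        case True
        show ?thesis unfolding T_def
          by (rule character_sum_dilate_coprime[of q Z "\<lambda>a. of_real (log_cyc q a)", OF Z(1) pos(3) _ True])
             (rule hc)
      next
        case False
        then have qy: "int q dvd y" using coprime_prime_iff by blast
        then have "log_cyc q (t * y) = 0" for t using log_cyc_cong[of "t * y" 0 q] by (simp add: cong_0_iff)
        moreover have "Z y = 0" using False dchar_eq_0_iff[OF Z(1)] by blast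
        ultimately show ?thesis by simp
      qed
      finally show ?thesis .
    qed
    have "0 = (\<Sum>b\<in>{0..<int q}. w (int p * b) * ?T (int p * b))"
      using log_relation_character[OF w Y] sum_multiples_of_p[of "\<lambda>a. w a * ?T a", OF T1] by simp
    also have "\<dots> = of_nat (p - 1) * T * (\<Sum>b\<in>{0..<int q}. w (int p * b) * X b)"
      unfolding T2 by (simp add: sum_distrib_left Z_def mult_ac)
    finally show ?thesis using \<open>T \<noteq> 0\<close> p by simp
  qed
qed

end

text \<open>Clearing denominators and taking absolute values turns the relation into an equality
  between a power of \<open>q\<close> and a power of \<open>p\<close>.\<close>

lemma ln_primes_independent:
  fixes \<alpha> \<beta> :: rat
  assumes "prime p" "prime q" "p \<noteq> q" and eq: "of_rat \<alpha> * ln (real q) + of_rat \<beta> * ln (real p) = 0"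
  shows "\<alpha> = 0 \<and> \<beta> = 0"
proof -
  have p1: "p > 1" "q > 1" using assms prime_gt_1_nat by auto
  obtain a b where ab: "quotient_of \<alpha> = (a, b)" by fastforce
  obtain c d where cd: "quotient_of \<beta> = (c, d)" by fastforce
  have bd: "b > 0" "d > 0" "\<alpha> = of_int a / of_int b" "\<beta> = of_int c / of_int d"
    using ab cd quotient_of_denom_pos quotient_of_div by auto
  define A where "A = a * d"
  define B where "B = c * b"
  have r: "of_rat \<alpha> = (of_int a / of_int b :: real)" "of_rat \<beta> = (of_int c / of_int d :: real)"
    using bd(3,4) by (simp_all add: of_rat_divide)
  have "of_int A * ln (real q) + of_int B * ln (real p) = of_int b * of_int d * (of_rat \<alpha> * ln (real q) + of_rat \<beta> * ln (real p))"
    unfolding r using bd(1,2) by (simp add: A_def B_def field_simps)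
  then have AB: "of_int A * ln (real q) + of_int B * ln (real p) = 0" using eq by simp
  then have "\<bar>of_int A * ln (real q)\<bar> = \<bar>of_int B * ln (real p)\<bar>" by linarith
  then have "real (nat \<bar>A\<bar>) * ln (real q) = real (nat \<bar>B\<bar>) * ln (real p)"
    using p1 by (simp add: abs_mult)
  then have "ln (real q ^ nat \<bar>A\<bar>) = ln (real p ^ nat \<bar>B\<bar>)" using p1 by (simp add: ln_realpow)
  then have "real q ^ nat \<bar>A\<bar> = real p ^ nat \<bar>B\<bar>" using p1 by (subst (asm) ln_inj_iff) auto
  then have eqn: "q ^ nat \<bar>A\<bar> = p ^ nat \<bar>B\<bar>" by (metis of_nat_eq_iff of_nat_power)
  have "A = 0"
  proof (rule ccontr)
    assume "A \<noteq> 0"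
    then have "q dvd q ^ nat \<bar>A\<bar>" by (simp add: dvd_power)
    then have "q dvd p" using assms(2) eqn prime_dvd_power by metis
    then show False using assms primes_dvd_imp_eq by blast
  qed
  then have "B = 0" using AB p1 by simp
  then show ?thesis using \<open>A = 0\<close> bd by (simp add: A_def B_def)
qed

context two_primes
begin

lemma log_relation_swap: "log_relation w \<Longrightarrow> two_primes.log_relation q p w"
  unfolding two_primes.log_relation_def[OF swap] log_relation_def mult.commute[of q p] .

text \<open>Rationality is essential: the weights \<open>ln p\<close> on nonzero multiples of
  \<open>p\<close> and \<open>- ln q\<close> on nonzero multiples of \<open>q\<close> also form a
  \<open>log_relation\<close>.\<close>

lemma rational_log_relation_nonunit:
  fixes w :: "int \<Rightarrow> rat"
  assumes w: "log_relation (\<lambda>a. of_real (of_rat (w a)))" and z: "\<And>a. coprime a (int M) \<Longrightarrow> w a = 0"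
    and a: "\<not> int M dvd a"
  shows "w a = 0"
proof -
  have P: "w (int p * b) = w (int p)" if "coprime b (int q)" for b
    using log_relation_nonunit_part[OF w _ that, of 1] z by simp
  have Q: "w (int q * b) = w (int q)" if "coprime b (int p)" for b
    using two_primes.log_relation_nonunit_part[OF swap log_relation_swap[OF w] _ that, of 1] z
    by (simp add: mult.commute)
  have "complex_of_real (\<Sum>a\<in>R. of_rat (w a) * log_cyc M a)
      = (\<Sum>a\<in>R. of_real (of_rat (w a)) * of_real (log_cyc M (1 * a)))" by simp
  also have "\<dots> = 0" using w unfolding log_relation_def by (metis coprime_1_left)
  finally have "0 = (\<Sum>a\<in>R. of_rat (w a) * log_cyc M a)" by (simp only: of_real_eq_0_iff)
  also have "\<dots> = (\<Sum>a\<in>R. (if int p dvd a then of_rat (w a) * log_cyc M a else 0)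
       + (if int q dvd a then of_rat (w a) * log_cyc M a else 0))"
  \<comment> \<open>The two cases overlap only at \<open>a = 0\<close>, where \<open>log_cyc\<close>
    is 0.\<close>
  proof (rule sum.cong[OF refl])
    fix a assume a: "a \<in> R"
    have "w a * 1 = 0" if "\<not> int p dvd a" "\<not> int q dvd a"
      using z coprime_pq_iff coprime_prime_iff that by simp
    moreover have "a = 0" if "int p dvd a" "int q dvd a"
      using divides_mult[OF that coprime_p_q] a zdvd_not_zless[of a "int M"] by force
    ultimately show "of_rat (w a) * log_cyc M a = (if int p dvd a then of_rat (w a) * log_cyc M a else 0)
       + (if int q dvd a then of_rat (w a) * log_cyc M a else 0)" by auto
  qed
  also have "\<dots> = (\<Sum>b\<in>{0..<int q}. of_rat (w (int p * b)) * log_cyc M (int p * b))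
      + (\<Sum>b\<in>{0..<int p}. of_rat (w (int q * b)) * log_cyc (q * p) (int q * b))"
    using sum_multiples_of_p[of "\<lambda>a. if int p dvd a then of_rat (w a) * log_cyc M a else 0"]
      two_primes.sum_multiples_of_p[OF swap, of "\<lambda>a. if int q dvd a then of_rat (w a) * log_cyc M a else 0"]
    by (simp add: sum.distrib mult.commute[of q p] mult.commute[of "int q" "int p"])
  also have "(\<Sum>b\<in>{0..<int q}. of_rat (w (int p * b)) * log_cyc M (int p * b)) = (\<Sum>b\<in>{0..<int q}. of_rat (w (int p)) * log_cyc q b)"
  proof (rule sum.cong[OF refl])
    fix b assume "b \<in> {0..<int q}"
    then have "b = 0 \<or> coprime b (int q)" using coprime_prime_iff zdvd_not_zless[of b "int q"] by force
    then show "of_rat (w (int p * b)) * log_cyc M (int p * b) = of_rat (w (int p)) * log_cyc q b"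
      using P p log_cyc_scale by auto
  qed
  also have "\<dots> = of_rat (w (int p)) * ln (real q)"
    using sum_log_cyc[of q] q unfolding sum_distrib_left[symmetric] by simp
  also have "(\<Sum>b\<in>{0..<int p}. of_rat (w (int q * b)) * log_cyc (q * p) (int q * b)) = (\<Sum>b\<in>{0..<int p}. of_rat (w (int q)) * log_cyc p b)"
  proof (rule sum.cong[OF refl])
    fix b assume "b \<in> {0..<int p}"
    then have "b = 0 \<or> coprime b (int p)" using coprime_prime_iff zdvd_not_zless[of b "int p"] by force
    then show "of_rat (w (int q * b)) * log_cyc (q * p) (int q * b) = of_rat (w (int q)) * log_cyc p b"
      using Q q log_cyc_scale by auto
  qed
  also have "\<dots> = of_rat (w (int q)) * ln (real p)"
    using sum_log_cyc[of p] p unfolding sum_distrib_left[symmetric] by simp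
  finally have "w (int p) = 0 \<and> w (int q) = 0"
    using ln_primes_independent[OF p(1) q(1) pq, of "w (int p)" "w (int q)"] by simp
  then have P0: "w (int p * b) = 0" if "coprime b (int q)" for b using P that by simp
  have Q0: "w (int q * b) = 0" if "coprime b (int p)" for b
    using Q that \<open>w (int p) = 0 \<and> w (int q) = 0\<close> by simp
  consider "coprime a (int M)" | "int p dvd a" | "int q dvd a" using coprime_pq_iff coprime_prime_iff by blast
  then show ?thesis
  proof cases
    case 1
    then show ?thesis using z by blast
  next
    case 2
    then obtain b where "a = int p * b" by blast
    moreover have "\<not> int q dvd b" using a calculation by (metis mult_dvd_mono dvd_refl of_nat_mult)
    ultimately show ?thesis using P0 coprime_prime_iff by blast
  next
    case 3
    then obtain b where "a = int q * b" by blast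
    moreover have "\<not> int p dvd b" using a calculation by (metis mult_dvd_mono dvd_refl mult.commute of_nat_mult)
    ultimately show ?thesis using Q0 coprime_prime_iff by blast
  qed
qed

end

section \<open>The basis\<close>

definition pm_cong :: "nat \<Rightarrow> int \<Rightarrow> int \<Rightarrow> bool" where
  "pm_cong m a b \<longleftrightarrow> [a = b] (mod int m) \<or> [a = - b] (mod int m)"

lemma pm_cong_iff_dvd: "pm_cong m a b \<longleftrightarrow> int m dvd a - b \<or> int m dvd a + b"
  by (simp add: pm_cong_def cong_iff_dvd_diff)

lemma pm_cong_uminus [simp]: "pm_cong m (- a) b \<longleftrightarrow> pm_cong m a b"
  unfolding pm_cong_iff_dvd by (metis add.commute diff_minus_eq_add dvd_minus_iff minus_add_distrib minus_diff_eq uminus_add_conv_diff)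

lemma pm_cong_cong: "[a = a'] (mod int m) \<Longrightarrow> pm_cong m a b \<longleftrightarrow> pm_cong m a' b"
  unfolding pm_cong_def by (meson cong_sym cong_trans)

lemma pm_cong_sym: "pm_cong m a b \<Longrightarrow> pm_cong m b a"
  unfolding pm_cong_iff_dvd by (metis add.commute dvd_diff_commute)

lemma pm_cong_trans: "pm_cong m a b \<Longrightarrow> pm_cong m b c \<Longrightarrow> pm_cong m a c"
  by (metis cong_trans pm_cong_cong pm_cong_def pm_cong_uminus)

lemma pm_cong_coprime: "pm_cong m a b \<Longrightarrow> coprime a (int m) \<longleftrightarrow> coprime b (int m)"
  unfolding pm_cong_def by (metis cong_imp_coprime cong_sym coprime_minus_left_iff)

lemma red_pm_cong:
  assumes "\<not> int m dvd a" "m > 0"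
  shows "red m a \<in> {1..m div 2}" "pm_cong m (int (red m a)) a"
  using theI'[OF red_unique_existence[of a m]] assms unfolding red_def[symmetric] pm_cong_def
  by (auto simp: cong_0_iff)

lemma red_eq_iff:
  assumes "\<not> int m dvd a" "m > 0" "j \<in> {1..m div 2}"
  shows "red m a = j \<longleftrightarrow> pm_cong m (int j) a"
proof
  assume "pm_cong m (int j) a"
  then show "red m a = j" unfolding red_def
    using assms by (intro the1_equality[OF red_unique_existence]) (auto simp: pm_cong_def cong_0_iff)
qed (use red_pm_cong assms in blast)

lemma sum_residues_half:
  fixes h :: "int \<Rightarrow> 'a::comm_ring_1"
  assumes "odd m" and per: "\<And>a b. [a = b] (mod int m) \<Longrightarrow> h a = h b" and ev: "\<And>a. h (- a) = h a"
  shows "(\<Sum>a\<in>{0..<int m}. h a) = h 0 + 2 * (\<Sum>k\<in>{1..m div 2}. h (int k))"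
proof -
  obtain n where n: "m = 2 * n + 1" using assms(1) oddE by blast
  have "{0..<int m} = insert 0 ({1..int n} \<union> {int n + 1..int m - 1})" using n by auto
  then have "(\<Sum>a\<in>{0..<int m}. h a) = h 0 + ((\<Sum>a\<in>{1..int n}. h a) + (\<Sum>a\<in>{int n + 1..int m - 1}. h a))"
    by (simp add: sum.union_disjoint)
  also have "(\<Sum>a\<in>{1..int n}. h a) = (\<Sum>k\<in>{1..n}. h (int k))"
    by (rule sum.reindex_bij_witness[of _ int nat]) auto
  also have "(\<Sum>a\<in>{int n + 1..int m - 1}. h a) = (\<Sum>k\<in>{1..n}. h (int k))"
  proof (rule sum.reindex_bij_witness[of _ "\<lambda>k. int m - int k" "\<lambda>a. nat (int m - a)"])
    fix a assume a: "a \<in> {int n + 1..int m - 1}"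
    have "[int m - a = - a] (mod int m)" by (simp add: cong_iff_dvd_diff)
    then have "h (int m - a) = h a" using per ev by metis
    then show "h (int (nat (int m - a))) = h a" using a by simp
  qed (use n in auto)
  finally show ?thesis using n by simp
qed

lemma sum_pm_cong:
  fixes h :: "int \<Rightarrow> 'a::comm_ring_1"
  assumes "odd m" "\<not> int m dvd x" and per: "\<And>a b. [a = b] (mod int m) \<Longrightarrow> h a = h b" and ev: "\<And>a. h (- a) = h a"
  shows "(\<Sum>a\<in>{0..<int m}. of_bool (pm_cong m a x) * h a) = 2 * h x"
proof -
  have m0: "m > 0" using assms(1) by (rule odd_pos)
  have "(\<Sum>a\<in>{0..<int m}. of_bool (pm_cong m a x) * h a) = of_bool (pm_cong m 0 x) * h 0 + 2 * (\<Sum>k\<in>{1..m div 2}. of_bool (pm_cong m (int k) x) * h (int k))"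
  proof (rule sum_residues_half[OF assms(1)])
    show "of_bool (pm_cong m a x) * h a = of_bool (pm_cong m b x) * h b" if "[a = b] (mod int m)" for a b
      using per[OF that] pm_cong_cong[OF that, of x] by simp
  qed (simp add: ev)
  also have "(\<Sum>k\<in>{1..m div 2}. of_bool (pm_cong m (int k) x) * h (int k)) = (\<Sum>k\<in>{1..m div 2}. if k = red m x then h x else 0)"
  proof (rule sum.cong[OF refl])
    fix k assume k: "k \<in> {1..m div 2}"
    show "of_bool (pm_cong m (int k) x) * h (int k) = (if k = red m x then h x else 0)"
    proof (cases "pm_cong m (int k) x")
      case True
      then have "h (int k) = h x" using per ev unfolding pm_cong_def by metis
      then show ?thesis using True red_eq_iff[OF assms(2) m0 k] by auto
    next
      case False
      then show ?thesis using red_eq_iff[OF assms(2) m0 k] by auto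
    qed
  qed
  also have "\<dots> = h x" using red_pm_cong(1)[OF assms(2) m0] by simp
  also have "pm_cong m 0 x \<longleftrightarrow> False" using assms(2) by (simp add: pm_cong_iff_dvd)
  finally show ?thesis by simp
qed

text \<open>The modulus of \<open>1 - cis (2 * t)\<close> is \<open>2 * sin t\<close> for
  \<open>0 < t < pi\<close>.\<close>

lemma Uval_eq_log_cyc:
  assumes "k \<in> {1..m div 2}"
  shows "Uval m k = (log_cyc m (int k) - log_cyc m 1) / ln 2"
proof -
  have m: "m \<ge> 2" using assms by auto
  have nrm: "norm (1 - unity_root m (int j)) = 2 * sin (pi * real j / real m)" if "j \<in> {1..m div 2}" for j
  proof -
    have j: "0 < pi * real j / real m" "pi * real j / real m < pi" using that m by (auto simp: field_simps)
    let ?t = "pi * real j / real m"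
    have "(norm (1 - unity_root m (int j)))\<^sup>2 = (1 - cos (2 * ?t))\<^sup>2 + (sin (2 * ?t))\<^sup>2"
      by (simp add: cmod_power2 unity_root_def mult.assoc)
    also have "\<dots> = (1 - (1 - 2 * (sin ?t)\<^sup>2))\<^sup>2 + (2 * sin ?t * cos ?t)\<^sup>2"
      by (simp only: sin_double cos_double_sin)
    also have "\<dots> = (2 * sin ?t)\<^sup>2 * ((sin ?t)\<^sup>2 + (cos ?t)\<^sup>2)"
    proof -
      have "(1 - (1 - 2 * s\<^sup>2))\<^sup>2 + (2 * s * c)\<^sup>2 = (2 * s)\<^sup>2 * (s\<^sup>2 + c\<^sup>2)" for s c :: real
        by (simp add: power2_eq_square algebra_simps)
      then show ?thesis .
    qed
    also have "\<dots> = (2 * sin ?t)\<^sup>2" by simp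
    finally have "(norm (1 - unity_root m (int j)))\<^sup>2 = (2 * sin ?t)\<^sup>2" .
    then show ?thesis by (rule power2_eq_imp_eq) (use sin_gt_zero[OF j] in auto)
  qed
  have pos: "sin (pi * real j / real m) > 0" if "j \<in> {1..m div 2}" for j
  proof (rule sin_gt_zero)
    have "j < m" "j > 0" using that m by auto
    then show "0 < pi * real j / real m" "pi * real j / real m < pi" using m by (auto simp: field_simps)
  qed
  have 1: "1 \<in> {1..m div 2}" using m by auto
  have L: "log_cyc m (int j) = ln 2 + ln (sin (pi * real j / real m))" if "j \<in> {1..m div 2}" for j
    unfolding log_cyc_def nrm[OF that] using pos[OF that] by (simp add: ln_mult)
  have "Uval m k = ln (sin (pi * real k / real m) / sin (pi * real 1 / real m)) / ln 2"
    by (simp add: Uval_def log_def)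
  also have "ln (sin (pi * real k / real m) / sin (pi * real 1 / real m))
      = ln (sin (pi * real k / real m)) - ln (sin (pi * real 1 / real m))"
    using pos[OF assms] pos[OF 1] ln_div[of "sin (pi * real k / real m)" "sin (pi * real 1 / real m)"] by simp
  also have "\<dots> = log_cyc m (int k) - log_cyc m (int 1)" unfolding L[OF assms] L[OF 1] by simp
  finally show ?thesis by simp
qed

abbreviation coef :: "(nat \<Rightarrow>\<^sub>0 rat) \<Rightarrow> nat \<Rightarrow> rat" where "coef \<equiv> Poly_Mapping.lookup"

text \<open>The zero-sum condition removes the common term \<open>log_cyc m 1\<close> from all
  \<open>Uval m k\<close>, while the coefficient at 1 is free to be chosen because
  \<open>Uval m 1 = 0\<close>.\<close>

lemma in_U_relations_iff:
  fixes d :: "int \<Rightarrow> rat"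
  assumes "odd m" "m \<ge> 3" and per: "\<And>a b. [a = b] (mod int m) \<Longrightarrow> d a = d b" and ev: "\<And>a. d (- a) = d a"
    and zero: "(\<Sum>k\<in>{1..m div 2}. d (int k)) = 0"
    and f: "Poly_Mapping.keys f \<subseteq> {2..m div 2}" "\<And>k. k \<in> {2..m div 2} \<Longrightarrow> coef f k = d (int k)"
  shows "f \<in> U_relations m \<longleftrightarrow> (\<Sum>a\<in>{0..<int m}. of_rat (d a) * log_cyc m a) = 0"
proof -
  let ?L = "\<Sum>k\<in>{1..m div 2}. of_rat (d (int k)) * log_cyc m (int k)"
  have z: "(\<Sum>k\<in>{1..m div 2}. real_of_rat (d (int k))) = 0" using zero by (metis of_rat_0 of_rat_sum)
  have "(\<Sum>k = 2..m div 2. of_rat (coef f k) * Uval m k) = (\<Sum>k = 2..m div 2. of_rat (d (int k)) * Uval m k)"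
    using f(2) by simp
  also have "\<dots> = (\<Sum>k\<in>{1..m div 2}. of_rat (d (int k)) * Uval m k)"
  proof (rule sum.mono_neutral_left)
    have "k = 1" if "k \<in> {1..m div 2} - {2..m div 2}" for k using that by auto
    moreover have "Uval m 1 = 0" using assms(2) Uval_eq_log_cyc[of 1 m] by simp
    ultimately show "\<forall>k\<in>{1..m div 2} - {2..m div 2}. of_rat (d (int k)) * Uval m k = 0"
      by (metis mult_zero_right)
  qed auto
  also have "\<dots> = (\<Sum>k\<in>{1..m div 2}. (of_rat (d (int k)) * log_cyc m (int k) - of_rat (d (int k)) * log_cyc m 1) * (1 / ln 2))"
    by (rule sum.cong[OF refl]) (simp add: Uval_eq_log_cyc right_diff_distrib)
  also have "\<dots> = (?L - (\<Sum>k\<in>{1..m div 2}. real_of_rat (d (int k))) * log_cyc m 1) * (1 / ln 2)"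
    by (simp only: sum_distrib_right[symmetric] sum_subtractf)
  also have "\<dots> = ?L / ln 2" unfolding z by simp
  finally have *: "(\<Sum>k = 2..m div 2. of_rat (coef f k) * Uval m k) = ?L / ln 2" .
  have "(\<Sum>a\<in>{0..<int m}. of_rat (d a) * log_cyc m a) = of_rat (d 0) * log_cyc m 0 + 2 * ?L"
  proof (rule sum_residues_half[OF assms(1)])
    show "of_rat (d a) * log_cyc m a = of_rat (d b) * log_cyc m b" if "[a = b] (mod int m)" for a b
      using per[OF that] log_cyc_cong[OF that] by simp
  qed (simp add: ev log_cyc_uminus)
  then show ?thesis using * f(1) by (simp add: U_relations_def)
qed

text \<open>The distribution relation at \<open>k\<close>, made even. The residues congruent to
  \<open>k\<close> or \<open>-k\<close> modulo \<open>p\<close> consist of units and of the two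
  residues of \<open>q * qs * k\<close> and its negative; the right-hand side
  \<open>v (q * k)\<close> is subtracted. \<open>Rform\<close> consists of the differences of these
  weights from those for \<open>k = 1\<close>.\<close>

definition dist_coeff :: "nat \<Rightarrow> nat \<Rightarrow> int \<Rightarrow> int \<Rightarrow> int \<Rightarrow> rat" where
  "dist_coeff p q qs k a = of_bool (coprime a (int (p * q)) \<and> pm_cong p a k)
     + of_bool (pm_cong (p * q) a (int q * qs * k)) - of_bool (pm_cong (p * q) a (int q * k))"

lemma lookup_Yvar: "coef (Yvar i) j = of_bool (i \<noteq> 1 \<and> i = j)"
  by (auto simp: Yvar_def lookup_single when_def)

lemma lf_basis_finiteI:
  assumes I: "finite I" and V: "lf.subspace V" and BV: "\<And>i. i \<in> I \<Longrightarrow> B i \<in> V"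
    and indep: "\<And>u i. (\<Sum>i\<in>I. lf_scale (u i) (B i)) = 0 \<Longrightarrow> i \<in> I \<Longrightarrow> u i = 0"
    and gen: "\<And>v. v \<in> V \<Longrightarrow> \<exists>u. v = (\<Sum>i\<in>I. lf_scale (u i) (B i))"
  shows "lf_basis B I V" unfolding lf_basis_def
proof (intro conjI)
  show inj: "inj_on B I"
  proof (rule inj_onI, rule ccontr)
    fix i j assume ij: "i \<in> I" "j \<in> I" "B i = B j" "i \<noteq> j"
    \<comment> \<open>Two equal members with different indices would satisfy
      \<open>B i - B j = 0\<close> with nonzero coefficients.\<close>
    define u where "u = (\<lambda>k. of_bool (k = i) - of_bool (k = j) :: rat)"
    have "(\<Sum>k\<in>I. lf_scale (u k) (B k)) = (\<Sum>k\<in>I. (if k = i then B i else 0) - (if k = j then B j else 0))"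
      by (rule sum.cong[OF refl]) (use ij in \<open>auto simp: u_def intro!: poly_mapping_eqI simp: lookup_minus\<close>)
    also have "\<dots> = 0" using ij I by (simp add: sum_subtractf)
    finally have "u i = 0" using indep ij by blast
    then show False using ij by (simp add: u_def)
  qed
  show "lf.independent (B ` I)"
  proof (rule lf.independent_if_scalars_zero)
    fix f v assume f: "(\<Sum>x\<in>B ` I. lf_scale (f x) x) = 0" and v: "v \<in> B ` I"
    have "(\<Sum>i\<in>I. lf_scale (f (B i)) (B i)) = 0" using f sum.reindex[OF inj, of "\<lambda>x. lf_scale (f x) x"] by simp
    moreover obtain i where "i \<in> I" "v = B i" using v by blast
    ultimately show "f v = 0" using indep[of "\<lambda>i. f (B i)" i] by simp
  qed (use I in simp)
  show "lf.span (B ` I) = V"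
  proof
    show "lf.span (B ` I) \<subseteq> V" using BV V by (intro lf.span_minimal) auto
    show "V \<subseteq> lf.span (B ` I)"
    proof
      fix v assume "v \<in> V"
      then obtain u where "v = (\<Sum>i\<in>I. lf_scale (u i) (B i))" using gen by blast
      moreover have "(\<Sum>i\<in>I. lf_scale (u i) (B i)) \<in> lf.span (B ` I)"
        by (intro lf.span_sum lf.span_scale lf.span_base imageI)
      ultimately show "v \<in> lf.span (B ` I)" by simp
    qed
  qed
qed

lemma U_relations_iff:
  "f \<in> U_relations m \<longleftrightarrow> (\<forall>k. k \<notin> {2..m div 2} \<longrightarrow> coef f k = 0) \<and>
     (\<Sum>k = 2..m div 2. of_rat (coef f k) * Uval m k) = 0"
  by (auto simp: U_relations_def in_keys_iff subset_iff)

lemma subspace_U_relations: "lf.subspace (U_relations m)" unfolding lf.subspace_def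
proof (intro conjI ballI allI)
  show "0 \<in> U_relations m" by (simp add: U_relations_iff)
next
  fix f g assume "f \<in> U_relations m" "g \<in> U_relations m"
  then show "f + g \<in> U_relations m"
    unfolding U_relations_iff by (simp add: lookup_add of_rat_add distrib_right sum.distrib)
next
  fix c f assume "f \<in> U_relations m"
  then show "lf_scale c f \<in> U_relations m"
    unfolding U_relations_iff by (simp add: of_rat_mult mult.assoc flip: sum_distrib_left)
qed

section \<open>Distribution relations as weight functions on residues\<close>

context two_primes
begin

lemma odd_pq: "odd M" using p q prime_odd_nat[of p] prime_odd_nat[of q] by auto

lemma pq_pos: "M > 0" "p > 0" "q > 0" "p * q \<ge> 3"
proof -
  show "M > 0" "p > 0" "q > 0" using p q by auto
  have "3 * 1 \<le> p * q" using p q by (intro mult_mono) auto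
  then show "p * q \<ge> 3" by simp
qed

lemma not_dvd_q_mult: "coprime k (int p) \<Longrightarrow> \<not> int M dvd int q * k"
  using coprime_prime_iff q by auto

lemma not_dvd_qqs_mult:
  assumes "coprime k (int p)"
  shows "\<not> int M dvd int q * qs * k"
proof
  assume "int M dvd int q * qs * k"
  then have "int p dvd int q * qs * k" by (metis dvd_mult_left of_nat_mult)
  moreover have "[int q * qs * k = 1 * k] (mod int p)" by (rule cong_scalar_right[OF qs])
  ultimately have "int p dvd k" by (metis cong_dvd_iff mult_1)
  then show False using assms coprime_prime_iff by blast
qed

lemma dist_coeff_cong:
  assumes "[a = b] (mod int M)"
  shows "dist_coeff p q qs k a = dist_coeff p q qs k b"
proof -
  have "pm_cong p a k \<longleftrightarrow> pm_cong p b k" "\<And>x. pm_cong M a x \<longleftrightarrow> pm_cong M b x"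
    using assms pm_cong_cong cong_pq_iff by blast+
  moreover have "coprime a (int M) \<longleftrightarrow> coprime b (int M)"
    using assms by (metis cong_imp_coprime cong_sym)
  ultimately show ?thesis by (simp add: dist_coeff_def)
qed

lemma dist_coeff_uminus: "dist_coeff p q qs k (- a) = dist_coeff p q qs k a" by (simp add: dist_coeff_def)

lemma pm_cong_pq_imp: "pm_cong M a b \<Longrightarrow> pm_cong p a b \<and> pm_cong q a b"
  unfolding pm_cong_def using cong_pq_iff by blast

text \<open>The correction terms live on multiples of \<open>q\<close>, so on units only the class
  modulo \<open>p\<close> up to sign counts.\<close>

lemma dist_coeff_unit:
  assumes "coprime a (int M)"
  shows "dist_coeff p q qs k a = of_bool (pm_cong p a k)"
proof -
  have "\<not> pm_cong M a (int q * x)" for x using assms pm_cong_coprime[of "p * q" a "int q * x"] q by auto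
  from this[of k] this[of "qs * k"] show ?thesis using assms by (simp add: dist_coeff_def mult.assoc)
qed

lemma sum_congruent_p:
  fixes h :: "int \<Rightarrow> real"
  assumes per: "\<And>a b. [a = b] (mod int M) \<Longrightarrow> h a = h b"
  shows "(\<Sum>a\<in>R. of_bool ([a = k] (mod int p)) * h a) = (\<Sum>i\<in>{0..<int q}. h (k + int p * i))"
proof -
  have c: "[crt x y = k] (mod int p) \<longleftrightarrow> [x = k] (mod int p)" for x y
    using crt_cong_p by (meson cong_sym cong_trans)
  have "(\<Sum>a\<in>R. of_bool ([a = k] (mod int p)) * h a) =
     (\<Sum>x\<in>{0..<int p}. \<Sum>y\<in>{0..<int q}. of_bool ([crt x y = k] (mod int p)) * h (crt x y))"
  proof (rule sum_crt)
    fix a b assume ab: "[a = b] (mod int M)"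
    then have "[a = k] (mod int p) \<longleftrightarrow> [b = k] (mod int p)"
      using cong_pq_iff by (meson cong_sym cong_trans)
    then show "of_bool ([a = k] (mod int p)) * h a = of_bool ([b = k] (mod int p)) * h b" using per[OF ab] by simp
  qed
  also have "\<dots> = (\<Sum>x\<in>{0..<int p}. if x = k mod int p then (\<Sum>y\<in>{0..<int q}. h (crt k y)) else 0)"
  proof (rule sum.cong[OF refl])
    fix x assume x: "x \<in> {0..<int p}"
    show "(\<Sum>y\<in>{0..<int q}. of_bool ([crt x y = k] (mod int p)) * h (crt x y)) = (if x = k mod int p then (\<Sum>y\<in>{0..<int q}. h (crt k y)) else 0)"
    proof (cases "[x = k] (mod int p)")
      case True
      then have "h (crt x y) = h (crt k y)" for y
        by (intro per) (meson cong_pq_iff cong_sym cong_trans crt_cong_p crt_cong_q)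
      then have "(\<Sum>y\<in>{0..<int q}. of_bool ([crt x y = k] (mod int p)) * h (crt x y)) = (\<Sum>y\<in>{0..<int q}. h (crt k y))"
        using True by (simp only: c) simp
      moreover have "x = k mod int p" using True x by (simp add: cong_def)
      ultimately show ?thesis by simp
    next
      case False
      then have "(\<Sum>y\<in>{0..<int q}. of_bool ([crt x y = k] (mod int p)) * h (crt x y)) = 0"
        by (simp only: c) simp
      moreover have "x \<noteq> k mod int p" using False x by (auto simp: cong_def)
      ultimately show ?thesis by simp
    qed
  qed
  also have "\<dots> = (\<Sum>y\<in>{0..<int q}. h (crt k y))" using p by simp
  also have "\<dots> = (\<Sum>i\<in>{0..<int q}. h (crt k (int p * i + k)))"
  proof -
    have hc: "h (crt k a) = h (crt k b)" if "[a = b] (mod int q)" for a b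
      by (intro per) (use that in \<open>meson cong_pq_iff cong_sym cong_trans crt_cong_p crt_cong_q\<close>)
    have "(\<Sum>y\<in>{0..<int q}. h (crt k y)) = (\<Sum>y\<in>{0..<int q}. h (crt k (y + k)))"
      by (rule sum_residues_add[symmetric]) (rule hc)
    also have "\<dots> = (\<Sum>y\<in>{0..<int q}. h (crt k (int p * y + k)))"
      by (rule sum_residues_mult[symmetric, of q "\<lambda>y. h (crt k (y + k))"])
         (intro hc cong_add cong_refl, assumption, rule coprime_p_q)
    finally show ?thesis .
  qed
  also have "\<dots> = (\<Sum>i\<in>{0..<int q}. h (k + int p * i))"
  proof (intro sum.cong refl per)
    fix i
    have "[k = k + int p * i] (mod int p)" by (simp add: cong_iff_dvd_diff)
    then show "[crt k (int p * i + k) = k + int p * i] (mod int M)"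
      unfolding cong_pq_iff using crt_cong_p[of k] crt_cong_q[of k "int p * i + k"]
      by (metis add.commute cong_trans)
  qed
  finally show ?thesis .
qed

text \<open>The classes of \<open>k\<close> and \<open>-k\<close> modulo \<open>p\<close> contribute
  equally because \<open>h\<close> is even; this is the factor 2.\<close>

lemma sum_dist_coeff:
  fixes h :: "int \<Rightarrow> real"
  assumes k: "coprime k (int p)" and per: "\<And>a b. [a = b] (mod int M) \<Longrightarrow> h a = h b" and ev: "\<And>a. h (- a) = h a"
  shows "(\<Sum>a\<in>R. of_rat (dist_coeff p q qs k a) * h a) = 2 * ((\<Sum>i\<in>{0..<int q}. h (k + int p * i)) - h (int q * k))"
proof -
  let ?S = "\<lambda>g. \<Sum>a\<in>R. g a"
  let ?e = "int q * qs * k"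
  have kp: "\<not> int p dvd k" using k coprime_prime_iff by blast
  \<comment> \<open>The two classes are disjoint since \<open>p\<close> is odd, so the indicator of
    \<open>pm_cong p a k\<close> is the sum of theirs.\<close>
  have nd: "\<not> (int p dvd a - k \<and> int p dvd a + k)" for a
  proof
    assume "int p dvd a - k \<and> int p dvd a + k"
    then have "int p dvd (a + k) - (a - k)" using dvd_diff by blast
    then have "int p dvd 2 * k" by simp
    then have "int p dvd 2" using kp p prime_dvd_mult_iff[of "int p" 2 k] by simp
    then show False using p zdvd_not_zless[of 2 "int p"] by simp
  qed
  have pme: "pm_cong M a ?e \<longleftrightarrow> int q dvd a \<and> pm_cong p a k" for a
  proof -
    have e1: "[?e = k] (mod int p)" using cong_scalar_right[OF qs, of k] by simp
    have e2: "[?e = 0] (mod int q)" by (simp add: cong_0_iff)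
    have "[a = ?e] (mod int M) \<longleftrightarrow> int q dvd a \<and> [a = k] (mod int p)" for a
      unfolding cong_pq_iff using e1 e2 by (metis cong_0_iff cong_sym cong_trans)
    from this[of a] this[of "- a"] show ?thesis
      unfolding pm_cong_def by (metis (no_types, lifting) cong_minus_minus_iff dvd_minus_iff minus_minus)
  qed
  have dc: "real_of_rat (dist_coeff p q qs k a) * h a + of_bool (pm_cong M a (int q * k)) * h a
     = of_bool ([a = k] (mod int p)) * h a + of_bool ([- a = k] (mod int p)) * h a" for a
  proof -
    have 1: "of_bool ([a = k] (mod int p)) + of_bool ([- a = k] (mod int p)) = (of_bool (pm_cong p a k) :: real)"
    proof -
      have "[- a = k] (mod int p) \<longleftrightarrow> [a = - k] (mod int p)"
        by (metis cong_minus_minus_iff minus_minus)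
      then show ?thesis using nd[of a] by (auto simp: pm_cong_def cong_iff_dvd_diff)
    qed
    have "coprime a (int M) \<longleftrightarrow> \<not> int q dvd a" if "pm_cong p a k"
      using pm_cong_coprime[OF that] k coprime_pq_iff coprime_prime_iff by blast
    then have "real_of_rat (dist_coeff p q qs k a) + of_bool (pm_cong M a (int q * k)) = of_bool (pm_cong p a k)"
      unfolding dist_coeff_def pme by (auto simp: of_rat_diff of_rat_add)
    then show ?thesis unfolding 1[symmetric] by (metis distrib_right)
  qed
  have "?S (\<lambda>a. of_rat (dist_coeff p q qs k a) * h a) + ?S (\<lambda>a. of_bool (pm_cong M a (int q * k)) * h a)
    = ?S (\<lambda>a. of_bool ([a = k] (mod int p)) * h a) + ?S (\<lambda>a. of_bool ([- a = k] (mod int p)) * h a)"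
    unfolding sum.distrib[symmetric] dc ..
  moreover have "?S (\<lambda>a. of_bool (pm_cong M a (int q * k)) * h a) = 2 * h (int q * k)"
  proof (rule sum_pm_cong[OF odd_pq not_dvd_q_mult[OF k]])
    show "h a = h b" if "[a = b] (mod int M)" for a b by (rule per[OF that])
    show "h (- a) = h a" for a by (rule ev)
  qed
  moreover have "?S (\<lambda>a. of_bool ([- a = k] (mod int p)) * h a) = ?S (\<lambda>a. of_bool ([a = k] (mod int p)) * h a)"
  proof -
    have "?S (\<lambda>a. of_bool ([- 1 * a = k] (mod int p)) * h (- 1 * a)) = ?S (\<lambda>a. of_bool ([a = k] (mod int p)) * h a)"
    proof (rule sum_residues_mult[of "p * q" "\<lambda>a. of_bool ([a = k] (mod int p)) * h a" "- 1"])
      fix a b assume ab: "[a = b] (mod int M)"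
      then have "[a = k] (mod int p) \<longleftrightarrow> [b = k] (mod int p)"
        using cong_pq_iff by (meson cong_sym cong_trans)
      then show "of_bool ([a = k] (mod int p)) * h a = of_bool ([b = k] (mod int p)) * h b" using per[OF ab] by simp
    qed simp
    then show ?thesis by (simp add: ev)
  qed
  moreover have "?S (\<lambda>a. of_bool ([a = k] (mod int p)) * h a) = (\<Sum>i\<in>{0..<int q}. h (k + int p * i))"
    by (rule sum_congruent_p[OF per])
  ultimately show ?thesis by simp
qed

text \<open>The total weight does not depend on \<open>k\<close>, so differences of two such weight
  functions have coefficient sum zero.\<close>

lemma sum_dist_coeff_one:
  assumes "coprime k (int p)"
  shows "(\<Sum>a\<in>R. dist_coeff p q qs k a) = 2 * (of_nat q - 1)"
proof -
  have "real_of_rat (\<Sum>a\<in>R. dist_coeff p q qs k a) = 2 * (real q - 1)"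
    using sum_dist_coeff[OF assms, of "\<lambda>_. 1"] by (simp add: of_rat_sum)
  also have "\<dots> = real_of_rat (2 * (of_nat q - 1))" by (simp add: of_rat_diff of_rat_mult)
  finally show ?thesis by (simp only: of_rat_eq_iff)
qed

text \<open>Multiplication by \<open>t\<close> permutes the residues \<open>i\<close> modulo
  \<open>q\<close>, so the conjugate by \<open>t\<close> is the distribution relation at
  \<open>t * k\<close>.\<close>

lemma dist_coeff_log_relation:
  assumes k: "coprime k (int p)" and t: "coprime t (int M)"
  shows "(\<Sum>a\<in>R. of_rat (dist_coeff p q qs k a) * log_cyc M (t * a)) = 0"
proof -
  have tk: "\<not> int p dvd t * k" and tq: "coprime t (int q)"
    using k t coprime_pq_iff coprime_prime_iff(1) by (auto simp: prime_dvd_mult_iff p)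
  have "(\<Sum>i\<in>{0..<int q}. log_cyc M (t * (k + int p * i))) = (\<Sum>i\<in>{0..<int q}. log_cyc M (t * k + int p * (t * i)))"
    by (simp add: algebra_simps)
  also have "\<dots> = (\<Sum>i\<in>{0..<int q}. log_cyc M (t * k + int p * i))"
    by (rule sum_residues_mult[of q "\<lambda>i. log_cyc M (t * k + int p * i)"])
       (auto intro!: log_cyc_cong tq simp: cong_iff_dvd_diff simp flip: right_diff_distrib)
  also have "\<dots> = log_cyc M (int q * (t * k))" by (rule log_cyc_distribution[OF pq_pos(2,3) tk])
  also have "\<dots> = log_cyc M (t * (int q * k))" by (simp add: mult_ac)
  finally have e: "(\<Sum>i\<in>{0..<int q}. log_cyc M (t * (k + int p * i))) = log_cyc M (t * (int q * k))" .
  have "(\<Sum>a\<in>R. of_rat (dist_coeff p q qs k a) * log_cyc M (t * a))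
      = 2 * ((\<Sum>i\<in>{0..<int q}. log_cyc M (t * (k + int p * i))) - log_cyc M (t * (int q * k)))"
  proof (rule sum_dist_coeff[OF k, of "\<lambda>a. log_cyc M (t * a)"])
    show "log_cyc M (t * a) = log_cyc M (t * b)" if "[a = b] (mod int M)" for a b
      by (rule log_cyc_cong) (rule cong_scalar_left[OF that])
    show "log_cyc M (t * - a) = log_cyc M (t * a)" for a by (simp add: log_cyc_uminus)
  qed
  then show ?thesis using e by simp
qed


section \<open>The coefficients of the forms\<close>

lemma prime_to_pq_not_dvd: "coprime a (int M) \<Longrightarrow> \<not> int M dvd a"
  using coprime_prime_iff(1)[of a] coprime_pq_iff[of a] dvd_mult_left[of "int p" "int q" a] by auto

lemma orbit_element:
  assumes k: "coprime k (int p)" "coprime k (int q)" and i: "[i = 1] (mod p)" "gcd i q = 1"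
  shows "red M (k * int i) \<in> {1..M div 2}"
    and "coprime (int (red M (k * int i))) (int M)"
    and "pm_cong p (int (red M (k * int i))) k"
proof -
  let ?j = "red M (k * int i)"
  have i1: "[int i = 1] (mod int p)" using i(1) by (metis cong_int_iff of_nat_1)
  then have "coprime (int i) (int p)" by (metis cong_imp_coprime cong_sym coprime_1_left)
  moreover have "coprime (int i) (int q)" using i(2) by (metis coprime_iff_gcd_eq_1 coprime_int_iff)
  ultimately have c: "coprime (k * int i) (int M)" using k by simp
  note r = red_pm_cong[OF prime_to_pq_not_dvd[OF c] pq_pos(1)]
  show "?j \<in> {1..M div 2}" by (rule r(1))
  show "coprime (int ?j) (int M)" using pm_cong_coprime[OF r(2)] c by blast
  have "[k * int i = k * 1] (mod int p)" by (rule cong_scalar_left[OF i1])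
  then have "pm_cong p (k * int i) k" by (simp add: pm_cong_def)
  then show "pm_cong p (int ?j) k" using pm_cong_pq_imp[OF r(2)] pm_cong_trans by blast
qed

lemma cyc_orbitE:
  assumes "j \<in> cyc_orbit p q k"
  obtains i where "j = red M (k * int i)" "[i = 1] (mod p)" "gcd i q = 1"
  using assms unfolding cyc_orbit_def by (elim CollectE exE conjE) (rule that)

lemma cyc_orbit_subset:
  assumes "coprime k (int p)" "coprime k (int q)"
  shows "cyc_orbit p q k \<subseteq> {1..M div 2}"
proof
  fix j assume "j \<in> cyc_orbit p q k"
  then obtain i where "j = red M (k * int i)" "[i = 1] (mod p)" "gcd i q = 1" by (rule cyc_orbitE)
  then show "j \<in> {1..M div 2}" using orbit_element(1)[OF assms] by simp
qed

text \<open>The multiplier \<open>i\<close> is 1 modulo \<open>p\<close> and an arbitrary unit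
  modulo \<open>q\<close>; since \<open>k\<close> is invertible modulo \<open>q\<close>, the
  products \<open>k * i\<close> reach every unit congruent to \<open>k\<close> modulo
  \<open>p\<close>.\<close>

lemma cyc_orbit_iff:
  assumes k: "coprime k (int p)" "coprime k (int q)" and j: "j \<in> {1..M div 2}"
  shows "j \<in> cyc_orbit p q k \<longleftrightarrow> coprime (int j) (int M) \<and> pm_cong p (int j) k"
proof
  assume "j \<in> cyc_orbit p q k"
  then obtain i where "j = red M (k * int i)" "[i = 1] (mod p)" "gcd i q = 1" by (rule cyc_orbitE)
  then show "coprime (int j) (int M) \<and> pm_cong p (int j) k" using orbit_element[OF k] by simp
next
  assume *: "coprime (int j) (int M) \<and> pm_cong p (int j) k"
  then obtain s :: int where s: "s = 1 \<or> s = - 1" "[k = s * int j] (mod int p)"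
  proof -
    have "pm_cong p k (int j)" using * pm_cong_sym by blast
    then show ?thesis using that[of 1] that[of "- 1"] by (auto simp: pm_cong_def)
  qed
  obtain k' where k': "[k * k' = 1] (mod int q)" using cong_solve_coprime_int[OF k(2)] by blast
  \<comment> \<open>The residue that \<open>i\<close> must have modulo \<open>q\<close> for
    \<open>k * i\<close> to be congruent to \<open>s * j\<close> there; modulo \<open>p\<close> the
    choice \<open>i = 1\<close> already works.\<close>
  define y where "y = s * int j * k'"
  have "coprime (k * k') (int q)" using k' by (metis cong_imp_coprime cong_sym coprime_1_left)
  then have cy: "coprime y (int q)" using * s(1) coprime_pq_iff by (auto simp: y_def)
  define i where "i = nat (crt 1 y mod int M)"
  have ii: "int i = crt 1 y mod int M" using pq_pos by (simp add: i_def del: of_nat_mult)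
  then have ic: "[int i = crt 1 y] (mod int M)" by (simp add: cong_def)
  have ip: "[int i = 1] (mod int p)" and iq: "[int i = y] (mod int q)"
    using ic crt_cong_p[of 1 y] crt_cong_q[of 1 y] unfolding cong_pq_iff by (blast intro: cong_trans)+
  have "[k * int i = s * int j] (mod int p)" using cong_trans[OF cong_scalar_left[OF ip, of k]] s(2) by simp
  moreover have "[k * int i = s * int j] (mod int q)"
  proof -
    have "[k * int i = k * y] (mod int q)" by (rule cong_scalar_left[OF iq])
    also have "k * y = (k * k') * (s * int j)" by (simp add: y_def mult_ac)
    also have "[(k * k') * (s * int j) = 1 * (s * int j)] (mod int q)" by (rule cong_scalar_right[OF k'])
    finally show ?thesis by simp
  qed
  ultimately have e: "[k * int i = s * int j] (mod int M)" unfolding cong_pq_iff by blast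
  then have "pm_cong M (k * int i) (int j)" using s(1) by (auto simp: pm_cong_def)
  then have pm: "pm_cong M (int j) (k * int i)" by (rule pm_cong_sym)
  moreover have "\<not> int M dvd k * int i" using * pm pm_cong_coprime[OF pm] prime_to_pq_not_dvd by blast
  ultimately have "red M (k * int i) = j" using red_eq_iff[OF _ pq_pos(1) j] by blast
  moreover have "i \<in> {1..p * q}"
  proof -
    have "i \<noteq> 0" using ip p zdvd_not_zless[of 1 "int p"] by (intro notI) (auto simp: cong_iff_dvd_diff)
    moreover have "int i < int M" using ii pq_pos by (simp del: of_nat_mult)
    ultimately show ?thesis by (simp del: of_nat_mult)
  qed
  moreover have "[i = 1] (mod p)" using ip by (metis cong_int_iff of_nat_1)
  moreover have "gcd i q = 1"
  proof -
    have "coprime (int i) (int q)" using cy iq by (metis cong_imp_coprime cong_sym)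
    then show ?thesis by (metis coprime_iff_gcd_eq_1 coprime_int_iff)
  qed
  ultimately show "j \<in> cyc_orbit p q k" unfolding cyc_orbit_def by (intro CollectI exI[of _ i] conjI) auto
qed

lemma lookup_orbit_sum:
  assumes "coprime k (int p)" "coprime k (int q)"
  shows "coef (\<Sum>i\<in>cyc_orbit p q k. Yvar i) j =
    of_bool (j \<in> {2..M div 2} \<and> coprime (int j) (int M) \<and> pm_cong p (int j) k)"
proof -
  have fin: "finite (cyc_orbit p q k)" using cyc_orbit_subset[OF assms] finite_subset by blast
  have "coef (\<Sum>i\<in>cyc_orbit p q k. Yvar i) j = (\<Sum>i\<in>cyc_orbit p q k. if i = j then of_bool (j \<noteq> 1) else 0)"
    unfolding lookup_sum by (rule sum.cong) (auto simp: lookup_Yvar)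
  also have "\<dots> = of_bool (j \<in> cyc_orbit p q k \<and> j \<noteq> 1)" using fin by simp
  also have "j \<in> cyc_orbit p q k \<and> j \<noteq> 1 \<longleftrightarrow> j \<in> {2..M div 2} \<and> j \<in> cyc_orbit p q k"
    using cyc_orbit_subset[OF assms] by auto
  also have "\<dots> \<longleftrightarrow> j \<in> {2..M div 2} \<and> coprime (int j) (int M) \<and> pm_cong p (int j) k"
    using cyc_orbit_iff[OF assms, of j] by auto
  finally show ?thesis .
qed

lemma lookup_Yvar_red:
  assumes "\<not> int M dvd x"
  shows "coef (Yvar (red M x)) j = of_bool (j \<in> {2..M div 2} \<and> pm_cong M (int j) x)"
proof -
  have r: "red M x \<in> {1..M div 2}" using red_pm_cong(1)[OF assms pq_pos(1)] .
  have "red M x \<noteq> 1 \<and> red M x = j \<longleftrightarrow> j \<in> {2..M div 2} \<and> red M x = j"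
    using r by auto
  also have "\<dots> \<longleftrightarrow> j \<in> {2..M div 2} \<and> pm_cong M (int j) x"
    using red_eq_iff[OF assms pq_pos(1), of j] by auto
  finally show ?thesis by (simp add: lookup_Yvar)
qed

lemma lookup_Rform:
  assumes k: "coprime k (int p)" "coprime k (int q)"
  shows "coef (Rform p q qs k) j =
    of_bool (j \<in> {2..M div 2}) * (dist_coeff p q qs k (int j) - dist_coeff p q qs 1 (int j))"
proof -
  have c1: "coprime (1::int) (int p)" "coprime (1::int) (int q)" by auto
  have q1: "\<not> int M dvd int q * 1" by (rule not_dvd_q_mult) simp
  \<comment> \<open>So \<open>q\<close> is its own reduced residue, and the term
    \<open>Yvar q\<close> has the shape of the third sum with \<open>k = 1\<close>.\<close>
  have "q \<in> {1..M div 2}"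
  proof -
    have "2 * q \<le> p * q" using p by (intro mult_right_mono) auto
    then have "q \<le> M div 2" by (simp add: less_eq_div_iff_mult_less_eq mult.commute)
    then show ?thesis using q by simp
  qed
  then have "red M (int q * 1) = q" using red_eq_iff[OF q1 pq_pos(1)] by (simp add: pm_cong_def)
  then have "Rform p q qs k = (\<Sum>j\<in>cyc_orbit p q k. Yvar j) - (\<Sum>j\<in>cyc_orbit p q 1. Yvar j)
     - Yvar (red M (int q * k)) + Yvar (red M (int q * qs * k))
     - Yvar (red M (int q * qs * 1)) + Yvar (red M (int q * 1))" by (simp add: Rform_def)
  note * = this lookup_orbit_sum[OF k] lookup_orbit_sum[OF c1]
    lookup_Yvar_red[OF not_dvd_q_mult[OF k(1)]] lookup_Yvar_red[OF q1]
    lookup_Yvar_red[OF not_dvd_qqs_mult[OF k(1)]] lookup_Yvar_red[OF not_dvd_qqs_mult[OF c1(1)]]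
  show ?thesis
  proof (cases "j \<in> {2..M div 2}")
    case True
    then show ?thesis by (simp only: * lookup_add lookup_minus dist_coeff_def simp_thms of_bool_eq mult_1)
  next
    case False
    then show ?thesis by (simp only: * lookup_add lookup_minus simp_thms of_bool_eq)
  qed
qed

lemma dist_coeff_0:
  assumes "coprime k (int p)"
  shows "dist_coeff p q qs k 0 = 0" using not_dvd_q_mult[OF assms] not_dvd_qqs_mult[OF assms] p
  by (auto simp: dist_coeff_def pm_cong_iff_dvd)

lemma Rform_in_U_relations:
  assumes k: "coprime k (int p)" "coprime k (int q)"
  shows "Rform p q qs k \<in> U_relations M"
proof -
  let ?d = "\<lambda>a. dist_coeff p q qs k a - dist_coeff p q qs 1 a"
  have c1: "coprime (1::int) (int p)" by simp
  have d: "\<And>a b. [a = b] (mod int M) \<Longrightarrow> ?d a = ?d b" "\<And>a. ?d (- a) = ?d a"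
    using dist_coeff_cong dist_coeff_uminus by metis+
  have "(\<Sum>a\<in>R. ?d a) = 0"
    unfolding sum_subtractf sum_dist_coeff_one[OF k(1)] sum_dist_coeff_one[OF c1] by simp
  moreover have "?d 0 = 0" using dist_coeff_0[OF k(1)] dist_coeff_0[OF c1] by simp
  ultimately have z: "(\<Sum>j\<in>{1..M div 2}. ?d (int j)) = 0"
    using sum_residues_half[OF odd_pq, of ?d, OF d] by simp
  have f: "Poly_Mapping.keys (Rform p q qs k) \<subseteq> {2..M div 2}"
    by (auto simp: in_keys_iff lookup_Rform[OF k])
  have "(\<Sum>a\<in>R. of_rat (dist_coeff p q qs l a) * log_cyc M a) = 0" if "coprime l (int p)" for l
    using dist_coeff_log_relation[OF that, of 1] by simp
  from this[OF k(1)] this[OF c1] show ?thesis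
    by (subst in_U_relations_iff[OF odd_pq pq_pos(4), of ?d, OF d z f])
       (simp_all add: lookup_Rform[OF k] of_rat_diff left_diff_distrib sum_subtractf del: of_nat_mult)
qed

end

lemma cyc_reps_finite:
  assumes "p > 0" "cyc_reps p q H"
  shows "finite H"
proof -
  have "inj_on (\<lambda>k. k mod int p) H"
  proof (rule inj_onI, rule ccontr)
    fix k k' assume "k \<in> H" "k' \<in> H" "k mod int p = k' mod int p" "k \<noteq> k'"
    then show False using assms(2) unfolding cyc_reps_def by (auto simp: cong_def)
  qed
  moreover have "(\<lambda>k. k mod int p) ` H \<subseteq> {0..<int p}" using assms(1) by auto
  ultimately show ?thesis by (meson finite_atLeastLessThan_int finite_imageD finite_subset)
qed

lemma cyc_reps_unique:
  assumes "cyc_reps p q H" "k \<in> H" "k' \<in> H" "pm_cong p a k" "pm_cong p a k'"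
  shows "k = k'"
proof -
  have "pm_cong p k k'" using assms(4,5) pm_cong_sym pm_cong_trans by blast
  then show ?thesis using assms(1-3) unfolding cyc_reps_def pm_cong_def by blast
qed

lemma cyc_reps_exists:
  assumes "odd p" "cyc_reps p q H" "\<not> int p dvd a"
  shows "\<exists>k\<in>H. pm_cong p a k"
proof -
  have p: "p > 0" using assms(1) by (rule odd_pos)
  have "p div 2 = (p - 1) div 2" using assms(1) by (auto elim: oddE)
  then have "red p a \<in> {1..(p - 1) div 2}" using red_pm_cong(1)[OF assms(3) p] by simp
  then obtain k where k: "k \<in> H" "[k = int (red p a)] (mod int p)"
    using assms(2) unfolding cyc_reps_def by blast
  then have "pm_cong p k (int (red p a))" by (simp add: pm_cong_def)
  then have "pm_cong p a k" using red_pm_cong(2)[OF assms(3) p] pm_cong_sym pm_cong_trans by blast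
  then show ?thesis using k by blast
qed

lemma sum_cyc_reps:
  fixes F :: "int \<Rightarrow> rat"
  assumes p: "odd p" "cyc_reps p q H" and a: "\<not> int p dvd a"
    and F: "\<And>k. k \<in> H \<Longrightarrow> pm_cong p a k \<Longrightarrow> F k = x"
  shows "(\<Sum>k\<in>H. F k * of_bool (pm_cong p a k)) = x"
proof -
  have fin: "finite H" using cyc_reps_finite[OF odd_pos[OF p(1)] p(2)] .
  obtain k where k: "k \<in> H" "pm_cong p a k" using cyc_reps_exists[OF p a] by blast
  have "(\<Sum>l\<in>H. F l * of_bool (pm_cong p a l)) = (\<Sum>l\<in>H. if l = k then F k else 0)"
    by (rule sum.cong[OF refl]) (use cyc_reps_unique[OF p(2)] k in auto)
  then show ?thesis using fin k F by simp
qed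

section \<open>Linear independence\<close>

locale two_primes_reps = two_primes +
  fixes Hp Hq :: "int set"
  assumes Hp: "cyc_reps p q Hp" "1 \<in> Hp" "\<And>k. k \<in> Hp \<Longrightarrow> coprime k (int p)"
    and Hq: "cyc_reps q p Hq" "1 \<in> Hq" "\<And>l. l \<in> Hq \<Longrightarrow> coprime l (int q)"
begin

abbreviation combination :: "(int \<Rightarrow> rat) \<Rightarrow> (int \<Rightarrow> rat) \<Rightarrow> (nat \<Rightarrow>\<^sub>0 rat)" where
  "combination u v \<equiv> (\<Sum>k\<in>Hp - {1}. lf_scale (u k) (Rform p q qs k)) + (\<Sum>l\<in>Hq - {1}. lf_scale (v l) (Rform q p ps l))"

lemma finite_reps: "finite Hp" "finite Hq" using cyc_reps_finite pq_pos Hp Hq by blast+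

lemma odd_primes: "odd p" "odd q" using odd_pq by auto

lemma coprime_reps:
  "k \<in> Hp \<Longrightarrow> coprime k (int p)" "k \<in> Hp \<Longrightarrow> coprime k (int q)"
  "l \<in> Hq \<Longrightarrow> coprime l (int p)" "l \<in> Hq \<Longrightarrow> coprime l (int q)"
  using Hp Hq unfolding cyc_reps_def by (auto simp: coprime_iff_gcd_eq_1)

lemma lookup_Rform_combination:
  fixes u v :: "int \<Rightarrow> rat"
  shows "coef (combination u v) j
    = of_bool (j \<in> {2..M div 2}) *
      ((\<Sum>k\<in>Hp - {1}. u k * (dist_coeff p q qs k (int j) - dist_coeff p q qs 1 (int j)))
       + (\<Sum>l\<in>Hq - {1}. v l * (dist_coeff q p ps l (int j) - dist_coeff q p ps 1 (int j))))"
proof -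
  have "coef (Rform p q qs k) j = of_bool (j \<in> {2..M div 2}) * (dist_coeff p q qs k (int j) - dist_coeff p q qs 1 (int j))"
    if "k \<in> Hp - {1}" for k using lookup_Rform coprime_reps that by blast
  moreover have "coef (Rform q p ps l) j = of_bool (j \<in> {2..M div 2}) * (dist_coeff q p ps l (int j) - dist_coeff q p ps 1 (int j))"
    if "l \<in> Hq - {1}" for l
    using two_primes.lookup_Rform[OF swap, unfolded mult.commute[of q p]] coprime_reps that by blast
  ultimately show ?thesis
    by (simp add: lookup_add lookup_sum sum_distrib_left distrib_left mult.left_commute del: atLeastAtMost_iff)
qed

text \<open>On units the combination is \<open>A a + B a\<close>, where \<open>A\<close> sees only
  \<open>a mod p\<close> and \<open>B\<close> only \<open>a mod q\<close>. Independent choice of the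
  components makes both constant; the values of \<open>A\<close> at the representatives then force
  \<open>A = 0\<close>, hence \<open>B = 0\<close>.\<close>

lemma Rform_independent:
  fixes u v :: "int \<Rightarrow> rat"
  assumes "combination u v = 0"
  shows "(\<forall>k\<in>Hp - {1}. u k = 0) \<and> (\<forall>l\<in>Hq - {1}. v l = 0)"
proof -
  define A where "A = (\<lambda>a. \<Sum>k\<in>Hp - {1}. u k * (of_bool (pm_cong p a k) - of_bool (pm_cong p a 1)))"
  define B where "B = (\<lambda>a. \<Sum>l\<in>Hq - {1}. v l * (of_bool (pm_cong q a l) - of_bool (pm_cong q a 1)))"
  have Aev: "A a = A b" if "pm_cong p a b" for a b
  proof -
    have "pm_cong p a k \<longleftrightarrow> pm_cong p b k" for k using that pm_cong_sym pm_cong_trans by blast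
    then show ?thesis by (simp add: A_def)
  qed
  have Bev: "B a = B b" if "pm_cong q a b" for a b
  proof -
    have "pm_cong q a k \<longleftrightarrow> pm_cong q b k" for k using that pm_cong_sym pm_cong_trans by blast
    then show ?thesis by (simp add: B_def)
  qed
  \<comment> \<open>The coefficient at 1 is lost by the convention \<open>Y 1 = 0\<close>, so this
    equation is available only away from the residues 1 and -1.\<close>
  have AB: "A a + B a = 0" if a: "coprime a (int M)" "\<not> pm_cong M a 1" for a
  proof -
    note r = red_pm_cong[OF prime_to_pq_not_dvd[OF a(1)] pq_pos(1)]
    let ?j = "red M a"
    have "?j \<noteq> 1" using r(2) a(2) pm_cong_sym by force
    then have j: "?j \<in> {2..M div 2}" using r(1) by auto
    have c: "coprime (int ?j) (int M)" using pm_cong_coprime[OF r(2)] a(1) by blast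
    have "0 = coef (combination u v) ?j" using assms by simp
    also have "\<dots> = A (int ?j) + B (int ?j)"
      unfolding lookup_Rform_combination A_def B_def dist_coeff_unit[OF c]
        two_primes.dist_coeff_unit[OF swap, unfolded mult.commute[of q p], OF c] using j by simp
    also have "\<dots> = A a + B a" using Aev Bev pm_cong_pq_imp[OF r(2)] by metis
    finally show ?thesis by simp
  qed
  have AB': "A x + B y = 0" if "coprime x (int p)" "coprime y (int q)" for x y
  proof -
    have AB1: "A x + B z = 0" if "coprime z (int q)" "\<not> pm_cong M (crt x z) 1" for z
    proof -
      have "A (crt x z) + B (crt x z) = 0" using AB coprime_crt_iff \<open>coprime x (int p)\<close> that by blast
      moreover have "A (crt x z) = A x" using Aev crt_cong_p pm_cong_def by blast
      moreover have "B (crt x z) = B z" using Bev crt_cong_q pm_cong_def by blast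
      ultimately show ?thesis by simp
    qed
    have two: False if "[z = 1] (mod int n)" "[z = - 1] (mod int n)" "n \<ge> 3" for z n
    proof -
      have "int n dvd (z + 1) - (z - 1)" using that(1,2) unfolding cong_iff_dvd_diff by (metis diff_minus_eq_add dvd_diff)
      then show False using that(3) zdvd_not_zless[of 2 "int n"] by simp
    qed
    show ?thesis
    proof (cases "pm_cong M (crt x y) 1")
      case False
      then show ?thesis using AB1 that by blast
    next
      case True
      \<comment> \<open>If \<open>(x, y)\<close> is an excluded residue, \<open>(x, -y)\<close> is
        not, since 1 and -1 differ modulo both primes; and \<open>B\<close> does not see the sign of
        \<open>y\<close>.\<close>
      have "\<not> pm_cong M (crt x (- y)) 1"
      proof
        assume *: "pm_cong M (crt x (- y)) 1"
        have x1: "[crt x y = s] (mod int M) \<Longrightarrow> [x = s] (mod int p) \<and> [y = s] (mod int q)" for s y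
          unfolding cong_pq_iff using crt_cong_p crt_cong_q by (meson cong_sym cong_trans)
        have neg: "[- y = s] (mod int q) \<Longrightarrow> [y = - s] (mod int q)" for s
          by (metis cong_minus_minus_iff minus_minus)
        from True * show False unfolding pm_cong_def using x1 neg two p(2) q(2) by (metis minus_minus)
      qed
      then have "A x + B (- y) = 0" using AB1[of "- y"] that by simp
      moreover have "B (- y) = B y" by (rule Bev) (simp add: pm_cong_def)
      ultimately show ?thesis by simp
    qed
  qed
  have pm1: "pm_cong n k k" for n k by (simp add: pm_cong_def)
  have valA: "A k = u k" if k: "k \<in> Hp - {1}" for k
  proof -
    have "\<not> pm_cong p k 1" using cyc_reps_unique[OF Hp(1) _ Hp(2) pm1, of k] k by blast
    then have "A k = (\<Sum>l\<in>Hp - {1}. if l = k then u k else 0)"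
      unfolding A_def by (intro sum.cong refl) (use cyc_reps_unique[OF Hp(1) _ _ pm1] k pm1 in auto)
    then show ?thesis using k finite_reps by simp
  qed
  have A1: "A 1 = - (\<Sum>k\<in>Hp - {1}. u k)"
  proof -
    have "\<not> pm_cong p 1 k" if "k \<in> Hp - {1}" for k using cyc_reps_unique[OF Hp(1) Hp(2) _ pm1, of k] that by blast
    then show ?thesis unfolding A_def using pm1 by (simp add: sum_negf)
  qed
  have Aconst: "A k = A 1" if "coprime k (int p)" for k using AB'[OF that, of 1] AB'[of 1 1] by simp
  \<comment> \<open>\<open>A\<close> has the value \<open>u k\<close> at each other representative
    \<open>k\<close> and minus the sum of these values at 1; a constant with this property is
    0.\<close>
  have "A 1 = - (of_nat (card (Hp - {1})) * A 1)"
    using A1 valA Aconst coprime_reps by (metis (no_types, lifting) DiffD1 sum.cong sum_constant)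
  then have "(1 + of_nat (card (Hp - {1}))) * A 1 = 0" by (simp add: distrib_right)
  then have A0: "A 1 = 0" by (simp add: add_eq_0_iff_both_eq_0)
  have valB: "B l = v l" if l: "l \<in> Hq - {1}" for l
  proof -
    have "\<not> pm_cong q l 1" using cyc_reps_unique[OF Hq(1) _ Hq(2) pm1, of l] l by blast
    then have "B l = (\<Sum>k\<in>Hq - {1}. if k = l then v l else 0)"
      unfolding B_def by (intro sum.cong refl) (use cyc_reps_unique[OF Hq(1) _ _ pm1] l pm1 in auto)
    then show ?thesis using l finite_reps by simp
  qed
  show ?thesis
  proof (intro conjI ballI)
    show "u k = 0" if "k \<in> Hp - {1}" for k using valA[OF that] Aconst coprime_reps(1) that A0 by auto
    show "v l = 0" if "l \<in> Hq - {1}" for l using valB[OF that] AB'[of 1 l] coprime_reps(4) that A0 by auto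
  qed
qed

end

section \<open>Spanning\<close>

lemma sum_minus_combinations:
  fixes x :: "'a \<Rightarrow> 'b::comm_ring_1"
  shows "(\<Sum>a\<in>R. x a - (\<Sum>k\<in>H. F k * P k a) - (\<Sum>l\<in>K. G l * Q l a))
    = (\<Sum>a\<in>R. x a) - (\<Sum>k\<in>H. F k * (\<Sum>a\<in>R. P k a)) - (\<Sum>l\<in>K. G l * (\<Sum>a\<in>R. Q l a))"
  unfolding sum_distrib_left sum_subtractf sum.swap[of "\<lambda>a k. F k * P k a" H R] sum.swap[of "\<lambda>a l. G l * Q l a" K R] ..

context two_primes
begin

lemma log_relation_of_sum:
  fixes d :: "int \<Rightarrow> rat"
  assumes per: "\<And>a b. [a = b] (mod int M) \<Longrightarrow> d a = d b" and ev: "\<And>a. d (- a) = d a"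
    and rel: "\<And>t. coprime t (int M) \<Longrightarrow> (\<Sum>a\<in>R. of_rat (d a) * log_cyc M (t * a)) = 0"
  shows "log_relation (\<lambda>a. of_real (of_rat (d a)))" unfolding log_relation_def
proof (intro conjI allI impI)
  show "complex_of_real (of_rat (d a)) = of_real (of_rat (d b))" if "[a = b] (mod int M)" for a b
    using per[OF that] by simp
  show "complex_of_real (of_rat (d (- a))) = of_real (of_rat (d a))" for a by (simp add: ev)
  fix t assume "coprime t (int M)"
  then show "(\<Sum>a\<in>R. complex_of_real (of_rat (d a)) * of_real (log_cyc M (t * a))) = 0"
    unfolding of_real_mult[symmetric] of_real_sum[symmetric] by (subst rel) simp_all
qed

lemma crt_uminus: "crt (- x) (- y) = - crt x y" by (simp add: crt_def)

text \<open>Evenness of \<open>d\<close> only allows changing both signs at once, whereas the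
  representatives are taken up to sign modulo each prime separately. The additive splitting makes
  the two parts even one by one.\<close>

lemma unit_part_splits:
  fixes d :: "int \<Rightarrow> rat"
  assumes per: "\<And>a b. [a = b] (mod int M) \<Longrightarrow> d a = d b" and ev: "\<And>a. d (- a) = d a"
    and rel: "log_relation (\<lambda>a. of_real (of_rat (d a)))"
  shows "coprime a (int M) \<Longrightarrow> d a = d (crt a 1) + d (crt 1 a) - d (crt 1 1)"
    and "coprime x (int p) \<Longrightarrow> pm_cong p x x' \<Longrightarrow> d (crt x' 1) = d (crt x 1)"
    and "coprime y (int q) \<Longrightarrow> pm_cong q y y' \<Longrightarrow> d (crt 1 y') = d (crt 1 y)"
proof -
  let ?W = "\<lambda>x y. d (crt x y)"
  have W: "?W x y = ?W x 1 + ?W 1 y - ?W 1 1" if "coprime x (int p)" "coprime y (int q)" for x y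
  proof -
    have "complex_of_real (of_rat (?W x y)) - of_real (of_rat (?W x 1)) = of_real (of_rat (?W 1 y)) - of_real (of_rat (?W 1 1))"
      using log_relation_unit_part[OF rel that(1) _ that(2), of 1 1] by simp
    then have "real_of_rat (?W x y - ?W x 1) = of_rat (?W 1 y - ?W 1 1)"
      unfolding of_rat_diff by (metis of_real_diff of_real_eq_iff)
    then show ?thesis unfolding of_rat_eq_iff by (simp add: algebra_simps)
  qed
  have Wc: "?W x y = ?W x' y'" if "[x = x'] (mod int p)" "[y = y'] (mod int q)" for x x' y y'
    by (rule per) (use that crt_cong_p crt_cong_q in \<open>meson cong_pq_iff cong_sym cong_trans\<close>)
  have Wm: "?W (- x) (- y) = ?W x y" for x y unfolding crt_uminus by (rule ev)
  \<comment> \<open>Both values are equal by evenness, and the splitting at \<open>(-1, -1)\<close>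
    makes their sum twice the value at \<open>(1, 1)\<close>.\<close>
  have m1: "?W 1 (- 1) = ?W 1 1" "?W (- 1) 1 = ?W 1 1"
    using W[of "- 1" "- 1"] Wm[of 1 1] Wm[of 1 "- 1"] by simp_all
  have X: "?W (- x) 1 = ?W x 1" if "coprime x (int p)" for x
    using Wm[of x "- 1"] W[of x "- 1"] that m1 by simp
  have Y: "?W 1 (- y) = ?W 1 y" if "coprime y (int q)" for y
    using Wm[of "- 1" y] W[of "- 1" y] that m1 by simp
  show "d a = ?W a 1 + ?W 1 a - ?W 1 1" if "coprime a (int M)"
  proof -
    have "[a = crt a a] (mod int M)" unfolding cong_pq_iff using crt_cong_p crt_cong_q cong_sym by blast
    then have "d a = ?W a a" by (rule per)
    then show ?thesis using W[of a a] that coprime_pq_iff by simp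
  qed
  show "?W x' 1 = ?W x 1" if x: "coprime x (int p)" "pm_cong p x x'"
  proof -
    have "pm_cong p x' x" using x(2) by (rule pm_cong_sym)
    then have "?W x' 1 = ?W x 1 \<or> ?W x' 1 = ?W (- x) 1" unfolding pm_cong_def using Wc cong_refl by blast
    then show ?thesis using X[OF x(1)] by auto
  qed
  show "?W 1 y' = ?W 1 y" if y: "coprime y (int q)" "pm_cong q y y'"
  proof -
    have "pm_cong q y' y" using y(2) by (rule pm_cong_sym)
    then have "?W 1 y' = ?W 1 y \<or> ?W 1 y' = ?W 1 (- y)" unfolding pm_cong_def using Wc cong_refl by blast
    then show ?thesis using Y[OF y(1)] by auto
  qed
qed

text \<open>The coefficients of a form, made into an even function on the residues modulo \<open>p q\<close>: the
  missing coefficient of \<open>Y\<^sub>1\<close> is chosen so that all coefficients add up to zero.\<close>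

lemma even_extension:
  assumes f: "f \<in> U_relations M"
  obtains d :: "int \<Rightarrow> rat" where "\<And>a b. [a = b] (mod int M) \<Longrightarrow> d a = d b" "\<And>a. d (- a) = d a" "d 0 = 0"
    "\<And>j. j \<in> {2..M div 2} \<Longrightarrow> coef f j = d (int j)"
    "(\<Sum>j\<in>{1..M div 2}. d (int j)) = 0"
proof -
  let ?c = "\<lambda>j. if j = 1 then - (\<Sum>i\<in>{2..M div 2}. coef f i) else coef f j"
  define d where "d = (\<lambda>a. if int M dvd a then 0 else ?c (red M a))"
  have red_pm: "d a = d b" if "pm_cong M a b" for a b
  proof -
    have i: "int M dvd a \<longleftrightarrow> int M dvd b"
      using that unfolding pm_cong_def by (metis cong_dvd_iff cong_sym dvd_minus_iff)
    show ?thesis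
    proof (cases "int M dvd a")
      case False
      have "pm_cong M (int (red M b)) a" using red_pm_cong(2)[of M b] False i pq_pos(1) that pm_cong_sym pm_cong_trans by blast
      then have "red M a = red M b" using red_eq_iff[OF False pq_pos(1)] red_pm_cong(1)[of M b] False i pq_pos(1) by blast
      then show ?thesis using i by (simp add: d_def)
    qed (use i in \<open>simp add: d_def\<close>)
  qed
  have dj: "d (int j) = ?c j" if j: "j \<in> {1..M div 2}" for j
  proof -
    have "\<not> int M dvd int j" using j by (auto simp del: of_nat_mult dest: dvd_imp_le)
    moreover from this have "red M (int j) = j" using red_eq_iff[OF _ pq_pos(1) j] by (simp add: pm_cong_def)
    ultimately show ?thesis unfolding d_def by (simp del: of_nat_mult)
  qed
  have "{1..M div 2} = insert 1 {2..M div 2}" using pq_pos(4) by auto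
  then have "(\<Sum>j\<in>{1..M div 2}. d (int j)) = (\<Sum>j\<in>insert 1 {2..M div 2}. ?c j)"
    using dj by (intro sum.cong) auto
  also have "\<dots> = 0" by simp
  finally have z: "(\<Sum>j\<in>{1..M div 2}. d (int j)) = 0" .
  show ?thesis
  proof (rule that[of d])
    show "d a = d b" if "[a = b] (mod int M)" for a b by (rule red_pm) (use that in \<open>simp only: pm_cong_def simp_thms\<close>)
    show "d (- a) = d a" for a by (rule red_pm) (simp add: pm_cong_def)
    show "d 0 = 0" by (simp add: d_def)
    show "coef f j = d (int j)" if "j \<in> {2..M div 2}" for j using dj[of j] that by simp
  qed (rule z)
qed

end

context two_primes_reps
begin

lemma Rform_spanning:
  assumes f: "f \<in> U_relations M"
  shows "\<exists>u v. f = combination u v"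
proof -
  let ?P = "dist_coeff p q qs" and ?Q = "dist_coeff q p ps"
  note swp = mult.commute[of q p]
  obtain d :: "int \<Rightarrow> rat" where d: "\<And>a b. [a = b] (mod int M) \<Longrightarrow> d a = d b" "\<And>a. d (- a) = d a" and d0: "d 0 = 0"
    and dl: "\<And>j. j \<in> {2..M div 2} \<Longrightarrow> coef f j = d (int j)"
    and ds: "(\<Sum>j\<in>{1..M div 2}. d (int j)) = 0" using even_extension[OF f] by blast
  have fk: "Poly_Mapping.keys f \<subseteq> {2..M div 2}" using f by (simp add: U_relations_def)
  have d_rel: "(\<Sum>a\<in>R. of_rat (d a) * log_cyc M (t * a)) = 0" if "coprime t (int M)" for t
    using in_U_relations_iff[OF odd_pq pq_pos(4) d ds fk dl] f log_cyc_galois[OF pq_pos(1) _ that, of d] by blast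
  have d_sum: "(\<Sum>a\<in>R. d a) = 0" using sum_residues_half[OF odd_pq, of d, OF d] d0 ds by simp
  have d_log: "log_relation (\<lambda>a. of_real (of_rat (d a)))"
    by (rule log_relation_of_sum) (erule d(1), rule d(2), erule d_rel)
  have split1: "d a = d (crt a 1) + d (crt 1 a) - d (crt 1 1)" if "coprime a (int M)" for a
    by (rule unit_part_splits(1)[OF _ _ d_log that]) (erule d(1), rule d(2))
  have split2: "d (crt x' 1) = d (crt x 1)" if "coprime x (int p)" "pm_cong p x x'" for x x'
    by (rule unit_part_splits(2)[OF _ _ d_log that]) (erule d(1), rule d(2))
  have split3: "d (crt 1 y') = d (crt 1 y)" if "coprime y (int q)" "pm_cong q y y'" for y y'
    by (rule unit_part_splits(3)[OF _ _ d_log that]) (erule d(1), rule d(2))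
  \<comment> \<open>The splitting of \<open>d\<close> on units into \<open>F\<close> and
    \<open>G\<close> is unique up to a constant; \<open>\<mu>\<close> spends this freedom on making
    the sum of \<open>F\<close> over \<open>Hp\<close> zero.\<close>
  define \<mu> where "\<mu> = (\<Sum>k\<in>Hp. d (crt k 1)) / of_nat (card Hp)"
  define F where "F = (\<lambda>x. d (crt x 1) - \<mu>)"
  define G where "G = (\<lambda>y. d (crt 1 y) - d (crt 1 1) + \<mu>)"
  have "card Hp > 0" using finite_reps Hp(2) card_gt_0_iff by blast
  then have F_sum: "(\<Sum>k\<in>Hp. F k) = 0" by (simp add: F_def \<mu>_def sum_subtractf)
  \<comment> \<open>What remains after subtracting full distribution relations, \<open>k = 1\<close>
    and \<open>l = 1\<close> included. It vanishes first on units, then everywhere.\<close>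
  define e where "e = (\<lambda>a. d a - (\<Sum>k\<in>Hp. F k * ?P k a) - (\<Sum>l\<in>Hq. G l * ?Q l a))"
  have Qc: "?Q l a = ?Q l b" if "[a = b] (mod int M)" for l a b
    using two_primes.dist_coeff_cong[OF swap, unfolded swp, OF that] .
  have Qm: "?Q l (- a) = ?Q l a" for l a by (rule two_primes.dist_coeff_uminus[OF swap])
  have e_per: "e a = e b" if "[a = b] (mod int M)" for a b
    unfolding e_def d(1)[OF that] dist_coeff_cong[OF that] Qc[OF that] ..
  have e_ev: "e (- a) = e a" for a unfolding e_def d(2) dist_coeff_uminus Qm ..
  have e_rel: "(\<Sum>a\<in>R. of_rat (e a) * log_cyc M (t * a)) = 0" if t: "coprime t (int M)" for t
  proof -
    let ?v = "\<lambda>a. log_cyc M (t * a)"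
    have "of_rat (e a) * ?v a = of_rat (d a) * ?v a - (\<Sum>k\<in>Hp. of_rat (F k) * (of_rat (?P k a) * ?v a))
        - (\<Sum>l\<in>Hq. of_rat (G l) * (of_rat (?Q l a) * ?v a))" for a
      by (simp add: e_def of_rat_diff of_rat_sum of_rat_mult left_diff_distrib sum_distrib_right mult.assoc)
    then have "(\<Sum>a\<in>R. real_of_rat (e a) * ?v a) = (\<Sum>a\<in>R. of_rat (d a) * ?v a)
        - (\<Sum>k\<in>Hp. of_rat (F k) * (\<Sum>a\<in>R. of_rat (?P k a) * ?v a))
        - (\<Sum>l\<in>Hq. of_rat (G l) * (\<Sum>a\<in>R. of_rat (?Q l a) * ?v a))"
      by (simp only: sum_minus_combinations)
    also have "\<dots> = 0" using d_rel[OF t] dist_coeff_log_relation[OF _ t] coprime_reps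
        two_primes.dist_coeff_log_relation[OF swap, unfolded swp, OF _ t] by simp
    finally show ?thesis .
  qed
  have e_unit: "e a = 0" if a: "coprime a (int M)" for a
  proof -
    have ap: "coprime a (int p)" "coprime a (int q)" using a coprime_pq_iff by blast+
    have "(\<Sum>k\<in>Hp. F k * of_bool (pm_cong p a k)) = F a"
      by (rule sum_cyc_reps[OF odd_primes(1) Hp(1)]) (use ap coprime_prime_iff split2[OF ap(1)] in \<open>auto simp: F_def\<close>)
    moreover have "(\<Sum>l\<in>Hq. G l * of_bool (pm_cong q a l)) = G a"
      by (rule sum_cyc_reps[OF odd_primes(2) Hq(1)]) (use ap coprime_prime_iff split3[OF ap(2)] in \<open>auto simp: G_def\<close>)
    ultimately have "e a = d a - F a - G a"
      unfolding e_def dist_coeff_unit[OF a] two_primes.dist_coeff_unit[OF swap, unfolded swp, OF a] by simp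
    then show ?thesis using split1[OF a] by (simp add: F_def G_def)
  qed
  have e_log: "log_relation (\<lambda>a. of_real (of_rat (e a)))"
    by (rule log_relation_of_sum) (erule e_per, rule e_ev, erule e_rel)
  have e0: "e a = 0" if "\<not> int M dvd a" for a
    by (rule rational_log_relation_nonunit[OF e_log _ that]) (erule e_unit)
  have P0: "?P k 0 = 0" if "k \<in> Hp" for k using dist_coeff_0 coprime_reps(1) that by blast
  have Q0: "?Q l 0 = 0" if "l \<in> Hq" for l using two_primes.dist_coeff_0[OF swap] coprime_reps(4) that by blast
  have "e 0 = 0" using d0 P0 Q0 by (simp add: e_def)
  then have e_zero: "e a = 0" if "a \<in> R" for a
    using e0 that zdvd_not_zless[of a "int M"] by (cases "a = 0") (auto simp del: of_nat_mult)
  \<comment> \<open>No freedom is left for \<open>G\<close>, but comparing total weights determines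
    its sum: \<open>d\<close> and the \<open>F\<close> part contribute zero, and each relation
    modulo \<open>q\<close> has weight \<open>2 * (p - 1)\<close>.\<close>
  have "(\<Sum>l\<in>Hq. G l) * (2 * (of_nat p - 1)) = 0"
  proof -
    have "0 = (\<Sum>a\<in>R. e a)" using e_zero by simp
    also have "\<dots> = (\<Sum>a\<in>R. d a) - (\<Sum>k\<in>Hp. F k * (\<Sum>a\<in>R. ?P k a))
        - (\<Sum>l\<in>Hq. G l * (\<Sum>a\<in>R. ?Q l a))" unfolding e_def by (rule sum_minus_combinations)
    also have "(\<Sum>k\<in>Hp. F k * (\<Sum>a\<in>R. ?P k a)) = (\<Sum>k\<in>Hp. F k) * (2 * (of_nat q - 1))"
      unfolding sum_distrib_right using sum_dist_coeff_one coprime_reps(1) by (intro sum.cong refl) auto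
    also have "(\<Sum>l\<in>Hq. G l * (\<Sum>a\<in>R. ?Q l a)) = (\<Sum>l\<in>Hq. G l) * (2 * (of_nat p - 1))"
      unfolding sum_distrib_right using two_primes.sum_dist_coeff_one[OF swap, unfolded swp] coprime_reps(4)
      by (intro sum.cong refl) auto
    finally show ?thesis using d_sum F_sum by simp
  qed
  then have G_sum: "(\<Sum>l\<in>Hq. G l) = 0" using p by auto
  \<comment> \<open>With coefficients of sum zero, combining the full relations is the same as
    combining their differences from the one at 1.\<close>
  have rem1: "(\<Sum>k\<in>H - {1}. u k * (x k - x 1)) = (\<Sum>k\<in>H. u k * x k)"
    if "finite H" "1 \<in> H" "(\<Sum>k\<in>H. u k) = 0" for H :: "int set" and u x :: "int \<Rightarrow> rat"
  proof -
    have "(\<Sum>k\<in>H - {1}. u k * (x k - x 1)) = (\<Sum>k\<in>H. u k * (x k - x 1))"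
      by (rule sum.mono_neutral_left) (use that in auto)
    also have "\<dots> = (\<Sum>k\<in>H. u k * x k) - (\<Sum>k\<in>H. u k) * x 1"
      by (simp add: right_diff_distrib sum_subtractf sum_distrib_right)
    finally show ?thesis using that by simp
  qed
  have "f = combination F G"
  proof (rule poly_mapping_eqI)
    fix j
    show "coef f j = coef (combination F G) j"
    proof (cases "j \<in> {2..M div 2}")
      case True
      then have "int j \<in> R" by (auto simp del: of_nat_mult)
      then have "d (int j) = (\<Sum>k\<in>Hp. F k * ?P k (int j)) + (\<Sum>l\<in>Hq. G l * ?Q l (int j))"
        using e_zero[of "int j"] by (simp add: e_def)
      then show ?thesis
        unfolding lookup_Rform_combination rem1[OF finite_reps(1) Hp(2) F_sum, of "\<lambda>k. ?P k (int j)"]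
          rem1[OF finite_reps(2) Hq(2) G_sum, of "\<lambda>l. ?Q l (int j)"] using dl[OF True] True by simp
    next
      case False
      then have "coef f j = 0" using fk by (auto simp: in_keys_iff)
      then show ?thesis unfolding lookup_Rform_combination using False by (simp del: atLeastAtMost_iff)
    qed
  qed
  then show ?thesis by blast
qed

theorem Rform_basis:
  "lf_basis (case_sum (Rform p q qs) (Rform q p ps)) ((Hp - {1}) <+> (Hq - {1})) (U_relations M)"
proof (rule lf_basis_finiteI)
  let ?B = "case_sum (Rform p q qs) (Rform q p ps)" and ?I = "(Hp - {1}) <+> (Hq - {1})"
  have fin: "finite (Hp - {1})" "finite (Hq - {1})" using finite_reps by auto
  show "finite ?I" using fin by simp
  show "lf.subspace (U_relations M)" by (rule subspace_U_relations)
  have split: "(\<Sum>i\<in>?I. lf_scale (u i) (?B i)) = (\<Sum>k\<in>Hp - {1}. lf_scale (u (Inl k)) (Rform p q qs k))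
      + (\<Sum>l\<in>Hq - {1}. lf_scale (u (Inr l)) (Rform q p ps l))" for u using fin by (simp add: sum.Plus)
  show "?B i \<in> U_relations M" if "i \<in> ?I" for i
    using that Rform_in_U_relations coprime_reps two_primes.Rform_in_U_relations[OF swap, unfolded mult.commute[of q p]]
    by auto
  show "u i = 0" if "(\<Sum>i\<in>?I. lf_scale (u i) (?B i)) = 0" "i \<in> ?I" for u i
    using Rform_independent[of "\<lambda>k. u (Inl k)" "\<lambda>l. u (Inr l)"] that unfolding split by auto
  show "\<exists>u. v = (\<Sum>i\<in>?I. lf_scale (u i) (?B i))" if v: "v \<in> U_relations M" for v
  proof -
    obtain F G where FG: "v = combination F G" using Rform_spanning[OF v] by blast
    show ?thesis by (rule exI[of _ "case_sum F G"]) (simp add: split FG)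
  qed
qed

end

theorem theorem4:
  fixes p q m :: nat and Hp Hq :: "int set" and qs ps :: int
  assumes "prime p" "prime q" "p \<ge> 3" "q \<ge> 3" "p \<noteq> q"
    and "m = p * q"
    and "cyc_reps p q Hp" "cyc_reps q p Hq"
    and "1 \<in> Hp" "1 \<in> Hq"
    \<comment> \<open>the subscripts of the form \<open>red m (q * k)\<close> and \<open>red m (p * l)\<close> are well-defined\<close>
    and "\<forall>k\<in>Hp - {1}. \<not> [int q * k = 0] (mod int m)"
    and "\<forall>l\<in>Hq - {1}. \<not> [int p * l = 0] (mod int m)"
    and "[int q * qs = 1] (mod int p)" "[int p * ps = 1] (mod int q)"
  shows "lf_basis (case_sum (Rform p q qs) (Rform q p ps))
           ((Hp - {1}) <+> (Hq - {1})) (U_relations m)"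
proof -
  interpret two_primes p q qs ps by unfold_locales (use assms in auto)
  \<comment> \<open>\<open>cyc_reps\<close> alone would admit a representative divisible by
    \<open>p\<close>; for it \<open>q * k\<close> would be a multiple of \<open>m\<close>, which the
    hypothesis on the subscripts rules out.\<close>
  have "coprime k (int p)" if "k \<in> Hp" for k
  proof (cases "k = 1")
    case False
    then have "\<not> int (p * q) dvd int q * k" using assms(6,11) that by (auto simp: cong_0_iff)
    then have "\<not> int p dvd k" by (metis dvd_refl mult.commute mult_dvd_mono of_nat_mult)
    then show ?thesis using coprime_prime_iff by blast
  qed simp
  moreover have "coprime l (int q)" if "l \<in> Hq" for l
  proof (cases "l = 1")
    case False
    then have "\<not> int (p * q) dvd int p * l" using assms(6,12) that by (auto simp: cong_0_iff)
    then have "\<not> int q dvd l" by (metis dvd_refl mult_dvd_mono of_nat_mult)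
    then show ?thesis using coprime_prime_iff by blast
  qed simp
  ultimately interpret two_primes_reps p q qs ps Hp Hq using assms by unfold_locales auto
  show ?thesis unfolding assms(6) by (rule Rform_basis)
qed

end
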